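(* Let $b \in H^\infty$ with $\|b\|_\infty \leq 1$, and let $X_b:\mathcal H(b)\to\mathcal H(b)$ be the restriction of the backward shift to the de Branges-Rovnyak space $\mathcal H(b)$. Then the following hold. (1) If $b$ is an extreme point of $H^\infty_1$, then $X_b \notin B_n(\Omega)$ for every integer $n\geq 1$ and every nonempty open set $\Omega\subseteq\mathbb{C}$. (2) If $b$ is a non-extreme point of $H^\infty_1$, then $X_b \in B_1(\mathbb D)$.
   Context: $\mathbb D=\{z\in\mathbb C:|z|<1\}$, $\mathbb T=\partial\mathbb D$, $m$ is Lebesgue measure on $\mathbb T$. $H^2$ is the Hardy space of analytic functions on $\mathbb D$ with square-summable Taylor coefficients, $H^\infty$ is the algebra of bounded analytic functions on $\mathbb D$ with the supremum norm, and $H^\infty_1=\{b\in H^\infty:\|b\|_\infty\leq 1\}$. For $b\in H^\infty_1$, $T_b:H^2\to H^2$ is multiplication by $b$ and $T_{\overline b}=T_b^*$. The de Branges-Rovnyak space is $\mathcal H(b)=(I-T_bT_{\overline b})^{1/2}H^2$ with inner product $\langle (I-T_bT_{\overline b})^{1/2}f,(I-T_bT_{\overline b})^{1/2}g\rangle_b=\langle f,g\rangle_2$ for $f,g\in H^2\ominus\ker (I-T_bT_{\overline b})^{1/2}$, where $\langle\cdot,\cdot\rangle_2$ is the inner product of $H^2$. It is a reproducing kernel Hilbert space on $\mathbb D$ with kernel $k^b_\omega(z)=\frac{1-\overline{b(\omega)}b(z)}{1-\overline\omega z}$. The backward shift $S^*f(z)=(f(z)-f(0))/z$ maps $\mathcal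 H(b)$ into itself, and $X_b=S^*|_{\mathcal H(b)}$, which is a bounded operator (a contraction) on $\mathcal H(b)$. An extreme point of $H^\infty_1$ is an element of $H^\infty_1$ that does not lie in any open line segment connecting two distinct points of $H^\infty_1$; it is known that $b\in H^\infty_1$ is extreme if and only if $\int_{\mathbb T}\log(1-|b|^2)\,dm=-\infty$ (using radial boundary values of $b$). Non-extreme means not an extreme point. For an open set $\Omega\subseteq\mathbb C$, an integer $n\geq1$ and a bounded operator $T$ on a complex separable Hilbert space $\mathcal H$, one writes $T\in B_n(\Omega)$ (Cowen-Douglas class of rank $n$) if: (i) $\dim\ker(T-\omega I)=n$ for all $\omega\in\Omega$; (ii) the closed linear span of $\bigcup_{\omega\in\Omega}\ker(T-\omega I)$ is $\mathcal H$; (iii) $\operatorname{ran}(T-\omega I)=\mathcal H$ for all $\omega\in\Omega$. *)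

theory Defs
  imports
    "HOL-Complex_Analysis.Complex_Analysis"
    "HOL-Library.Function_Algebras"
    "HOL-Library.Nonpos_Ints"
begin

section \<open>Functions on the disc as vectors\<close>

text \<open>
  An analytic function on the open unit disc is represented by the function on all of
  \<^typ>\<open>complex\<close> that agrees with it on the disc and is \<^term>\<open>0\<close> elsewhere. Equality of
  representatives is then equality on the disc; in particular ``distinct points'' in the
  definition of an extreme point has its intended meaning.
\<close>

definition cscale :: "complex \<Rightarrow> (complex \<Rightarrow> complex) \<Rightarrow> (complex \<Rightarrow> complex)" where
  "cscale c f = (\<lambda>z. c * f z)"

interpretation cfun: vector_space cscale
  by unfold_locales (auto simp: cscale_def fun_eq_iff algebra_simps)

text \<open>The pointwise real vector space structure, needed to use \<^const>\<open>extreme_point_of\<close>.\<close>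

instantiation "fun" :: (type, real_vector) real_vector
begin

definition scaleR_fun :: "real \<Rightarrow> ('a \<Rightarrow> 'b) \<Rightarrow> 'a \<Rightarrow> 'b" where
  "scaleR_fun r f = (\<lambda>x. r *\<^sub>R f x)"

instance
  by standard (auto simp: scaleR_fun_def fun_eq_iff algebra_simps)

end

section \<open>Operators on Hilbert spaces of functions\<close>

text \<open>
  A Hilbert space of functions is given by its carrier \<open>H\<close>, a \<^const>\<open>cscale\<close>-subspace, and
  its inner product \<open>ip\<close>, linear in the first argument and meaningful only on \<open>H\<close>. The
  definitions below are intended for complete separable \<open>(H, ip)\<close>.
\<close>

type_synonym cvec = "complex \<Rightarrow> complex"

definition ip_norm :: "(cvec \<Rightarrow> cvec \<Rightarrow> complex) \<Rightarrow> cvec \<Rightarrow> real" where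
  "ip_norm ip f = sqrt (Re (ip f f))"

definition bounded_operator :: "cvec set \<Rightarrow> (cvec \<Rightarrow> cvec \<Rightarrow> complex) \<Rightarrow> (cvec \<Rightarrow> cvec) \<Rightarrow> bool" where
  "bounded_operator H ip T \<longleftrightarrow>
     (\<forall>f\<in>H. T f \<in> H) \<and>
     (\<forall>f\<in>H. \<forall>g\<in>H. T (f + g) = T f + T g) \<and>
     (\<forall>c. \<forall>f\<in>H. T (cscale c f) = cscale c (T f)) \<and>
     (\<exists>C. \<forall>f\<in>H. ip_norm ip (T f) \<le> C * ip_norm ip f)"

definition adjoint_op :: "cvec set \<Rightarrow> (cvec \<Rightarrow> cvec \<Rightarrow> complex) \<Rightarrow> (cvec \<Rightarrow> cvec) \<Rightarrow> cvec \<Rightarrow> cvec" where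
  "adjoint_op H ip T g = (THE h. h \<in> H \<and> (\<forall>f\<in>H. ip (T f) g = ip f h))"

text \<open>
  The positive square root of a positive operator. Setting it to \<^term>\<open>0\<close> off \<open>H\<close> only serves
  to make it unique as a total function.
\<close>

definition sqrt_op :: "cvec set \<Rightarrow> (cvec \<Rightarrow> cvec \<Rightarrow> complex) \<Rightarrow> (cvec \<Rightarrow> cvec) \<Rightarrow> cvec \<Rightarrow> cvec" where
  "sqrt_op H ip A = (THE R.
     bounded_operator H ip R \<and>
     (\<forall>f\<in>H. ip (R f) f \<in> \<real>\<^sub>\<ge>\<^sub>0) \<and>
     (\<forall>f\<in>H. R (R f) = A f) \<and>
     (\<forall>f. f \<notin> H \<longrightarrow> R f = 0))"

definition eigenspace :: "cvec set \<Rightarrow> (cvec \<Rightarrow> cvec) \<Rightarrow> complex \<Rightarrow> cvec set" where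
  "eigenspace H T \<omega> = {f \<in> H. T f - cscale \<omega> f = 0}"

definition closed_span :: "cvec set \<Rightarrow> (cvec \<Rightarrow> cvec \<Rightarrow> complex) \<Rightarrow> cvec set \<Rightarrow> cvec set" where
  "closed_span H ip S = {f \<in> H. \<forall>e>0. \<exists>g \<in> cfun.span S. ip_norm ip (f - g) < e}"

text \<open>
  The Cowen--Douglas class of rank \<open>n \<ge> 1\<close>. The library dimension of an infinite-dimensional
  space is \<^term>\<open>0\<close>, so the definition must not be used for \<open>n = 0\<close>.
\<close>

definition cowen_douglas ::
  "cvec set \<Rightarrow> (cvec \<Rightarrow> cvec \<Rightarrow> complex) \<Rightarrow> nat \<Rightarrow> complex set \<Rightarrow> (cvec \<Rightarrow> cvec) set" where
  "cowen_douglas H ip n \<Omega> = {T.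
     bounded_operator H ip T \<and>
     (\<forall>\<omega>\<in>\<Omega>. cfun.dim (eigenspace H T \<omega>) = n) \<and>
     closed_span H ip (\<Union>\<omega>\<in>\<Omega>. eigenspace H T \<omega>) = H \<and>
     (\<forall>\<omega>\<in>\<Omega>. (\<lambda>f. T f - cscale \<omega> f) ` H = H)}"

section \<open>Hardy spaces\<close>

abbreviation unit_disc :: "complex set" where
  "unit_disc \<equiv> ball 0 1"

definition disc_analytic :: "cvec set" where
  "disc_analytic = {f. f holomorphic_on unit_disc \<and> (\<forall>z. z \<notin> unit_disc \<longrightarrow> f z = 0)}"

definition taylor_coeff :: "cvec \<Rightarrow> nat \<Rightarrow> complex" where
  "taylor_coeff f n = fps_nth (fps_expansion f 0) n"

definition H2 :: "cvec set" where
  "H2 = {f \<in> disc_analytic. summable (\<lambda>n. (norm (taylor_coeff f n))\<^sup>2)}"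

definition H2_ip :: "cvec \<Rightarrow> cvec \<Rightarrow> complex" where
  "H2_ip f g = (\<Sum>n. taylor_coeff f n * cnj (taylor_coeff g n))"

definition Hinf :: "cvec set" where
  "Hinf = {b \<in> disc_analytic. bounded (b ` unit_disc)}"

definition Hinf_norm :: "cvec \<Rightarrow> real" where
  "Hinf_norm b = (SUP z\<in>unit_disc. norm (b z))"

definition Hinf_unit_ball :: "cvec set" where
  "Hinf_unit_ball = {b \<in> Hinf. Hinf_norm b \<le> 1}"

section \<open>De Branges--Rovnyak spaces\<close>

definition toeplitz :: "cvec \<Rightarrow> cvec \<Rightarrow> cvec" where
  "toeplitz b f = (\<lambda>z. b z * f z)"

definition toeplitz_adj :: "cvec \<Rightarrow> cvec \<Rightarrow> cvec" where
  "toeplitz_adj b = adjoint_op H2 H2_ip (toeplitz b)"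

definition defect_op :: "cvec \<Rightarrow> cvec \<Rightarrow> cvec" where
  "defect_op b = sqrt_op H2 H2_ip (\<lambda>f. f - toeplitz b (toeplitz_adj b f))"

definition dBR :: "cvec \<Rightarrow> cvec set" where
  "dBR b = defect_op b ` H2"

text \<open>The preimage of \<open>u\<close> under the defect operator that is orthogonal to its kernel.\<close>

definition dBR_lift :: "cvec \<Rightarrow> cvec \<Rightarrow> cvec" where
  "dBR_lift b u = (THE f. f \<in> H2 \<and> (\<forall>g\<in>H2. defect_op b g = 0 \<longrightarrow> H2_ip f g = 0) \<and>
     defect_op b f = u)"

definition dBR_ip :: "cvec \<Rightarrow> cvec \<Rightarrow> cvec \<Rightarrow> complex" where
  "dBR_ip b u v = H2_ip (dBR_lift b u) (dBR_lift b v)"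

text \<open>At the origin \<open>(f z - f 0) / z\<close> is to be read as its limit \<open>deriv f 0\<close>.\<close>

definition backward_shift :: "cvec \<Rightarrow> cvec" where
  "backward_shift f = (\<lambda>z. if z \<in> unit_disc
     then (if z = 0 then deriv f 0 else (f z - f 0) / z) else 0)"

definition X_op :: "cvec \<Rightarrow> cvec \<Rightarrow> cvec" where
  "X_op b = restrict backward_shift (dBR b)"

end

theory Submission
  imports Defs
begin

text \<open>
  Identify \<open>H\<^sup>2\<close> with the square-summable sequences. Let \<open>S\<close> be the shift, \<open>T\<close> multiplication
  by \<open>b\<close>, \<open>R = (I - T T\<^sup>*)\<^sup>1\<^sup>/\<^sup>2\<close> and \<open>G = (I - T\<^sup>* T)\<^sup>1\<^sup>/\<^sup>2\<close>. The space \<open>H(b)\<close> is the range of \<open>R\<close>, with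
  the norm that makes \<open>R\<close> isometric on the closure of that range, so \<open>u\<close> lies in \<open>H(b)\<close> exactly when
  \<open>|\<langle>f, u\<rangle>| \<le> C \<parallel>R f\<parallel>\<close> for all \<open>f\<close> (\<open>range_symmetricI\<close>). Every question about \<open>H(b)\<close> thereby
  becomes an estimate for \<open>\<parallel>R f\<parallel>\<^sup>2 = \<parallel>f\<parallel>\<^sup>2 - \<parallel>T\<^sup>* f\<parallel>\<^sup>2\<close>. Its companion \<open>\<parallel>G f\<parallel>\<^sup>2 = \<parallel>f\<parallel>\<^sup>2 - \<parallel>T f\<parallel>\<^sup>2\<close>, on the
  circle the integral of \<open>(1 - |b|\<^sup>2) |f|\<^sup>2\<close>, is invariant under \<open>S\<close>, and the two are tied together by
  \<open>\<parallel>G T\<^sup>* f\<parallel> \<le> \<parallel>R f\<parallel>\<close> and \<open>\<parallel>R T f\<parallel> \<le> \<parallel>G f\<parallel>\<close>.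

  An eigenvector of \<open>S\<^sup>*\<close> in \<open>H\<^sup>2\<close> is a multiple of a kernel \<open>k\<^sub>z(w) = 1 / (1 - z\<^sup>* w)\<close>, where \<open>|z| < 1\<close>
  and \<open>z\<^sup>*\<close> is the conjugate of \<open>z\<close>, so the theorem turns on which kernels lie in \<open>H(b)\<close>. Three conditions on \<open>b\<close> are equivalent:
  \<^item> \<open>b\<close> is not extreme;
  \<^item> \<open>b\<close> has a mate, an analytic \<open>a \<noteq> 0\<close> with \<open>|a|\<^sup>2 + |b|\<^sup>2 \<le> 1\<close>;
  \<^item> evaluation at some point of the disc is bounded by a multiple of \<open>\<parallel>G f\<parallel>\<close>.

  If \<open>b \<plusminus> h\<close> are in the ball, the parallelogram law makes \<open>h\<close> a mate; if \<open>a\<close> is a mate, \<open>b \<plusminus> a\<^sup>2/2\<close>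
  stay in the ball, because \<open>|b| + (1 - |b|\<^sup>2)/2 \<le> 1\<close>. A mate gives \<open>\<parallel>a f\<parallel> \<le> \<parallel>G f\<parallel>\<close>, and dividing by \<open>a\<close>
  on a small circle on which it has no zeros bounds the evaluation at every point
  (\<open>ev_bound_of_mate\<close>). Conversely, a bounded evaluation forbids that \<open>S\<close> has dense range in the norm
  \<open>\<parallel>G f\<parallel>\<close>; its Wold decomposition then has a wandering vector, whose coefficient map is
  multiplication by a mate (\<open>outer_factor\<close>). This is the operator form of Szego's theorem.

  If \<open>b\<close> is extreme and \<open>X\<^sub>b\<close> were in \<open>B\<^sub>n(\<Omega>)\<close>, then \<open>k\<^sub>z \<in> H(b)\<close> for all \<open>z\<close> in an open set, hence for some
  \<open>z\<close> with \<open>b(z) \<noteq> 0\<close>. But then \<open>|b(z) f(z)| = |(T f)(z)| \<le> C \<parallel>R T f\<parallel> \<le> C \<parallel>G f\<parallel>\<close>, so \<open>b\<close> would not be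
  extreme.

  If \<open>b\<close> is not extreme, all evaluations of \<open>T\<^sup>* f\<close> and of \<open>f\<close> are bounded by \<open>\<parallel>R f\<parallel>\<close>. Hence every \<open>k\<^sub>z\<close> is
  in \<open>H(b)\<close>, and the solution \<open>u\<close> of \<open>S\<^sup>* u - \<omega> u = g\<close> that is divisible by the variable is in \<open>H(b)\<close> along with
  \<open>g\<close> (\<open>bshift_range_surj\<close>). It remains that the kernels are total (\<open>kernels_total\<close>). The mate \<open>a\<close> built
  from the wandering vector is outer and has \<open>\<parallel>a f\<parallel> = \<parallel>G f\<parallel>\<close> (\<open>outer_factor_norm\<close>); moreover
  \<open>\<parallel>R f\<parallel>\<^sup>2 = \<parallel>G f\<parallel>\<^sup>2 + \<parallel>P f\<parallel>\<^sup>2\<close> with a Hankel operator \<open>P\<close> (\<open>hankel_operator\<close>). A vector orthogonal to all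
  kernels is a limit of \<open>R g\<^sub>n\<close> with \<open>g\<^sub>n \<rightarrow> 0\<close> pointwise on the disc. Then \<open>a g\<^sub>n \<rightarrow> 0\<close> in \<open>H\<^sup>2\<close>, and since \<open>P\<close>
  intertwines multiplication by \<open>a\<close> with its transpose, the limit of \<open>P g\<^sub>n\<close> annihilates the dense
  range of multiplication by \<open>a\<close>. So \<open>R g\<^sub>n \<rightarrow> 0\<close>.
\<close>

section \<open>The Hilbert space of square-summable sequences\<close>

lemma summable_cmod_mult:
  fixes a c :: "nat \<Rightarrow> complex"
  assumes "summable (\<lambda>n. (cmod (a n))\<^sup>2)" "summable (\<lambda>n. (cmod (c n))\<^sup>2)"
  shows "summable (\<lambda>n. cmod (a n) * cmod (c n))"
proof (rule summable_comparison_test')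
  show "summable (\<lambda>n. (cmod (a n))\<^sup>2 + (cmod (c n))\<^sup>2)"
    using assms by (rule summable_add)
  show "norm (cmod (a n) * cmod (c n)) \<le> (cmod (a n))\<^sup>2 + (cmod (c n))\<^sup>2" if "n \<ge> 0" for n
  proof -
    have "2 * (cmod (a n) * cmod (c n)) \<le> (cmod (a n))\<^sup>2 + (cmod (c n))\<^sup>2"
      using sum_squares_bound[of "cmod (a n)" "cmod (c n)"] by simp
    moreover have "0 \<le> cmod (a n) * cmod (c n)" by simp
    ultimately have "cmod (a n) * cmod (c n) \<le> (cmod (a n))\<^sup>2 + (cmod (c n))\<^sup>2" by linarith
    then show ?thesis by simp
  qed
qed

lemma summable_cmod_add:
  fixes a c :: "nat \<Rightarrow> complex"
  assumes "summable (\<lambda>n. (cmod (a n))\<^sup>2)" "summable (\<lambda>n. (cmod (c n))\<^sup>2)"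
  shows "summable (\<lambda>n. (cmod (a n + c n))\<^sup>2)"
proof (rule summable_comparison_test')
  show "summable (\<lambda>n. 2 * (cmod (a n))\<^sup>2 + 2 * (cmod (c n))\<^sup>2)"
    using assms by (intro summable_add summable_mult)
  show "norm ((cmod (a n + c n))\<^sup>2) \<le> 2 * (cmod (a n))\<^sup>2 + 2 * (cmod (c n))\<^sup>2" if "n \<ge> 0" for n
  proof -
    have "(cmod (a n + c n))\<^sup>2 \<le> (cmod (a n) + cmod (c n))\<^sup>2"
      by (intro power_mono norm_triangle_ineq) auto
    also have "\<dots> \<le> 2 * (cmod (a n))\<^sup>2 + 2 * (cmod (c n))\<^sup>2"
      using sum_squares_bound[of "cmod (a n)" "cmod (c n)"] by (simp add: power2_sum)
    finally show ?thesis by simp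
  qed
qed

text \<open>
  Making \<open>\<ell>\<^sup>2\<close> a type gives access to the library of bounded linear maps and Banach spaces. The
  class \<^class>\<open>real_inner\<close> supplies the real part of the complex inner product; the complex structure is
  added afterwards as a scalar multiplication, and complex linearity is commutation with it.
\<close>

typedef ell2 = "{c :: nat \<Rightarrow> complex. summable (\<lambda>n. (cmod (c n))\<^sup>2)}"
  morphisms coef Abs_ell2
  by (rule exI[of _ "\<lambda>_. 0"]) simp

setup_lifting type_definition_ell2

lemma summable_coef: "summable (\<lambda>n. (cmod (coef f n))\<^sup>2)"
  using coef by auto

lemma ell2_eqI: "(\<And>n. coef f n = coef g n) \<Longrightarrow> f = g"
  by (simp add: coef_inject[symmetric] fun_eq_iff)

instantiation ell2 :: real_inner
begin

lift_definition zero_ell2 :: ell2 is "\<lambda>_. 0" by simp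
lift_definition plus_ell2 :: "ell2 \<Rightarrow> ell2 \<Rightarrow> ell2" is "\<lambda>a c n. a n + c n"
  by (rule summable_cmod_add)
lift_definition uminus_ell2 :: "ell2 \<Rightarrow> ell2" is "\<lambda>a n. - a n" by simp
lift_definition minus_ell2 :: "ell2 \<Rightarrow> ell2 \<Rightarrow> ell2" is "\<lambda>a c n. a n - c n"
  subgoal for a c using summable_cmod_add[of a "\<lambda>n. - c n"] by simp done
lift_definition scaleR_ell2 :: "real \<Rightarrow> ell2 \<Rightarrow> ell2" is "\<lambda>r a n. r *\<^sub>R a n"
  by (auto simp: power_mult_distrib intro: summable_mult)

definition inner_ell2 :: "ell2 \<Rightarrow> ell2 \<Rightarrow> real" where
  "inner_ell2 f g = (\<Sum>n. coef f n \<bullet> coef g n)"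
definition norm_ell2 :: "ell2 \<Rightarrow> real" where
  "norm_ell2 f = sqrt (inner f f)"
definition dist_ell2 :: "ell2 \<Rightarrow> ell2 \<Rightarrow> real" where
  "dist_ell2 f g = norm (f - g)"
definition sgn_ell2 :: "ell2 \<Rightarrow> ell2" where
  "sgn_ell2 f = inverse (norm f) *\<^sub>R f"
definition uniformity_ell2 :: "(ell2 \<times> ell2) filter" where
  "uniformity_ell2 = (INF e\<in>{0 <..}. principal {(x, y). dist x y < e})"
definition open_ell2 :: "ell2 set \<Rightarrow> bool" where
  "open_ell2 U = (\<forall>x\<in>U. eventually (\<lambda>(x', y). x' = x \<longrightarrow> y \<in> U) uniformity)"

lemma summable_inner_coef: "summable (\<lambda>n. coef f n \<bullet> coef g n)"
proof (rule summable_comparison_test')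
  show "summable (\<lambda>n. cmod (coef f n) * cmod (coef g n))"
    by (intro summable_cmod_mult summable_coef)
  show "norm (coef f n \<bullet> coef g n) \<le> cmod (coef f n) * cmod (coef g n)" if "n \<ge> 0" for n
    using Cauchy_Schwarz_ineq2 by simp
qed

instance
proof
  fix f g h :: ell2 and r s :: real
  show "f + g + h = f + (g + h)" "f + g = g + f" "0 + f = f" "- f + f = 0" "f - g = f + - g"
    by (transfer, simp add: fun_eq_iff)+
  show "r *\<^sub>R (f + g) = r *\<^sub>R f + r *\<^sub>R g" "(r + s) *\<^sub>R f = r *\<^sub>R f + s *\<^sub>R f"
    "r *\<^sub>R s *\<^sub>R f = (r * s) *\<^sub>R f" "1 *\<^sub>R f = f"
    by (transfer, simp add: fun_eq_iff algebra_simps)+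
  show "sgn f = inverse (norm f) *\<^sub>R f" by (rule sgn_ell2_def)
  show "dist f g = norm (f - g)" by (rule dist_ell2_def)
  show "(uniformity :: (ell2 \<times> ell2) filter) = (INF e\<in>{0 <..}. principal {(x, y). dist x y < e})"
    by (rule uniformity_ell2_def)
  show "open U = (\<forall>x\<in>U. eventually (\<lambda>(x', y). x' = x \<longrightarrow> y \<in> U) uniformity)" for U :: "ell2 set"
    by (rule open_ell2_def)
  show "f \<bullet> g = g \<bullet> f" by (simp add: inner_ell2_def inner_commute)
  show "(f + g) \<bullet> h = f \<bullet> h + g \<bullet> h"
    by (simp add: inner_ell2_def plus_ell2.rep_eq inner_add_left suminf_add summable_inner_coef)
  show "(r *\<^sub>R f) \<bullet> g = r * (f \<bullet> g)"
    using suminf_mult[OF summable_inner_coef, of r f g] by (simp add: inner_ell2_def scaleR_ell2.rep_eq)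
  show "0 \<le> f \<bullet> f"
    unfolding inner_ell2_def by (intro suminf_nonneg summable_inner_coef) simp
  show "f \<bullet> f = 0 \<longleftrightarrow> f = 0"
  proof
    assume "f \<bullet> f = 0"
    then have "\<forall>n. coef f n \<bullet> coef f n = 0"
      unfolding inner_ell2_def using suminf_eq_zero_iff[OF summable_inner_coef, of f f] by simp
    then show "f = 0" by (intro ell2_eqI) (simp add: zero_ell2.rep_eq)
  qed (simp add: inner_ell2_def zero_ell2.rep_eq)
  show "norm f = sqrt (f \<bullet> f)" by (rule norm_ell2_def)
qed

end

lemmas coef_simps [simp] = zero_ell2.rep_eq plus_ell2.rep_eq uminus_ell2.rep_eq minus_ell2.rep_eq
  scaleR_ell2.rep_eq

lemma coef_sum [simp]: "coef (\<Sum>i\<in>A. f i) n = (\<Sum>i\<in>A. coef (f i) n)"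
  by (induction A rule: infinite_finite_induct) auto

lemma norm_ell2_squared: "(norm f)\<^sup>2 = (\<Sum>n. (cmod (coef f n))\<^sup>2)"
  unfolding power2_norm_eq_inner inner_ell2_def by (simp add: power2_norm_eq_inner)

lemma sum_coef_le: "finite A \<Longrightarrow> (\<Sum>n\<in>A. (cmod (coef f n))\<^sup>2) \<le> (norm f)\<^sup>2"
  unfolding norm_ell2_squared by (intro sum_le_suminf summable_coef) auto

lemma norm_coef_le: "cmod (coef f n) \<le> norm f"
  using sum_coef_le[of "{n}" f] by (auto intro: power2_le_imp_le)

lemma bounded_linear_coef: "bounded_linear (\<lambda>f. coef f n)"
  by (rule bounded_linear_intro[of _ 1]) (auto simp: norm_coef_le)

lemma ell2_intro_bound:
  assumes "\<And>N. (\<Sum>n<N. (cmod (c n))\<^sup>2) \<le> C"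
  shows "coef (Abs_ell2 c) = c" "(norm (Abs_ell2 c))\<^sup>2 \<le> C"
proof -
  have s: "summable (\<lambda>n. (cmod (c n))\<^sup>2)"
    by (rule summableI_nonneg_bounded[of _ C]) (use assms in auto)
  then show *: "coef (Abs_ell2 c) = c" by (simp add: Abs_ell2_inverse)
  show "(norm (Abs_ell2 c))\<^sup>2 \<le> C"
    unfolding norm_ell2_squared * by (rule suminf_le_const[OF s]) (rule assms)
qed

instance ell2 :: banach
proof
  fix X :: "nat \<Rightarrow> ell2"
  assume X: "Cauchy X"
  have "convergent (\<lambda>k. coef (X k) n)" for n
    using bounded_linear.Cauchy[OF bounded_linear_coef X] by (simp add: Cauchy_convergent_iff)
  then obtain c where c: "\<And>n. (\<lambda>k. coef (X k) n) \<longlonglongrightarrow> c n"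
    unfolding convergent_def by metis
  have tail: "(\<Sum>n<N. (cmod (c n - coef (X k) n))\<^sup>2) \<le> e\<^sup>2"
    if "\<And>j. j \<ge> k \<Longrightarrow> norm (X j - X k) \<le> e" for e k N
  proof (rule tendsto_upperbound)
    show "(\<lambda>j. \<Sum>n<N. (cmod (coef (X j) n - coef (X k) n))\<^sup>2) \<longlonglongrightarrow> (\<Sum>n<N. (cmod (c n - coef (X k) n))\<^sup>2)"
      by (intro tendsto_intros c)
    show "\<forall>\<^sub>F j in sequentially. (\<Sum>n<N. (cmod (coef (X j) n - coef (X k) n))\<^sup>2) \<le> e\<^sup>2"
      using eventually_ge_at_top[of k]
    proof eventually_elim
      case (elim j)
      have "(\<Sum>n<N. (cmod (coef (X j) n - coef (X k) n))\<^sup>2) \<le> (norm (X j - X k))\<^sup>2"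
        using sum_coef_le[of "{..<N}" "X j - X k"] by simp
      also have "\<dots> \<le> e\<^sup>2" using that[OF elim] by (intro power_mono) auto
      finally show ?case .
    qed
  qed simp
  have ex: "\<exists>k0. \<forall>k\<ge>k0. \<forall>j\<ge>k. norm (X j - X k) \<le> e" if "e > 0" for e
    using CauchyD[OF X that] by (meson less_imp_le order_trans)
  obtain k0 where k0: "\<And>j. j \<ge> k0 \<Longrightarrow> norm (X j - X k0) \<le> 1" using ex[OF zero_less_one] by blast
  define d where "d = Abs_ell2 (\<lambda>n. c n - coef (X k0) n)"
  have d: "coef d n = c n - coef (X k0) n" for n
    unfolding d_def using ell2_intro_bound(1)[OF tail[OF k0]] by simp
  define L where "L = d + X k0"
  have L: "coef L n = c n" for n by (simp add: L_def d)
  have "X \<longlonglongrightarrow> L"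
  proof (rule LIMSEQ_I)
    fix e :: real assume e: "e > 0"
    obtain k1 where k1: "\<forall>k\<ge>k1. \<forall>j\<ge>k. norm (X j - X k) \<le> e / 2"
      using ex[OF half_gt_zero[OF e]] ..
    have "norm (X k - L) < e" if "k \<ge> k1" for k
    proof -
      have "(\<Sum>n<N. (cmod (coef (L - X k) n))\<^sup>2) \<le> (e/2)\<^sup>2" for N
        using tail[of k "e/2" N] k1[rule_format, OF that] by (simp add: L)
      then have "(norm (L - X k))\<^sup>2 \<le> (e/2)\<^sup>2"
        unfolding norm_ell2_squared by (rule suminf_le_const[OF summable_coef])
      then have "norm (L - X k) \<le> e/2" using e by (auto dest: power2_le_imp_le)
      with e show ?thesis by (simp add: norm_minus_commute)
    qed
    then show "\<exists>k1. \<forall>k\<ge>k1. norm (X k - L) < e" by blast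
  qed
  then show "convergent X" unfolding convergent_def by blast
qed

section \<open>Riesz representation and complex structure\<close>

text \<open>
  The functional is represented by the limit of a sequence minimising \<open>\<parallel>R f\<parallel>\<^sup>2 - 2 l(f)\<close> over \<open>V\<close>; the
  parallelogram law makes it Cauchy and the first variation identifies its limit. Taking the norm
  through an operator \<open>R\<close> covers at once the Riesz theorem (\<open>R\<close> the identity, \<open>V\<close> everything),
  orthogonal projection (\<open>l\<close> an inner product), and functionals bounded by \<open>\<parallel>R f\<parallel>\<close> only.
\<close>

lemma riesz_minimizer:
  fixes R :: "'b::real_vector \<Rightarrow> 'a::{real_inner,complete_space}" and l :: "'b \<Rightarrow> real"
  assumes R: "linear R" and l: "linear l" and V: "subspace V"
    and bd: "\<And>f. f \<in> V \<Longrightarrow> \<bar>l f\<bar> \<le> C * norm (R f)"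
  obtains y where "y \<in> closure (R ` V)" "\<And>f. f \<in> V \<Longrightarrow> l f = y \<bullet> R f"
proof -
  define J where "J f = (norm (R f))\<^sup>2 - 2 * l f" for f
  have J_ge: "J f \<ge> - C\<^sup>2" if "f \<in> V" for f
  proof -
    have "0 \<le> (norm (R f) - C)\<^sup>2" by simp
    then show ?thesis using bd[OF that] unfolding J_def power2_diff by argo
  qed
  define m where "m = Inf (J ` V)"
  have ne: "J ` V \<noteq> {}" using subspace_0[OF V] by auto
  have bb: "bdd_below (J ` V)" using J_ge by (auto intro!: bdd_belowI)
  have m_le: "m \<le> J f" if "f \<in> V" for f
    unfolding m_def using that bb by (intro cInf_lower) auto
  have "\<exists>f\<in>V. J f < m + 1 / real (Suc n)" for n
    using cInf_lessD[OF ne, of "m + 1 / real (Suc n)"] by (auto simp: m_def)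
  then obtain f where fV: "\<And>n. f n \<in> V" and fJ: "\<And>n. J (f n) < m + 1 / real (Suc n)" by metis
  have Jlim: "(\<lambda>n. J (f n)) \<longlonglongrightarrow> m"
  proof (rule tendsto_sandwich[of "\<lambda>_. m" _ _ "\<lambda>n. m + 1 / real (Suc n)"])
    show "(\<lambda>n. m + 1 / real (Suc n)) \<longlonglongrightarrow> m"
      using tendsto_add[OF tendsto_const LIMSEQ_inverse_real_of_nat, of m] by (simp add: inverse_eq_divide)
    show "\<forall>\<^sub>F n in sequentially. J (f n) \<le> m + 1 / real (Suc n)"
      using fJ by (intro always_eventually allI less_imp_le)
  qed (auto intro!: always_eventually m_le fV)
  have par: "(norm (R (f n) - R (f k)))\<^sup>2 \<le> 2 / real (Suc n) + 2 / real (Suc k)" for n k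
  proof -
    have "(1/2) *\<^sub>R (f n + f k) \<in> V" using fV V by (simp add: subspace_add subspace_scale)
    from m_le[OF this] have "m \<le> (norm (R (f n) + R (f k)))\<^sup>2 / 4 - (l (f n) + l (f k))"
      unfolding J_def linear_scale[OF R] linear_scale[OF l]
      by (simp add: linear_add[OF R] linear_add[OF l] power_divide add_divide_distrib)
    then have "4 * m \<le> (norm (R (f n) + R (f k)))\<^sup>2 - 4 * (l (f n) + l (f k))" by argo
    moreover have "(norm (R (f n) - R (f k)))\<^sup>2 + (norm (R (f n) + R (f k)))\<^sup>2
      = 2 * (norm (R (f n)))\<^sup>2 + 2 * (norm (R (f k)))\<^sup>2"
      by (simp add: power2_norm_eq_inner inner_diff inner_add algebra_simps)
    ultimately show ?thesis using fJ[of n] fJ[of k] unfolding J_def by argo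
  qed
  have "Cauchy (\<lambda>n. R (f n))"
  proof (rule metric_CauchyI)
    fix e :: real assume e: "e > 0"
    obtain N where N: "4 / e\<^sup>2 < real N" using reals_Archimedean2 by blast
    have "dist (R (f n)) (R (f k)) < e" if "n \<ge> N" "k \<ge> N" for n k
    proof -
      have "2 / real (Suc n) \<le> 2 / real (Suc N)" "2 / real (Suc k) \<le> 2 / real (Suc N)"
        using that by (auto intro!: divide_left_mono)
      with par[of n k] have "(norm (R (f n) - R (f k)))\<^sup>2 \<le> 4 / real (Suc N)" by linarith
      also have "\<dots> < e\<^sup>2" using N e by (simp add: field_simps) (smt (verit) zero_less_power2)
      finally show ?thesis using e by (simp add: dist_norm power2_less_imp_less)
    qed
    then show "\<exists>M. \<forall>m\<ge>M. \<forall>n\<ge>M. dist (R (f m)) (R (f n)) < e" by blast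
  qed
  then obtain y where y: "(\<lambda>n. R (f n)) \<longlonglongrightarrow> y" unfolding Cauchy_convergent_iff convergent_def by blast
  have "y \<in> closure (R ` V)" unfolding closure_sequential using y fV by (intro exI[of _ "\<lambda>n. R (f n)"]) simp
  moreover have "l g = y \<bullet> R g" if g: "g \<in> V" for g
  proof -
    define d where "d = y \<bullet> R g - l g"
    have *: "0 \<le> 2 * t * d + t\<^sup>2 * (norm (R g))\<^sup>2" for t
    proof -
      have "m \<le> J (f n) + 2 * t * (R (f n) \<bullet> R g - l g) + t\<^sup>2 * (norm (R g))\<^sup>2" for n
      proof -
        have "f n + t *\<^sub>R g \<in> V" using fV g V by (simp add: subspace_add subspace_scale)
        moreover have "(norm (R (f n) + t *\<^sub>R R g))\<^sup>2 = (norm (R (f n)))\<^sup>2 + 2 * t * (R (f n) \<bullet> R g) + t\<^sup>2 * (norm (R g))\<^sup>2"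
          unfolding power2_norm_eq_inner
          by (simp add: inner_add inner_commute[of "R g" "R (f n)"] power2_eq_square algebra_simps)
        ultimately show ?thesis using m_le[of "f n + t *\<^sub>R g"] unfolding J_def
          by (simp add: linear_add[OF R] linear_add[OF l] linear_scale[OF R] linear_scale[OF l] algebra_simps)
      qed
      moreover have "(\<lambda>n. J (f n) + 2 * t * (R (f n) \<bullet> R g - l g) + t\<^sup>2 * (norm (R g))\<^sup>2)
        \<longlonglongrightarrow> m + 2 * t * d + t\<^sup>2 * (norm (R g))\<^sup>2"
        unfolding d_def by (intro tendsto_intros Jlim y)
      ultimately have "m \<le> m + 2 * t * d + t\<^sup>2 * (norm (R g))\<^sup>2" by (intro LIMSEQ_le_const) auto
      then show ?thesis by simp
    qed
    \<comment> \<open>A step proportional to the defect, short enough for the linear term to dominate.\<close>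
    define s where "s = 1 / ((norm (R g))\<^sup>2 + 1)"
    have s: "s > 0" "s * (norm (R g))\<^sup>2 < 1"
      unfolding s_def using add_nonneg_pos[OF zero_le_power2[of "norm (R g)"] zero_less_one] by (auto simp: field_simps)
    have "0 \<le> 2 * (- s * d) * d + (- s * d)\<^sup>2 * (norm (R g))\<^sup>2" by (rule *)
    also have "\<dots> = - (s * d\<^sup>2) * (2 - s * (norm (R g))\<^sup>2)" by (simp add: power2_eq_square algebra_simps)
    finally have "s * d\<^sup>2 \<le> 0" using s by (simp add: mult_le_0_iff zero_le_mult_iff)
    with s have "d = 0" by (simp add: mult_le_0_iff)
    then show ?thesis by (simp add: d_def)
  qed
  ultimately show ?thesis using that by blast
qed

definition adj :: "('a::{real_inner,complete_space} \<Rightarrow> 'a) \<Rightarrow> 'a \<Rightarrow> 'a" where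
  "adj T g = (THE h. \<forall>f. T f \<bullet> g = f \<bullet> h)"

lemma inner_eq_imp_eq: "(\<And>f. f \<bullet> x = f \<bullet> y) \<Longrightarrow> x = (y::'a::real_inner)"
  by (metis inner_diff_right inner_eq_zero_iff right_minus_eq)

lemma inner_adj:
  assumes "bounded_linear T"
  shows "T f \<bullet> g = f \<bullet> adj T g"
proof -
  obtain K where K: "\<And>x. norm (T x) \<le> norm x * K" using bounded_linear.bounded[OF assms] by blast
  have "\<bar>T f \<bullet> g\<bar> \<le> (K * norm g) * norm f" for f
    using Cauchy_Schwarz_ineq2[of "T f" g] mult_right_mono[OF K[of f], of "norm g"] by (simp add: mult_ac)
  moreover have "linear (\<lambda>f. T f \<bullet> g)" "linear (\<lambda>x::'a. x)"
    by (auto intro!: linearI simp: linear_add linear_scale bounded_linear.linear[OF assms] inner_add_left)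
  ultimately obtain h where "\<And>f. T f \<bullet> g = h \<bullet> f"
    using riesz_minimizer[of "\<lambda>x. x" "\<lambda>f. T f \<bullet> g" UNIV "K * norm g"] by auto
  then have "\<exists>!h. \<forall>f. T f \<bullet> g = f \<bullet> h" by (metis inner_commute inner_eq_imp_eq)
  from theI'[OF this] show ?thesis unfolding adj_def by blast
qed

lemma norm_adj_le:
  assumes T: "bounded_linear T" and K: "\<And>x. norm (T x) \<le> K * norm x"
  shows "norm (adj T g) \<le> K * norm g"
proof -
  have "norm (adj T g) * norm (adj T g) = T (adj T g) \<bullet> g"
    using inner_adj[OF T, of "adj T g" g] by (simp add: power2_norm_eq_inner[symmetric] power2_eq_square)
  also have "\<dots> \<le> norm (T (adj T g)) * norm g" by (rule norm_cauchy_schwarz)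
  also have "\<dots> \<le> norm (adj T g) * (K * norm g)" using mult_right_mono[OF K, of "norm g" "adj T g"] by (simp add: mult_ac)
  finally show ?thesis using K[of g] by (cases "adj T g = 0") (auto intro: order_trans[OF norm_ge_zero])
qed

lemma bounded_linear_adj:
  assumes T: "bounded_linear T"
  shows "bounded_linear (adj T)"
proof -
  obtain K where K: "\<And>x. norm (T x) \<le> norm x * K" using bounded_linear.bounded[OF T] by blast
  show ?thesis
  proof (rule bounded_linear_intro[of _ K])
    show "adj T (x + y) = adj T x + adj T y" for x y
      by (rule inner_eq_imp_eq) (simp add: inner_add_right flip: inner_adj[OF T])
    show "adj T (r *\<^sub>R x) = r *\<^sub>R adj T x" for r x
      by (rule inner_eq_imp_eq) (simp flip: inner_adj[OF T])
    show "norm (adj T x) \<le> norm x * K" for x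
      using norm_adj_le[OF T, of K x] K by (simp add: mult.commute)
  qed
qed

lift_definition cmul :: "complex \<Rightarrow> ell2 \<Rightarrow> ell2" (infixr "*\<^sub>C" 75) is "\<lambda>c a n. c * a n"
  by (auto simp: norm_mult power_mult_distrib intro: summable_mult)

declare cmul.rep_eq [simp]

lemma norm_cmul [simp]: "norm (c *\<^sub>C f) = cmod c * norm f"
proof -
  have "(norm (c *\<^sub>C f))\<^sup>2 = (cmod c * norm f)\<^sup>2"
    using suminf_mult[OF summable_coef, of "(cmod c)\<^sup>2" f]
    by (simp add: norm_ell2_squared norm_mult power_mult_distrib)
  then show ?thesis by (simp add: power2_eq_iff_nonneg)
qed

lemma cmul_add: "c *\<^sub>C (f + g) = c *\<^sub>C f + c *\<^sub>C g"
  and add_cmul: "(c + d) *\<^sub>C f = c *\<^sub>C f + d *\<^sub>C f"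
  and cmul_cmul [simp]: "c *\<^sub>C d *\<^sub>C f = (c * d) *\<^sub>C f"
  and cmul_1 [simp]: "1 *\<^sub>C f = f"
  and cmul_0 [simp]: "0 *\<^sub>C f = 0"
  and cmul_zero [simp]: "c *\<^sub>C 0 = 0"
  and scaleR_cmul: "r *\<^sub>R f = of_real r *\<^sub>C f"
  and cmul_diff: "c *\<^sub>C (f - g) = c *\<^sub>C f - c *\<^sub>C g"
  by (auto intro!: ell2_eqI simp: algebra_simps scaleR_conv_of_real)

lemma bounded_linear_cmul: "bounded_linear (\<lambda>f. c *\<^sub>C f)"
  by (rule bounded_linear_intro[of _ "cmod c"]) (auto simp: cmul_add scaleR_cmul mult.commute)

lemma inner_cmul_left: "(c *\<^sub>C f) \<bullet> g = f \<bullet> (cnj c *\<^sub>C g)"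
  by (simp add: inner_ell2_def inner_complex_def algebra_simps)

text \<open>
  The imaginary part is recovered from the real inner product, because
  \<open>Im \<langle>f, g\<rangle> = Re \<langle>f, i g\<rangle>\<close> for an inner product that is linear in its first argument.
\<close>

definition cip :: "ell2 \<Rightarrow> ell2 \<Rightarrow> complex" where
  "cip f g = Complex (f \<bullet> g) (f \<bullet> (\<i> *\<^sub>C g))"

lemma cip_sums: "(\<lambda>n. coef f n * cnj (coef g n)) sums cip f g"
proof -
  have "(\<lambda>n. coef f n * cnj (coef g n)) = (\<lambda>n. Complex (coef f n \<bullet> coef g n) (coef f n \<bullet> coef (\<i> *\<^sub>C g) n))"
    by (auto simp: fun_eq_iff complex_eq_iff inner_complex_def)
  moreover have "(\<lambda>n. Complex (coef f n \<bullet> coef g n) (coef f n \<bullet> coef (\<i> *\<^sub>C g) n)) sums cip f g"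
    unfolding cip_def by (simp add: sums_complex_iff inner_ell2_def summable_sums summable_inner_coef del: cmul.rep_eq)
  ultimately show ?thesis by simp
qed

lemma Re_cip [simp]: "Re (cip f g) = f \<bullet> g" by (simp add: cip_def)

lemma cip_add_left: "cip (f + g) h = cip f h + cip g h"
  and cip_add_right: "cip h (f + g) = cip h f + cip h g"
  and cip_diff_left: "cip (f - g) h = cip f h - cip g h"
  and cip_diff_right: "cip h (f - g) = cip h f - cip h g"
  and cip_zero_left [simp]: "cip 0 h = 0"
  and cip_zero_right [simp]: "cip h 0 = 0"
  by (auto simp: cip_def complex_eq_iff inner_add inner_diff cmul_add cmul_diff)

lemma cip_cmul_left [simp]: "cip (c *\<^sub>C f) g = c * cip f g"
proof -
  have "(\<lambda>n. coef (c *\<^sub>C f) n * cnj (coef g n)) sums (c * cip f g)"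
    using sums_mult[OF cip_sums[of f g], of c] by (simp add: mult.assoc)
  with cip_sums show ?thesis by (metis sums_unique2)
qed

lemma cip_commute: "cip g f = cnj (cip f g)"
proof -
  have "(\<lambda>n. coef g n * cnj (coef f n)) sums cnj (cip f g)"
    using sums_cnj[THEN iffD2, OF cip_sums[of f g]] by (simp add: mult.commute)
  with cip_sums show ?thesis by (metis sums_unique2)
qed

lemma cip_cmul_right [simp]: "cip f (c *\<^sub>C g) = cnj c * cip f g"
  using cip_cmul_left[of c g f] by (metis cip_commute complex_cnj_mult)

lemma cip_self: "cip f f = of_real ((norm f)\<^sup>2)"
  using cip_commute[of f f] by (auto simp: complex_eq_iff power2_norm_eq_inner)

lemma norm_cip_le: "cmod (cip f g) \<le> norm f * norm g"
proof (cases "cip f g = 0")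
  case False
  \<comment> \<open>Rotating \<open>f\<close> makes the complex inner product real, which reduces the claim to the real Cauchy-Schwarz inequality.\<close>
  define u where "u = cnj (cip f g) / cmod (cip f g)"
  have "cnj (cip f g) * cip f g = complex_of_real (cmod (cip f g)) * complex_of_real (cmod (cip f g))"
    by (metis complex_norm_square mult.commute of_real_power power2_eq_square)
  then have "u * cip f g = cmod (cip f g)" using False by (simp add: u_def)
  then have "cmod (cip f g) = Re (cip (u *\<^sub>C f) g)" by (metis Re_complex_of_real cip_cmul_left)
  also have "\<dots> = (u *\<^sub>C f) \<bullet> g" by (rule Re_cip)
  also have "\<dots> \<le> norm (u *\<^sub>C f) * norm g" by (simp add: norm_cauchy_schwarz del: norm_cmul)
  also have "\<dots> = norm f * norm g" using False by (simp add: u_def norm_divide)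
  finally show ?thesis .
qed simp

lemma bounded_linear_cip_left: "bounded_linear (\<lambda>f. cip f g)"
  by (rule bounded_linear_intro[of _ "norm g"]) (auto simp: norm_cip_le cip_add_left scaleR_cmul scaleR_conv_of_real)
lemma bounded_linear_cip_right: "bounded_linear (\<lambda>g. cip f g)"
  by (rule bounded_linear_intro[of _ "norm f"])
    (auto simp: norm_cip_le cip_add_right scaleR_cmul scaleR_conv_of_real mult.commute[of _ "norm f"])

lemmas tendsto_cip_left = bounded_linear.tendsto[OF bounded_linear_cip_left]
lemmas tendsto_cip_right = bounded_linear.tendsto[OF bounded_linear_cip_right]

definition bounded_clinear :: "(ell2 \<Rightarrow> ell2) \<Rightarrow> bool" where
  "bounded_clinear T \<longleftrightarrow> bounded_linear T \<and> (\<forall>c f. T (c *\<^sub>C f) = c *\<^sub>C T f)"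

lemma bounded_clinearD:
  assumes "bounded_clinear T"
  shows "bounded_linear T" "T (c *\<^sub>C f) = c *\<^sub>C T f" "T (f + g) = T f + T g" "T (f - g) = T f - T g" "T 0 = 0"
  using assms by (auto simp: bounded_clinear_def bounded_linear.linear linear_add linear_diff linear_0)

lemma bounded_clinearI:
  assumes "bounded_linear T" "\<And>f. T (\<i> *\<^sub>C f) = \<i> *\<^sub>C T f"
  shows "bounded_clinear T"
  unfolding bounded_clinear_def
proof safe
  fix c f
  have split: "c *\<^sub>C g = Re c *\<^sub>R g + Im c *\<^sub>R (\<i> *\<^sub>C g)" for g
    by (subst complex_eq[of c], subst add_cmul) (simp add: scaleR_cmul mult.commute)
  show "T (c *\<^sub>C f) = c *\<^sub>C T f"
    by (simp add: split assms(2) linear_add linear_scale bounded_linear.linear[OF assms(1)])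
qed (rule assms)

lemma bounded_clinear_compose: "bounded_clinear S \<Longrightarrow> bounded_clinear T \<Longrightarrow> bounded_clinear (\<lambda>f. S (T f))"
  by (auto simp: bounded_clinear_def bounded_linear_compose)

lemma cip_adj: "bounded_clinear T \<Longrightarrow> cip (T f) g = cip f (adj T g)"
proof -
  assume T: "bounded_clinear T"
  have "T f \<bullet> (\<i> *\<^sub>C g) = f \<bullet> (\<i> *\<^sub>C adj T g)"
  proof -
    have "T f \<bullet> (\<i> *\<^sub>C g) = ((- \<i>) *\<^sub>C T f) \<bullet> g" by (simp add: inner_cmul_left)
    also have "\<dots> = ((- \<i>) *\<^sub>C f) \<bullet> adj T g" by (metis T bounded_clinearD(1,2) inner_adj)
    finally show ?thesis by (simp add: inner_cmul_left)
  qed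
  then show ?thesis by (simp add: cip_def inner_adj[OF bounded_clinearD(1)[OF T]])
qed

lemma bounded_clinear_adj:
  assumes T: "bounded_clinear T"
  shows "bounded_clinear (adj T)"
proof (rule bounded_clinearI)
  show "bounded_linear (adj T)" by (intro bounded_linear_adj bounded_clinearD(1)[OF T])
  show "adj T (\<i> *\<^sub>C g) = \<i> *\<^sub>C adj T g" for g
    by (rule inner_eq_imp_eq) (metis Re_cip cip_adj[OF T] cip_cmul_right)
qed

section \<open>Shift, backward shift and point evaluation\<close>

lift_definition monomial :: "nat \<Rightarrow> ell2" is "\<lambda>n k. if k = n then 1 else 0"
  by (rule summable_finite[of "{n}" for n]) auto

declare monomial.rep_eq [simp]

lift_definition shift :: "ell2 \<Rightarrow> ell2" is "\<lambda>a n. case n of 0 \<Rightarrow> 0 | Suc m \<Rightarrow> a m"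
  by (subst summable_Suc_iff[symmetric]) simp

lift_definition bshift :: "ell2 \<Rightarrow> ell2" is "\<lambda>a n. a (Suc n)"
  by (subst summable_Suc_iff)

lemma coef_shift_0 [simp]: "coef (shift f) 0 = 0"
  and coef_shift_Suc [simp]: "coef (shift f) (Suc n) = coef f n"
  by (simp_all add: shift.rep_eq)

declare bshift.rep_eq [simp]

lemma bshift_shift [simp]: "bshift (shift f) = f"
  by (rule ell2_eqI) simp

lemma shift_monomial [simp]: "shift (monomial n) = monomial (Suc n)"
  by (rule ell2_eqI) (simp add: shift.rep_eq split: nat.split)

lemma shift_bshift: "f = coef f 0 *\<^sub>C monomial 0 + shift (bshift f)"
proof (rule ell2_eqI)
  show "coef f n = coef (coef f 0 *\<^sub>C monomial 0 + shift (bshift f)) n" for n by (cases n) auto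
qed

lemma norm_shift [simp]: "norm (shift f) = norm f"
proof -
  have "(norm (shift f))\<^sup>2 = (norm f)\<^sup>2"
    unfolding norm_ell2_squared using suminf_split_head[OF summable_coef, of "shift f"] by simp
  then show ?thesis by (simp add: power2_eq_iff_nonneg)
qed

lemma norm_bshift_squared: "(norm (bshift f))\<^sup>2 = (norm f)\<^sup>2 - (cmod (coef f 0))\<^sup>2"
  unfolding norm_ell2_squared using suminf_split_head[OF summable_coef, of f] by simp

lemma norm_bshift_le: "norm (bshift f) \<le> norm f"
  using norm_bshift_squared[of f] by (auto intro: power2_le_imp_le)

lemma bounded_clinear_shift: "bounded_clinear shift"
proof (rule bounded_clinearI)
  show "bounded_linear shift"
    by (rule bounded_linear_intro[of _ 1]) (auto intro!: ell2_eqI simp: shift.rep_eq split: nat.split)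
qed (auto intro!: ell2_eqI simp: shift.rep_eq split: nat.split)

lemma bounded_clinear_bshift: "bounded_clinear bshift"
proof (rule bounded_clinearI)
  show "bounded_linear bshift"
    by (rule bounded_linear_intro[of _ 1]) (auto intro!: ell2_eqI simp: norm_bshift_le)
qed (auto intro!: ell2_eqI)

lemma cip_shift: "cip (shift f) g = cip f (bshift g)"
proof -
  have "(\<lambda>n. coef (shift f) (Suc n) * cnj (coef g (Suc n))) sums cip (shift f) g"
    using sums_Suc_iff[THEN iffD2, of "\<lambda>n. coef (shift f) n * cnj (coef g n)"] cip_sums[of "shift f" g] by simp
  then have "(\<lambda>n. coef f n * cnj (coef (bshift g) n)) sums cip (shift f) g" by simp
  then show ?thesis using cip_sums sums_unique2 by blast
qed

lemma inner_shift: "shift f \<bullet> g = f \<bullet> bshift g"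
  using cip_shift[of f g] by (metis Re_cip)

lemma cip_shift_shift [simp]: "cip (shift f) (shift g) = cip f g"
  by (simp add: cip_shift)

lemma cip_monomial_right [simp]: "cip f (monomial n) = coef f n"
proof -
  have "(\<lambda>k. coef f k * cnj (coef (monomial n) k)) sums (\<Sum>k\<in>{n}. coef f k * cnj (coef (monomial n) k))"
    by (rule sums_finite) auto
  then show ?thesis using cip_sums[of f "monomial n"] sums_unique2 by fastforce
qed

lemma norm_monomial [simp]: "norm (monomial n) = 1"
  using cip_self[of "monomial n"] norm_ge_zero[of "monomial n"]
  by (metis cip_monomial_right monomial.rep_eq of_real_eq_1_iff power2_eq_1_iff not_one_le_zero order_trans neg_0_le_iff_le)

lemma ell2_sums: "(\<lambda>n. coef f n *\<^sub>C monomial n) sums f"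
proof -
  have "(\<lambda>N. (norm (f - (\<Sum>n<N. coef f n *\<^sub>C monomial n)))\<^sup>2) \<longlonglongrightarrow> 0"
  proof -
    have *: "(norm (f - (\<Sum>n<N. coef f n *\<^sub>C monomial n)))\<^sup>2 = (\<Sum>n. (cmod (coef f (n + N)))\<^sup>2)" for N
    proof -
      define g where "g = f - (\<Sum>n<N. coef f n *\<^sub>C monomial n)"
      have g: "coef g k = (if k < N then 0 else coef f k)" for k
        unfolding g_def by (simp add: if_distrib[of "\<lambda>x. _ * x"] sum.delta' cong: if_cong)
      have "(norm g)\<^sup>2 = (\<Sum>n. (cmod (coef g (n + N)))\<^sup>2) + (\<Sum>n<N. (cmod (coef g n))\<^sup>2)"
        unfolding norm_ell2_squared by (rule suminf_split_initial_segment[OF summable_coef])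
      then show ?thesis by (simp add: g g_def[symmetric])
    qed
    show ?thesis unfolding * by (rule suminf_exist_split2[OF summable_coef])
  qed
  then have "(\<lambda>N. norm (f - (\<Sum>n<N. coef f n *\<^sub>C monomial n))) \<longlonglongrightarrow> 0"
    using tendsto_real_sqrt by fastforce
  then have "(\<lambda>N. f - (\<Sum>n<N. coef f n *\<^sub>C monomial n)) \<longlonglongrightarrow> 0" by (rule tendsto_norm_zero_cancel)
  from tendsto_diff[OF tendsto_const[of f] this] show ?thesis by (simp add: sums_def)
qed

text \<open>
  Identities between continuous expressions need to be checked on the powers of the variable only.
\<close>

lemma ell2_dense_induct:
  assumes "\<And>n. P (monomial n)" and "\<And>f g. P f \<Longrightarrow> P g \<Longrightarrow> P (f + g)" and "\<And>c f. P f \<Longrightarrow> P (c *\<^sub>C f)"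
    and "\<And>X f. (\<And>k. P (X k)) \<Longrightarrow> X \<longlonglongrightarrow> f \<Longrightarrow> P f"
  shows "P f"
proof (rule assms(4))
  show "(\<lambda>N. \<Sum>n<N. coef f n *\<^sub>C monomial n) \<longlonglongrightarrow> f" using ell2_sums unfolding sums_def .
  have "P 0" using assms(3)[OF assms(1), of 0] by simp
  then show "P (\<Sum>n<N. coef f n *\<^sub>C monomial n)" for N
    by (induction N) (auto intro: assms)
qed

text \<open>
  The Szego kernel. Its value \<open>0\<close> outside the disc makes evaluation there vanish, which is how functions
  on the disc are represented.
\<close>

lift_definition szego :: "complex \<Rightarrow> ell2" is "\<lambda>z n. if cmod z < 1 then cnj z ^ n else 0"
proof -
  fix z :: complex
  have "summable (\<lambda>n. ((cmod z)\<^sup>2) ^ n)" if "cmod z < 1"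
    using that by (intro summable_geometric) (simp add: power_less_one_iff abs_square_less_1)
  then show "summable (\<lambda>n. (cmod (if cmod z < 1 then cnj z ^ n else 0))\<^sup>2)"
    by (cases "cmod z < 1") (simp_all add: norm_power mult.commute flip: power_mult)
qed

definition ev :: "complex \<Rightarrow> ell2 \<Rightarrow> complex" where "ev z f = cip f (szego z)"

lemma ev_sums: "cmod z < 1 \<Longrightarrow> (\<lambda>n. coef f n * z ^ n) sums ev z f"
  using cip_sums[of f "szego z"] by (simp add: ev_def szego.rep_eq)

lemma norm_ev_le: "cmod (ev z f) \<le> norm (szego z) * norm f"
  using norm_cip_le[of f "szego z"] by (simp add: ev_def mult.commute)

lemma ev_add: "ev z (f + g) = ev z f + ev z g"
  and ev_diff: "ev z (f - g) = ev z f - ev z g"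
  and ev_cmul: "ev z (c *\<^sub>C f) = c * ev z f"
  and ev_zero [simp]: "ev z 0 = 0"
  by (simp_all add: ev_def cip_add_left cip_diff_left)

lemma tendsto_ev: "(X \<longlongrightarrow> f) F \<Longrightarrow> ((\<lambda>k. ev z (X k)) \<longlongrightarrow> ev z f) F"
  unfolding ev_def by (rule tendsto_cip_left)

lemma bshift_szego: "bshift (szego z) = cnj z *\<^sub>C szego z"
  by (rule ell2_eqI) (auto simp: szego.rep_eq)

lemma ev_shift: "ev z (shift f) = z * ev z f"
  by (simp add: ev_def cip_shift bshift_szego)

lemma ev_monomial: "cmod z < 1 \<Longrightarrow> ev z (monomial n) = z ^ n"
  unfolding ev_def by (subst cip_commute) (simp add: szego.rep_eq)

lemma ev_bshift: "cmod z < 1 \<Longrightarrow> z * ev z (bshift f) = ev z f - coef f 0"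
  by (subst (2) shift_bshift) (simp add: ev_add ev_cmul ev_shift ev_monomial)

lemma ev_0 [simp]: "ev 0 f = coef f 0"
  using ev_bshift[of 0 f] by simp

text \<open>
  The affine map \<open>h \<mapsto> f + z L h\<close> is a contraction.
\<close>

lemma neumann:
  assumes L: "bounded_clinear L" "\<And>f. norm (L f) \<le> norm f" and z: "cmod z < 1"
  obtains h where "h - z *\<^sub>C L h = f"
proof -
  have "\<exists>!h. f + z *\<^sub>C L h = h"
  proof (rule banach_fix_type[of "cmod z"])
    show "\<forall>x y. dist (f + z *\<^sub>C L x) (f + z *\<^sub>C L y) \<le> cmod z * dist x y"
      using L(2) by (auto simp: dist_norm cmul_diff[symmetric] bounded_clinearD(4)[OF L(1), symmetric] mult_left_mono)
  qed (use z in auto)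
  then show ?thesis using that by (metis add_diff_cancel_right')
qed

section \<open>Positive square roots\<close>

text \<open>
  With \<open>B = I - A\<close>, the root is \<open>I - L\<close> where \<open>L = (B + L\<^sup>2)/2\<close> is the limit of the iteration
  \<open>Y \<mapsto> (B + Y\<^sup>2)/2\<close> from \<open>0\<close>. As \<open>\<parallel>B\<parallel> \<le> 1\<close>, the steps of the iteration are dominated in norm by those of
  the scalar iteration \<open>y \<mapsto> (1 + y\<^sup>2)/2\<close>, which increases to a limit below \<open>1\<close>; this gives convergence
  in norm. Symmetry and commutation relations pass from \<open>A\<close> to each iterate and so to the limit.
\<close>

lemma positive_sqrt_exists:
  fixes A :: "'a::{real_inner,banach} \<Rightarrow> 'a"
  assumes A: "bounded_linear A" and sym: "\<And>f g. A f \<bullet> g = f \<bullet> A g"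
    and contr: "\<And>f. norm (f - A f) \<le> norm f"
  obtains R where "bounded_linear R" "\<And>f g. R f \<bullet> g = f \<bullet> R g" "\<And>f. R f \<bullet> f \<ge> 0" "\<And>f. R (R f) = A f"
    "\<And>C f. bounded_linear C \<Longrightarrow> (\<And>f. C (A f) = A (C f)) \<Longrightarrow> C (R f) = R (C f)"
proof -
  have blB: "bounded_linear (\<lambda>f. f - A f)" by (intro bounded_linear_intros A)
  define B where "B = Blinfun (\<lambda>f. f - A f)"
  have B: "blinfun_apply B f = f - A f" for f
    unfolding B_def by (simp add: bounded_linear_Blinfun_apply[OF blB])
  have nB: "norm B \<le> 1" by (rule norm_blinfun_bound) (auto simp: B contr)
  define Y where "Y = rec_nat (0 :: 'a \<Rightarrow>\<^sub>L 'a) (\<lambda>_ Z. (1/2) *\<^sub>R (B + (Z o\<^sub>L Z)))"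
  have Y0: "Y 0 = 0" and YS: "Y (Suc n) = (1/2) *\<^sub>R (B + (Y n o\<^sub>L Y n))" for n by (simp_all add: Y_def)
  define y where "y = rec_nat (0 :: real) (\<lambda>_ t. (1 + t\<^sup>2) / 2)"
  have y0: "y 0 = 0" and yS: "y (Suc n) = (1 + (y n)\<^sup>2) / 2" for n by (simp_all add: y_def)
  have y_bounds: "0 \<le> y n \<and> y n \<le> 1" for n
  proof (induction n)
    case (Suc n)
    then have "(y n)\<^sup>2 \<le> 1" by (simp add: power_le_one)
    then show ?case by (simp add: yS add_nonneg_nonneg)
  qed (simp add: y0)
  have y_mono: "y n \<le> y (Suc n)" for n
    using zero_le_power2[of "1 - y n"] by (simp add: yS power2_diff)
  have Y_norm: "norm (Y n) \<le> y n" for n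
  proof (induction n)
    case (Suc n)
    have "norm (Y n o\<^sub>L Y n) \<le> (y n)\<^sup>2"
      using order_trans[OF norm_blinfun_compose mult_mono[OF Suc Suc]] y_bounds by (simp add: power2_eq_square)
    with nB have "norm (B + (Y n o\<^sub>L Y n)) \<le> 1 + (y n)\<^sup>2" by (meson add_mono norm_triangle_le)
    then show ?case unfolding YS yS by simp
  qed (simp add: Y0 y0)
  have Y_step: "norm (Y (Suc n) - Y n) \<le> y (Suc n) - y n" for n
  proof (induction n)
    case 0
    then show ?case using nB by (simp add: YS yS Y0 y0 bounded_bilinear.zero_left[OF bounded_bilinear_blinfun_compose])
  next
    case (Suc n)
    let ?D = "Y (Suc n) - Y n"
    have "Y (Suc (Suc n)) - (1/2) *\<^sub>R (B + (Y n o\<^sub>L Y n)) = (1/2) *\<^sub>R ((?D o\<^sub>L Y (Suc n)) + (Y n o\<^sub>L ?D))"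
      unfolding YS[of "Suc n"]
      by (simp add: bounded_bilinear.diff_left[OF bounded_bilinear_blinfun_compose]
          bounded_bilinear.diff_right[OF bounded_bilinear_blinfun_compose] algebra_simps)
    then have "Y (Suc (Suc n)) - Y (Suc n) = (1/2) *\<^sub>R ((?D o\<^sub>L Y (Suc n)) + (Y n o\<^sub>L ?D))"
      by (simp only: YS[of n, symmetric])
    also have "norm \<dots> \<le> (1/2) * ((y (Suc n) - y n) * y (Suc n) + y n * (y (Suc n) - y n))"
      using order_trans[OF norm_blinfun_compose mult_mono[OF Suc Y_norm[of "Suc n"]]]
        order_trans[OF norm_blinfun_compose mult_mono[OF Y_norm[of n] Suc]] y_bounds y_mono[of n]
      by (simp add: norm_triangle_mono)
    also have "\<dots> = ((y (Suc n))\<^sup>2 - (y n)\<^sup>2) / 2" by (simp add: algebra_simps power2_eq_square)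
    also have "\<dots> = y (Suc (Suc n)) - y (Suc n)" using yS[of "Suc n"] yS[of n] by argo
    finally show ?case .
  qed
  have Y_diff: "norm (Y (n + k) - Y n) \<le> y (n + k) - y n" for n k
  proof (induction k)
    case (Suc k)
    show ?case using norm_triangle_le[OF add_mono[OF Y_step[of "n + k"] Suc]] by simp
  qed simp
  have "convergent y"
    by (rule incseq_convergent[of y 1, THEN exE]) (auto simp: incseq_SucI y_mono y_bounds convergent_def)
  then have "Cauchy y" by (simp add: Cauchy_convergent_iff)
  have "Cauchy Y"
  proof (rule metric_CauchyI)
    fix e :: real assume "e > 0"
    then obtain M where M: "\<And>m n. m \<ge> M \<Longrightarrow> n \<ge> M \<Longrightarrow> dist (y m) (y n) < e"
      using metric_CauchyD[OF \<open>Cauchy y\<close>] by blast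
    have less: "dist (Y m) (Y n) < e" if "n \<ge> M" "m \<ge> n" for m n
      using Y_diff[of n "m - n"] M[of m n] that by (simp add: dist_norm)
    have "dist (Y m) (Y n) < e" if "m \<ge> M" "n \<ge> M" for m n
      using less[of n m] less[of m n] that by (cases "m \<ge> n") (auto simp: dist_commute)
    then show "\<exists>M. \<forall>m\<ge>M. \<forall>n\<ge>M. dist (Y m) (Y n) < e" by blast
  qed
  then obtain L where L: "Y \<longlonglongrightarrow> L" by (auto simp: Cauchy_convergent_iff convergent_def)
  have "(\<lambda>n. Y (Suc n)) \<longlonglongrightarrow> (1/2) *\<^sub>R (B + (L o\<^sub>L L))"
    unfolding YS by (intro tendsto_intros L)
  with LIMSEQ_Suc[OF L] have L_eq: "L = (1/2) *\<^sub>R (B + (L o\<^sub>L L))" by (rule LIMSEQ_unique)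
  have L_lim: "(\<lambda>n. Y n f) \<longlonglongrightarrow> L f" for f by (intro tendsto_intros L)
  have Y_app: "Y (Suc n) f = (1/2) *\<^sub>R (f - A f + Y n (Y n f))" for n f
    by (simp add: YS B blinfun.add_left blinfun.scaleR_left)
  have norm_L: "norm L \<le> 1"
    using order_trans[OF Y_norm conjunct2[OF y_bounds]] by (intro LIMSEQ_le_const2[OF tendsto_norm[OF L]]) auto
  define R where "R f = f - L f" for f
  show ?thesis
  proof (rule that)
    show "bounded_linear R" unfolding R_def by (intro bounded_linear_intros)
    have "Y n f \<bullet> g = f \<bullet> Y n g" for n f g
    proof (induction n arbitrary: f g)
      case (Suc n)
      show ?case by (simp add: Y_app inner_add inner_diff sym Suc)
    qed (simp add: Y0)
    then have "L f \<bullet> g = f \<bullet> L g" for f g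
      using tendsto_inner[OF L_lim[of f] tendsto_const[of g]] tendsto_inner[OF tendsto_const[of f] L_lim[of g]]
      by (simp add: LIMSEQ_unique)
    then show "R f \<bullet> g = f \<bullet> R g" for f g by (simp add: R_def inner_diff)
    show "R f \<bullet> f \<ge> 0" for f
    proof -
      have "L f \<bullet> f \<le> norm (L f) * norm f" by (rule norm_cauchy_schwarz)
      also have "\<dots> \<le> norm f * norm f"
        using norm_L norm_blinfun[of L f] mult_left_le_one_le[of "norm f" "norm L"] by (intro mult_right_mono) auto
      finally show ?thesis by (simp add: R_def inner_diff power2_norm_eq_inner[symmetric] power2_eq_square)
    qed
    show "R (R f) = A f" for f
    proof -
      have "2 *\<^sub>R L f = f - A f + L (L f)"
        using arg_cong[OF L_eq, of "\<lambda>Z. 2 *\<^sub>R blinfun_apply Z f"]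
        by (simp add: B blinfun.add_left blinfun.scaleR_left)
      then show ?thesis by (simp add: R_def blinfun.diff_right scaleR_2 algebra_simps)
    qed
    show "C (R f) = R (C f)" if C: "bounded_linear C" and comm: "\<And>f. C (A f) = A (C f)" for C f
    proof -
      note lin = bounded_linear.linear[OF C]
      have "C (Y n f) = Y n (C f)" for n f
      proof (induction n arbitrary: f)
        case (Suc n)
        show ?case by (simp add: Y_app linear_add[OF lin] linear_diff[OF lin] linear_scale[OF lin] comm Suc)
      qed (simp add: Y0 linear_0[OF lin])
      then have "C (L f) = L (C f)"
        using bounded_linear.tendsto[OF C L_lim[of f]] L_lim[of "C f"] by (simp add: LIMSEQ_unique)
      then show ?thesis by (simp add: R_def linear_diff[OF lin])
    qed
  qed
qed

text \<open>
  Otherwise a small step from \<open>f\<close> in the direction \<open>- P f\<close> would make the form negative.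
\<close>

lemma positive_form_null:
  fixes P :: "'a::real_inner \<Rightarrow> 'a"
  assumes P: "linear P" and sym: "\<And>f g. P f \<bullet> g = f \<bullet> P g" and pos: "\<And>f. P f \<bullet> f \<ge> 0" and null: "P f \<bullet> f = 0"
  shows "P f = 0"
proof (rule ccontr)
  assume "P f \<noteq> 0"
  define g where "g = P f"
  define a where "a = g \<bullet> g"
  have a: "a > 0" using \<open>P f \<noteq> 0\<close> by (simp add: a_def g_def)
  \<comment> \<open>The summand \<open>1\<close> keeps the denominator positive.\<close>
  define t where "t = - a / (P g \<bullet> g + 1)"
  have pg: "P g \<bullet> g \<ge> 0" by (rule pos)
  have "0 \<le> P (f + t *\<^sub>R g) \<bullet> (f + t *\<^sub>R g)" by (rule pos)
  also have "\<dots> = 2 * t * a + t\<^sup>2 * (P g \<bullet> g)"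
    using null sym[of g f]
    by (simp add: linear_add[OF P] linear_scale[OF P] inner_add power2_eq_square a_def flip: g_def)
      (simp add: g_def inner_commute algebra_simps)
  also have "\<dots> = t * (2 * a + t * (P g \<bullet> g))" by (simp add: power2_eq_square algebra_simps)
  finally have *: "0 \<le> t * (2 * a + t * (P g \<bullet> g))" .
  have "t < 0" using a pg by (simp add: t_def divide_neg_pos)
  moreover have "t * (P g \<bullet> g) \<ge> - a" using a pg by (simp add: t_def field_simps)
  ultimately show False using * a by (simp add: zero_le_mult_iff)
qed

text \<open>
  For \<open>y = R x - R' x\<close> commutation gives \<open>(R + R') y = 0\<close>, so both positive forms vanish at \<open>y\<close>; then
  \<open>R y = R' y = 0\<close>, and \<open>\<parallel>y\<parallel>\<^sup>2 = \<langle>x, (R - R') y\<rangle> = 0\<close>.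
\<close>

lemma positive_sqrt_unique:
  fixes R R' :: "'a::{real_inner} \<Rightarrow> 'a"
  assumes R: "linear R" "\<And>f g. R f \<bullet> g = f \<bullet> R g" "\<And>f. R f \<bullet> f \<ge> 0"
    and R': "linear R'" "\<And>f g. R' f \<bullet> g = f \<bullet> R' g" "\<And>f. R' f \<bullet> f \<ge> 0"
    and eq: "\<And>f. R (R f) = R' (R' f)" and comm: "\<And>f. R (R' f) = R' (R f)"
  shows "R = R'"
proof
  fix x
  note l = linear_diff[OF R(1)] linear_diff[OF R'(1)]
  define y where "y = R x - R' x"
  have "R y + R' y = 0" by (simp add: y_def l eq comm)
  then have "R y \<bullet> y + R' y \<bullet> y = 0" by (metis inner_add_left inner_zero_left)
  then have "R y \<bullet> y = 0" "R' y \<bullet> y = 0" using R(3)[of y] R'(3)[of y] by linarith+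
  then have "R y = 0" "R' y = 0" using positive_form_null[OF R] positive_form_null[OF R'] by blast+
  moreover have "y \<bullet> y = x \<bullet> (R y - R' y)"
    by (subst (1) y_def) (simp add: inner_diff R(2) R'(2))
  ultimately show "R x = R' x" by (simp add: y_def)
qed

section \<open>Analytic functions with square-summable coefficients\<close>

definition hfun :: "ell2 \<Rightarrow> cvec" where "hfun f = (\<lambda>z. ev z f)"

lemma hfun_outside: "z \<notin> unit_disc \<Longrightarrow> hfun f z = 0"
proof -
  assume "z \<notin> unit_disc"
  then have "szego z = 0" by (intro ell2_eqI) (simp add: szego.rep_eq)
  then show ?thesis by (simp add: hfun_def ev_def)
qed

lemma ev_holomorphic: "(\<lambda>z. ev z f) holomorphic_on unit_disc"
  by (rule power_series_holomorphic[of _ _ "coef f"]) (use ev_sums in auto)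

lemma taylor_coeff_sums:
  assumes "F holomorphic_on unit_disc" "cmod z < 1"
  shows "(\<lambda>n. taylor_coeff F n * z ^ n) sums F z"
  using holomorphic_power_series[of F 0 1 z] assms by (simp add: taylor_coeff_def fps_expansion_def)

lemma taylor_coeff_eq:
  assumes "\<And>z. cmod z < 1 \<Longrightarrow> (\<lambda>n. a n * z ^ n) sums F z"
  shows "taylor_coeff F n = a n"
proof -
  have "summable (\<lambda>n. a n * (1/2) ^ n)" using assms[of "1/2"] by (simp add: sums_iff)
  then have r: "fps_conv_radius (Abs_fps a) \<ge> ereal (1/2)"
    using conv_radius_geI[of a "1/2"] by (simp add: fps_conv_radius_def)
  have "F has_fps_expansion Abs_fps a"
    unfolding has_fps_expansion_def
  proof
    show "0 < fps_conv_radius (Abs_fps a)" using r by (rule order.strict_trans2[rotated]) simp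
    have "\<forall>\<^sub>F z in nhds 0. z \<in> ball (0::complex) 1" by (intro eventually_nhds_in_open) auto
    then show "\<forall>\<^sub>F z in nhds 0. eval_fps (Abs_fps a) z = F z"
      by eventually_elim (use assms in \<open>simp add: eval_fps_def sums_iff\<close>)
  qed
  then show ?thesis unfolding taylor_coeff_def by (simp add: fps_expansion_eqI)
qed

lemma taylor_coeff_hfun [simp]: "taylor_coeff (hfun f) = coef f"
  by (rule ext, rule taylor_coeff_eq) (simp add: hfun_def ev_sums)

lemma hfun_in_H2 [simp]: "hfun f \<in> H2"
  using ev_holomorphic[of f] hfun_outside[of _ f] summable_coef[of f]
  by (auto simp: H2_def disc_analytic_def hfun_def[symmetric])

lemma hfun_eq_iff [simp]: "hfun f = hfun g \<longleftrightarrow> f = g"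
  by (metis taylor_coeff_hfun coef_inject)

lemma H2_imp_hfun:
  assumes "F \<in> H2" obtains f where "F = hfun f"
proof -
  define f where "f = Abs_ell2 (taylor_coeff F)"
  have f: "coef f = taylor_coeff F" unfolding f_def using assms by (simp add: H2_def Abs_ell2_inverse)
  have "F z = hfun f z" for z
  proof (cases "cmod z < 1")
    case True
    then show ?thesis using taylor_coeff_sums[of F z] ev_sums[of z f] assms sums_unique2
      by (auto simp: H2_def disc_analytic_def f hfun_def)
  next
    case False
    then show ?thesis using assms hfun_outside[of z f] by (simp add: H2_def disc_analytic_def)
  qed
  with that show ?thesis by blast
qed

lemma H2_ip_hfun [simp]: "H2_ip (hfun f) (hfun g) = cip f g"
  using cip_sums[of f g] by (simp add: H2_ip_def sums_iff)

lemma hfun_add: "hfun (f + g) = hfun f + hfun g"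
  and hfun_diff: "hfun (f - g) = hfun f - hfun g"
  and hfun_cmul: "hfun (c *\<^sub>C f) = cscale c (hfun f)"
  and hfun_zero [simp]: "hfun 0 = 0"
  by (auto simp: hfun_def cscale_def fun_eq_iff ev_add ev_diff ev_cmul)

lemma ev_eq_imp_eq: "(\<And>z. cmod z < 1 \<Longrightarrow> ev z f = ev z g) \<Longrightarrow> f = g"
proof -
  assume "\<And>z. cmod z < 1 \<Longrightarrow> ev z f = ev z g"
  then have "hfun f z = hfun g z" for z
    using hfun_outside[of z f] hfun_outside[of z g] by (cases "cmod z < 1") (auto simp: hfun_def)
  then show "f = g" by (metis ext hfun_eq_iff)
qed

section \<open>Means on circles and multipliers\<close>

lemma has_integral_cis:
  "((\<lambda>t. cis (of_int k * t)) has_integral (if k = 0 then 2 * pi else 0)) {0..2*pi}"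
proof (cases "k = 0")
  case True
  have "((\<lambda>t. 1::complex) has_integral of_real (2 * pi)) {0..2*pi}"
    using has_integral_const_real[of "1::complex" 0 "2*pi"] by (simp add: scaleR_conv_of_real)
  with True show ?thesis by simp
next
  case False
  have "((\<lambda>t. cis (of_int k * t)) has_integral
      (cis (of_int k * (2 * pi)) / (\<i> * of_int k) - cis (of_int k * 0) / (\<i> * of_int k))) {0..2*pi}"
  proof (rule fundamental_theorem_of_calculus)
    fix t :: real
    have "((\<lambda>t. cis (of_int k * t)) has_derivative (\<lambda>s. (of_int k * s) *\<^sub>R (\<i> * cis (of_int k * t)))) (at t within {0..2*pi})"
      by (auto intro!: derivative_eq_intros)
    then have "((\<lambda>t. cis (of_int k * t)) has_vector_derivative (of_int k * (\<i> * cis (of_int k * t)))) (at t within {0..2*pi})"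
      unfolding has_vector_derivative_def by (simp add: scaleR_conv_of_real mult_ac)
    then have "((\<lambda>t. cis (of_int k * t) / (\<i> * of_int k)) has_vector_derivative (of_int k * (\<i> * cis (of_int k * t))) / (\<i> * of_int k)) (at t within {0..2*pi})"
      by (rule has_vector_derivative_divide)
    then show "((\<lambda>t. cis (of_int k * t) / (\<i> * of_int k)) has_vector_derivative cis (of_int k * t)) (at t within {0..2*pi})"
      using False by simp
  qed simp
  moreover have "cis (of_int k * (2 * pi)) = 1"
    using cis_multiple_2pi[of "of_int k"] by (simp add: mult_ac)
  ultimately show ?thesis using False by simp
qed

lemma parseval_polynomial:
  fixes a :: "nat \<Rightarrow> complex"
  shows "((\<lambda>t. (cmod (\<Sum>n<N. a n * (of_real r * cis t) ^ n))\<^sup>2) has_integral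
    2 * pi * (\<Sum>n<N. (cmod (a n) * r ^ n)\<^sup>2)) {0..2*pi}"
proof -
  let ?c = "\<lambda>n. a n * of_real r ^ n"
  have "((\<lambda>t. \<Sum>n<N. \<Sum>m<N. ?c n * cnj (?c m) * cis (of_int (int n - int m) * t)) has_integral
      (\<Sum>n<N. \<Sum>m<N. ?c n * cnj (?c m) * (if int n - int m = 0 then 2 * pi else 0))) {0..2*pi}"
    by (intro has_integral_sum has_integral_mult_right has_integral_cis) auto
  moreover have "(\<Sum>n<N. \<Sum>m<N. ?c n * cnj (?c m) * cis (of_int (int n - int m) * t))
      = of_real ((cmod (\<Sum>n<N. a n * (of_real r * cis t) ^ n))\<^sup>2)" for t
  proof -
    have "cis (of_int (int n - int m) * t) = cis (real n * t) * cis (- (real m * t))" for n m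
      unfolding cis_mult by (simp add: algebra_simps)
    then have "cis (of_int (int n - int m) * t) = cis t ^ n * cnj (cis t ^ m)" for n m
      by (simp only: Complex.DeMoivre cis_cnj)
    then have "(\<Sum>n<N. \<Sum>m<N. ?c n * cnj (?c m) * cis (of_int (int n - int m) * t))
      = (\<Sum>n<N. a n * (of_real r * cis t) ^ n) * cnj (\<Sum>m<N. a m * (of_real r * cis t) ^ m)"
      unfolding cnj_sum sum_product by (intro sum.cong refl) (simp add: power_mult_distrib mult_ac)
    then show ?thesis by (simp only: complex_norm_square)
  qed
  moreover have "(\<Sum>n<N. \<Sum>m<N. ?c n * cnj (?c m) * (if int n - int m = 0 then 2 * pi else 0))
    = of_real (2 * pi * (\<Sum>n<N. (cmod (a n) * r ^ n)\<^sup>2))"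
  proof -
    have "(\<Sum>m<N. ?c n * cnj (?c m) * (if int n - int m = 0 then 2 * pi else 0))
      = of_real (2 * pi * (cmod (a n) * r ^ n)\<^sup>2)" if "n < N" for n
    proof -
      have "(\<Sum>m<N. ?c n * cnj (?c m) * (if int n - int m = 0 then 2 * pi else 0))
        = (\<Sum>m<N. if n = m then ?c n * cnj (?c n) * (2 * pi) else 0)" by (intro sum.cong) auto
      also have "\<dots> = ?c n * cnj (?c n) * (2 * pi)" using that by simp
      also have "?c n * cnj (?c n) = of_real ((cmod (a n) * r ^ n)\<^sup>2)"
      proof -
        have "(cmod (?c n))\<^sup>2 = (cmod (a n) * r ^ n)\<^sup>2"
          by (simp add: norm_mult norm_power power_mult_distrib flip: power_abs)
        then show ?thesis by (simp only: complex_norm_square[symmetric])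
      qed
      finally show ?thesis by (simp add: mult.commute)
    qed
    then show ?thesis by (simp add: sum_distrib_left)
  qed
  ultimately have "((\<lambda>t. complex_of_real ((cmod (\<Sum>n<N. a n * (of_real r * cis t) ^ n))\<^sup>2)) has_integral
    of_real (2 * pi * (\<Sum>n<N. (cmod (a n) * r ^ n)\<^sup>2))) {0..2*pi}" by simp
  from has_integral_Re[OF this] show ?thesis by (simp only: Re_complex_of_real)
qed

text \<open>
  The partial sums converge uniformly on the circle of radius \<open>r < 1\<close>, so the formula for polynomials
  passes to the limit.
\<close>

lemma parseval_circle:
  fixes F :: cvec
  assumes F: "\<And>z. cmod z < 1 \<Longrightarrow> (\<lambda>n. a n * z ^ n) sums F z" and r: "0 \<le> r" "r < 1"
  shows "summable (\<lambda>n. (cmod (a n) * r ^ n)\<^sup>2)"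
    and "((\<lambda>t. (cmod (F (of_real r * cis t)))\<^sup>2) has_integral 2 * pi * (\<Sum>n. (cmod (a n) * r ^ n)\<^sup>2)) {0..2*pi}"
proof -
  define P where "P N t = (\<Sum>n<N. a n * (of_real r * cis t) ^ n)" for N and t :: real
  obtain s where s: "r < s" "s < 1" using r dense by blast
  have "summable (\<lambda>n. a n * of_real s ^ n)" using F[of "of_real s"] s r by (auto simp: sums_iff)
  then have "summable (\<lambda>n. cmod (a n * of_real r ^ n))"
    by (rule powser_insidea) (use s r in auto)
  then have sum: "summable (\<lambda>n. cmod (a n) * r ^ n)" using r by (simp add: norm_mult norm_power)
  have lim: "uniform_limit {0..2*pi} P (\<lambda>t. \<Sum>n. a n * (of_real r * cis t) ^ n) sequentially"
    unfolding P_def by (rule Weierstrass_m_test[OF _ sum]) (use r in \<open>simp add: norm_mult norm_power\<close>)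
  have eq: "(\<Sum>n. a n * (of_real r * cis t) ^ n) = F (of_real r * cis t)" for t
    using F[of "of_real r * cis t"] r by (simp add: norm_mult sums_iff)
  have unif: "uniform_limit {0..2*pi} P (\<lambda>t. F (of_real r * cis t)) sequentially" using lim unfolding eq .
  have contP: "continuous_on {0..2*pi} (P N)" for N
    unfolding P_def by (intro continuous_intros)
  have "continuous_on {0..2*pi} (\<lambda>t. F (of_real r * cis t))"
    by (rule uniform_limit_theorem[OF _ unif]) (auto simp: contP)
  then have bdd: "bounded ((\<lambda>t. cmod (F (of_real r * cis t))) ` {0..2*pi})"
    by (intro compact_imp_bounded compact_continuous_image continuous_intros) auto
  have unif2: "uniform_limit {0..2*pi} (\<lambda>N t. (cmod (P N t))\<^sup>2) (\<lambda>t. (cmod (F (of_real r * cis t)))\<^sup>2) sequentially"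
    unfolding power2_eq_square by (intro uniform_lim_mult uniform_limit_norm unif bdd)
  obtain I J where I: "\<And>N. ((\<lambda>t. (cmod (P N t))\<^sup>2) has_integral I N) {0..2*pi}"
    and J: "((\<lambda>t. (cmod (F (of_real r * cis t)))\<^sup>2) has_integral J) {0..2*pi}" and IJ: "I \<longlonglongrightarrow> J"
    by (rule uniform_limit_integral[OF unif2]) (auto intro!: continuous_intros contP)
  have "I N = 2 * pi * (\<Sum>n<N. (cmod (a n) * r ^ n)\<^sup>2)" for N
    using has_integral_unique[OF I parseval_polynomial[where N = N and a = a and r = r, folded P_def]] .
  then have "(\<lambda>N. 2 * pi * (\<Sum>n<N. (cmod (a n) * r ^ n)\<^sup>2)) \<longlonglongrightarrow> J" using IJ by presburger
  then have "(\<lambda>n. 2 * pi * (cmod (a n) * r ^ n)\<^sup>2) sums J" by (simp add: sums_def sum_distrib_left)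
  then have "(\<lambda>n. (cmod (a n) * r ^ n)\<^sup>2) sums (J / (2 * pi))" using sums_divide[of "\<lambda>n. 2 * pi * (cmod (a n) * r ^ n)\<^sup>2" J "2*pi"] by simp
  then show "summable (\<lambda>n. (cmod (a n) * r ^ n)\<^sup>2)"
    and "((\<lambda>t. (cmod (F (of_real r * cis t)))\<^sup>2) has_integral 2 * pi * (\<Sum>n. (cmod (a n) * r ^ n)\<^sup>2)) {0..2*pi}"
    using J by (auto simp: sums_iff)
qed

text \<open>
  A pointwise inequality between moduli on the disc implies the inequality between norms: integrate over
  circles and let the radius tend to \<open>1\<close>. This is how pointwise information about multipliers enters
  the estimates of the forms \<open>\<parallel>R f\<parallel>\<close> and \<open>\<parallel>G f\<parallel>\<close>.
\<close>

lemma norm_form_nonneg: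
  fixes f :: "'i \<Rightarrow> ell2" and s :: "'i \<Rightarrow> real"
  assumes fin: "finite I" and pos: "\<And>z. cmod z < 1 \<Longrightarrow> (\<Sum>i\<in>I. s i * (cmod (ev z (f i)))\<^sup>2) \<ge> 0"
  shows "(\<Sum>i\<in>I. s i * (norm (f i))\<^sup>2) \<ge> 0"
proof -
  define r where "r k = 1 - inverse (real (Suc k))" for k
  have r: "0 \<le> r k" "r k < 1" for k by (auto simp: r_def field_simps)
  have r_lim: "r \<longlonglongrightarrow> 1"
    unfolding r_def using tendsto_diff[OF tendsto_const LIMSEQ_inverse_real_of_nat, of 1] by simp
  define M where "M k i = (\<Sum>n. (cmod (coef (f i) n) * r k ^ n)\<^sup>2)" for k i
  have "(\<Sum>i\<in>I. s i * (2 * pi * M k i)) \<ge> 0" for k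
  proof (rule has_integral_nonneg)
    show "((\<lambda>t. \<Sum>i\<in>I. s i * (cmod (ev (of_real (r k) * cis t) (f i)))\<^sup>2) has_integral (\<Sum>i\<in>I. s i * (2 * pi * M k i))) {0..2*pi}"
      unfolding M_def using parseval_circle(2)[OF ev_sums r] by (intro has_integral_sum has_integral_mult_right fin) auto
    show "0 \<le> (\<Sum>i\<in>I. s i * (cmod (ev (of_real (r k) * cis t) (f i)))\<^sup>2)" for t
      by (rule pos) (use r in \<open>simp add: norm_mult\<close>)
  qed
  moreover have "(\<lambda>k. M k i) \<longlonglongrightarrow> (norm (f i))\<^sup>2" for i
  proof -
    have "(\<lambda>k. suminf (\<lambda>n. (cmod (coef (f i) n) * r k ^ n)\<^sup>2)) \<longlonglongrightarrow> (\<Sum>n. (cmod (coef (f i) n) * 1 ^ n)\<^sup>2)"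
    proof (rule tannerys_theorem[THEN conjunct2, THEN conjunct2])
      show "(\<lambda>k. (cmod (coef (f i) n) * r k ^ n)\<^sup>2) \<longlonglongrightarrow> (cmod (coef (f i) n) * 1 ^ n)\<^sup>2" for n
        by (intro tendsto_intros r_lim)
      show "\<forall>\<^sub>F (n, k) in sequentially \<times>\<^sub>F sequentially. norm ((cmod (coef (f i) n) * r k ^ n)\<^sup>2) \<le> (cmod (coef (f i) n))\<^sup>2"
        using r by (intro always_eventually) (auto intro!: power_mono mult_left_le power_le_one simp: less_imp_le)
    qed (auto simp: summable_coef)
    then show ?thesis by (simp add: M_def norm_ell2_squared)
  qed
  then have "(\<lambda>k. \<Sum>i\<in>I. s i * (2 * pi * M k i)) \<longlonglongrightarrow> (\<Sum>i\<in>I. s i * (2 * pi * (norm (f i))\<^sup>2))"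
    by (intro tendsto_intros)
  ultimately have "0 \<le> (\<Sum>i\<in>I. s i * (2 * pi * (norm (f i))\<^sup>2))" by (intro LIMSEQ_le_const) auto
  also have "\<dots> = 2 * pi * (\<Sum>i\<in>I. s i * (norm (f i))\<^sup>2)" by (simp add: sum_distrib_left mult_ac)
  finally show ?thesis using pi_gt_zero by (auto simp: zero_le_mult_iff)
qed

text \<open>
  The mean of \<open>|b f|\<^sup>2\<close> over a circle is at most that of \<open>|f|\<^sup>2\<close>; by Parseval this bounds the partial sums
  of the squared coefficients of \<open>b f\<close>.
\<close>

lemma mult_contraction:
  assumes b: "b holomorphic_on unit_disc" "\<And>z. cmod z < 1 \<Longrightarrow> cmod (b z) \<le> 1"
  obtains g where "\<And>z. cmod z < 1 \<Longrightarrow> ev z g = b z * ev z f" "norm g \<le> norm f"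
proof -
  define F where "F z = b z * ev z f" for z
  have F: "F holomorphic_on unit_disc" unfolding F_def by (intro holomorphic_intros b ev_holomorphic)
  note Fs = taylor_coeff_sums[OF F]
  define c where "c = taylor_coeff F"
  have r_bound: "(\<Sum>n<N. (cmod (c n) * r ^ n)\<^sup>2) \<le> (norm f)\<^sup>2" if r: "0 \<le> r" "r < 1" for r N
  proof -
    have "2 * pi * (\<Sum>n. (cmod (c n) * r ^ n)\<^sup>2) \<le> 2 * pi * (\<Sum>n. (cmod (coef f n) * r ^ n)\<^sup>2)"
    proof (rule has_integral_le[OF parseval_circle(2)[OF Fs r, folded c_def] parseval_circle(2)[OF ev_sums r]])
      fix t
      have "cmod (of_real r * cis t) < 1" using r by (simp add: norm_mult)
      from b(2)[OF this] show "(cmod (F (of_real r * cis t)))\<^sup>2 \<le> (cmod (ev (of_real r * cis t) f))\<^sup>2"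
        by (auto simp: F_def norm_mult intro!: power_mono mult_left_le_one_le)
    qed
    moreover have "(\<Sum>n<N. (cmod (c n) * r ^ n)\<^sup>2) \<le> (\<Sum>n. (cmod (c n) * r ^ n)\<^sup>2)"
      unfolding c_def by (intro sum_le_suminf parseval_circle(1)[OF Fs r]) auto
    moreover have "(\<Sum>n. (cmod (coef f n) * r ^ n)\<^sup>2) \<le> (norm f)\<^sup>2"
      unfolding norm_ell2_squared using r
      by (intro suminf_le parseval_circle(1)[OF ev_sums r] summable_coef)
        (auto intro!: power_mono mult_left_le power_le_one)
    ultimately show ?thesis by simp
  qed
  have "(\<Sum>n<N. (cmod (c n))\<^sup>2) \<le> (norm f)\<^sup>2" for N
  proof (rule tendsto_upperbound)
    have "((\<lambda>r. \<Sum>n<N. (cmod (c n) * r ^ n)\<^sup>2) \<longlongrightarrow> (\<Sum>n<N. (cmod (c n) * 1 ^ n)\<^sup>2)) (at_left (1::real))"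
      by (intro tendsto_intros)
    then show "((\<lambda>r. \<Sum>n<N. (cmod (c n) * r ^ n)\<^sup>2) \<longlongrightarrow> (\<Sum>n<N. (cmod (c n))\<^sup>2)) (at_left (1::real))" by simp
    show "\<forall>\<^sub>F r in at_left (1::real). (\<Sum>n<N. (cmod (c n) * r ^ n)\<^sup>2) \<le> (norm f)\<^sup>2"
      using eventually_at_left_real[OF zero_less_one] by (auto elim!: eventually_mono intro: r_bound)
  qed simp
  note * = ell2_intro_bound[OF this]
  show ?thesis
  proof (rule that)
    show "norm (Abs_ell2 c) \<le> norm f" by (rule power2_le_imp_le[OF *(2) norm_ge_zero])
    show "ev z (Abs_ell2 c) = b z * ev z f" if "cmod z < 1" for z
    proof -
      have "(\<lambda>n. c n * z ^ n) sums ev z (Abs_ell2 c)" using ev_sums[OF that, of "Abs_ell2 c"] by (simp only: *(1))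
      with Fs[OF that, folded c_def] have "ev z (Abs_ell2 c) = F z" using sums_unique2 by blast
      then show ?thesis by (simp add: F_def)
    qed
  qed
qed

section \<open>Multiplication operators and their defect operators\<close>

lemma mult_op_clinear:
  assumes ev: "\<And>z f. cmod z < 1 \<Longrightarrow> ev z (T f) = b z * ev z f" and bd: "\<And>f. norm (T f) \<le> norm f"
  shows "bounded_clinear T"
proof (rule bounded_clinearI)
  show "bounded_linear T"
  proof (rule bounded_linear_intro[of _ 1])
    show "T (f + g) = T f + T g" for f g
      by (rule ev_eq_imp_eq) (simp add: ev ev_add algebra_simps)
    show "T (r *\<^sub>R f) = r *\<^sub>R T f" for r f
      by (rule ev_eq_imp_eq) (simp add: ev ev_cmul scaleR_cmul)
  qed (simp add: bd)
  show "T (\<i> *\<^sub>C f) = \<i> *\<^sub>C T f" for f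
    by (rule ev_eq_imp_eq) (simp add: ev ev_cmul)
qed

text \<open>
  Such an operator sends \<open>z\<^sup>n\<close> to \<open>z\<^sup>n\<close> times the image of \<open>1\<close>.
\<close>

lemma shift_commuting_imp_mult:
  assumes V: "bounded_clinear V" and comm: "\<And>f. V (shift f) = shift (V f)" and z: "cmod z < 1"
  shows "ev z (V f) = ev z (V (monomial 0)) * ev z f"
proof (induction f rule: ell2_dense_induct)
  case (1 n)
  have "ev z (V (monomial n)) = z ^ n * ev z (V (monomial 0))"
    by (induction n) (simp_all add: comm ev_shift flip: shift_monomial)
  then show ?case by (simp add: ev_monomial z)
next
  case (2 f g)
  then show ?case by (simp add: bounded_clinearD(3)[OF V] ev_add algebra_simps)
next
  case (3 c f)
  then show ?case by (simp add: bounded_clinearD(2)[OF V] ev_cmul)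
next
  case (4 X f)
  have "(\<lambda>k. ev z (V (X k))) \<longlonglongrightarrow> ev z (V f)"
    by (intro tendsto_ev bounded_linear.tendsto[OF bounded_clinearD(1)[OF V]] 4)
  moreover have "(\<lambda>k. ev z (V (monomial 0)) * ev z (X k)) \<longlonglongrightarrow> ev z (V (monomial 0)) * ev z f"
    by (intro tendsto_intros tendsto_ev 4)
  ultimately show ?case using 4(1) LIMSEQ_unique by simp
qed

text \<open>
  The commutation clause is part of the choice because it is what makes the root complex linear and
  comparable with any other positive root.
\<close>

definition psqrt :: "('a::{real_inner,banach} \<Rightarrow> 'a) \<Rightarrow> 'a \<Rightarrow> 'a" where
  "psqrt A = (SOME R. bounded_linear R \<and> (\<forall>f g. R f \<bullet> g = f \<bullet> R g) \<and> (\<forall>f. R f \<bullet> f \<ge> 0) \<and> (\<forall>f. R (R f) = A f) \<and>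
    (\<forall>C. bounded_linear C \<longrightarrow> (\<forall>f. C (A f) = A (C f)) \<longrightarrow> (\<forall>f. C (R f) = R (C f))))"

lemma psqrt:
  fixes A :: "'a::{real_inner,banach} \<Rightarrow> 'a"
  assumes "bounded_linear A" "\<And>f g. A f \<bullet> g = f \<bullet> A g" "\<And>f. norm (f - A f) \<le> norm f"
  shows "bounded_linear (psqrt A)" "psqrt A f \<bullet> g = f \<bullet> psqrt A g" "psqrt A f \<bullet> f \<ge> 0" "psqrt A (psqrt A f) = A f"
    "bounded_linear C \<Longrightarrow> (\<And>f. C (A f) = A (C f)) \<Longrightarrow> C (psqrt A f) = psqrt A (C f)"
proof -
  obtain R where "bounded_linear R \<and> (\<forall>f g. R f \<bullet> g = f \<bullet> R g) \<and> (\<forall>f. R f \<bullet> f \<ge> 0) \<and> (\<forall>f. R (R f) = A f) \<and>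
    (\<forall>C. bounded_linear C \<longrightarrow> (\<forall>f. C (A f) = A (C f)) \<longrightarrow> (\<forall>f. C (R f) = R (C f)))"
    by (rule positive_sqrt_exists[OF assms]) blast
  from someI[of "\<lambda>R. bounded_linear R \<and> (\<forall>f g. R f \<bullet> g = f \<bullet> R g) \<and> (\<forall>f. R f \<bullet> f \<ge> 0) \<and> (\<forall>f. R (R f) = A f) \<and>
    (\<forall>C. bounded_linear C \<longrightarrow> (\<forall>f. C (A f) = A (C f)) \<longrightarrow> (\<forall>f. C (R f) = R (C f)))", OF this, folded psqrt_def]
  show "bounded_linear (psqrt A)" "psqrt A f \<bullet> g = f \<bullet> psqrt A g" "psqrt A f \<bullet> f \<ge> 0" "psqrt A (psqrt A f) = A f"
    "bounded_linear C \<Longrightarrow> (\<And>f. C (A f) = A (C f)) \<Longrightarrow> C (psqrt A f) = psqrt A (C f)"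
    by blast+
qed

lemma closure_range_sequence:
  fixes R :: "'a \<Rightarrow> 'b::metric_space"
  assumes "y \<in> closure (range R)" obtains g where "(\<lambda>n. R (g n)) \<longlonglongrightarrow> y"
proof -
  obtain Y where Y: "\<forall>n. \<exists>f. Y n = R f" "Y \<longlonglongrightarrow> y"
    using assms unfolding closure_sequential by (auto simp: image_iff)
  then obtain g where "\<And>n. Y n = R (g n)" by metis
  then have "Y = (\<lambda>n. R (g n))" by blast
  with Y(2) show ?thesis using that by blast
qed

text \<open>
  The functional \<open>R f \<mapsto> \<langle>f, u\<rangle>\<close> is well defined and bounded on the range of \<open>R\<close>, so it is represented by
  some \<open>x\<close> in its closure; symmetry of \<open>R\<close> turns this into \<open>R x = u\<close>. This characterises the elements of
  \<open>H(b)\<close> and their norms by inequalities.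
\<close>

lemma range_symmetricI:
  fixes R :: "'a::{real_inner,complete_space} \<Rightarrow> 'a"
  assumes R: "bounded_linear R" and sym: "\<And>f g. R f \<bullet> g = f \<bullet> R g" and bd: "\<And>f. \<bar>f \<bullet> u\<bar> \<le> C * norm (R f)" and C: "C \<ge> 0"
  obtains x where "x \<in> closure (range R)" "R x = u" "norm x \<le> C"
proof -
  have "linear (\<lambda>f. f \<bullet> u)" by (intro bounded_linear.linear bounded_linear_inner_left)
  then obtain x where x: "x \<in> closure (range R)" "\<And>f. f \<bullet> u = x \<bullet> R f"
    by (rule riesz_minimizer[OF bounded_linear.linear[OF R] _ subspace_UNIV bd]) auto
  have "R x = u" by (rule inner_eq_imp_eq) (metis inner_commute sym x(2))
  moreover have "norm x \<le> C"
  proof -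
    obtain g where g: "(\<lambda>n. R (g n)) \<longlonglongrightarrow> x" using x(1) by (rule closure_range_sequence)
    have "R (g n) \<bullet> x \<le> C * norm (R (g n))" for n
      using bd[of "g n"] x(2)[of "g n"] by (simp add: inner_commute)
    then have "x \<bullet> x \<le> C * norm x"
      by (intro LIMSEQ_le[OF tendsto_inner[OF g tendsto_const] tendsto_mult[OF tendsto_const tendsto_norm[OF g]]]) auto
    then have "norm x * norm x \<le> C * norm x" by (simp add: power2_norm_eq_inner[symmetric] power2_eq_square)
    then show ?thesis using C by (cases "norm x = 0") auto
  qed
  ultimately show ?thesis using that x by blast
qed

text \<open>
  Bessel's inequality makes the coefficient map of an orthonormal sequence a contraction.
\<close>

lemma orthonormal_analysis:
  assumes E: "\<And>i j. cip (E i) (E j) = (if i = j then 1 else 0)"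
  obtains V where "bounded_clinear V" "\<And>x. norm (V x) \<le> norm x" "\<And>x n. coef (V x) n = cip x (E n)"
proof -
  have bessel: "(\<Sum>n<N. (cmod (cip x (E n)))\<^sup>2) \<le> (norm x)\<^sup>2" for x and N :: nat
  proof -
    define s where "s = (\<Sum>n<N. (cmod (cip x (E n)))\<^sup>2)"
    define u where "u = (\<Sum>n<N. cip x (E n) *\<^sub>C E n)"
    have left: "cip (\<Sum>n\<in>A. h n) v = (\<Sum>n\<in>A. cip (h n) v)" and right: "cip v (\<Sum>n\<in>A. h n) = (\<Sum>n\<in>A. cip v (h n))"
      if "finite A" for A :: "nat set" and h v
      using that by (induction A) (simp_all add: cip_add_left cip_add_right)
    have xu: "cip x u = of_real s"
      by (simp add: u_def s_def right complex_norm_square mult.commute del: of_real_power)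
    have Eu: "cip (E n) u = cnj (cip x (E n))" if "n < N" for n
      using that by (simp add: u_def right E if_distrib[of "\<lambda>x. _ * x"] cong: if_cong)
    have "cip u u = (\<Sum>n<N. cip x (E n) * cip (E n) u)"
      by (subst (1) u_def) (simp add: left)
    also have "\<dots> = of_real s" by (simp add: Eu s_def complex_norm_square del: of_real_power)
    finally have "(norm u)\<^sup>2 = s" unfolding cip_self of_real_eq_iff .
    moreover have "s \<ge> 0" unfolding s_def by (intro sum_nonneg) auto
    moreover have "s \<le> norm x * norm u" using norm_cip_le[of x u] \<open>s \<ge> 0\<close> by (simp add: xu)
    ultimately have "norm u \<le> norm x" by (cases "norm u = 0") (auto simp: power2_eq_square)
    with \<open>(norm u)\<^sup>2 = s\<close> show ?thesis unfolding s_def by (metis norm_ge_zero power_mono)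
  qed
  define V where "V x = Abs_ell2 (\<lambda>n. cip x (E n))" for x
  have cV: "coef (V x) n = cip x (E n)" for x n
    unfolding V_def by (subst ell2_intro_bound(1)[OF bessel[of x]]) simp
  have nV: "norm (V x) \<le> norm x" for x
    using ell2_intro_bound(2)[OF bessel[of x]] unfolding V_def by (rule power2_le_imp_le) simp
  show ?thesis
  proof (rule that[OF _ nV cV], rule bounded_clinearI)
    show "bounded_linear V"
      by (rule bounded_linear_intro[of _ 1])
        (auto intro!: ell2_eqI simp: cV nV cip_add_left scaleR_cmul)
    show "V (\<i> *\<^sub>C f) = \<i> *\<^sub>C V f" for f by (rule ell2_eqI) (simp add: cV)
  qed
qed

text \<open>
  Test the hypothesis on the kernel at \<open>z\<close>: since \<open>\<langle>V k\<^sub>z, k\<^sub>z\<rangle> = a(z) \<parallel>k\<^sub>z\<parallel>\<^sup>2\<close>, one has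
  \<open>|a(z)| \<parallel>k\<^sub>z\<parallel> \<le> \<parallel>V k\<^sub>z\<parallel>\<close>, and likewise for \<open>T\<close>.
\<close>

lemma norm_mult_pair_bound:
  assumes V: "\<And>z f. cmod z < 1 \<Longrightarrow> ev z (V f) = a z * ev z f" and T: "\<And>z f. cmod z < 1 \<Longrightarrow> ev z (T f) = b z * ev z f"
    and le: "\<And>f. (norm (V f))\<^sup>2 + (norm (T f))\<^sup>2 \<le> (norm f)\<^sup>2" and z: "cmod z < 1"
  shows "(cmod (a z))\<^sup>2 + (cmod (b z))\<^sup>2 \<le> 1"
proof -
  let ?k = "szego z"
  have k: "cmod (ev z ?k) = norm ?k * norm ?k" by (simp add: ev_def cip_self power2_eq_square norm_mult)
  have "ev z (monomial 0) = 1" using ev_monomial[OF z, of 0] by simp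
  then have pos: "norm ?k > 0" by (auto simp: ev_def)
  have "cmod (c z) * norm ?k \<le> norm (W ?k)" if "\<And>z f. cmod z < 1 \<Longrightarrow> ev z (W f) = c z * ev z f" for W c
    using norm_ev_le[of z "W ?k"] pos by (simp add: that[OF z] norm_mult k mult_ac)
  then have "(cmod (a z) * norm ?k)\<^sup>2 \<le> (norm (V ?k))\<^sup>2" "(cmod (b z) * norm ?k)\<^sup>2 \<le> (norm (T ?k))\<^sup>2"
    using V T by (auto intro!: power_mono)
  with le[of ?k] have "((cmod (a z))\<^sup>2 + (cmod (b z))\<^sup>2) * (norm ?k)\<^sup>2 \<le> 1 * (norm ?k)\<^sup>2"
    by (simp add: power_mult_distrib algebra_simps)
  then show ?thesis using pos by (simp only: mult_le_cancel_right) auto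
qed

locale schur =
  fixes b :: cvec
  assumes hol: "b holomorphic_on unit_disc" and bound: "\<And>z. cmod z < 1 \<Longrightarrow> cmod (b z) \<le> 1"
begin

definition T :: "ell2 \<Rightarrow> ell2" where
  "T f = (SOME g. (\<forall>z. cmod z < 1 \<longrightarrow> ev z g = b z * ev z f) \<and> norm g \<le> norm f)"

lemma T: "cmod z < 1 \<Longrightarrow> ev z (T f) = b z * ev z f" "norm (T f) \<le> norm f"
proof -
  obtain g where "(\<forall>z. cmod z < 1 \<longrightarrow> ev z g = b z * ev z f) \<and> norm g \<le> norm f"
    by (rule mult_contraction[OF hol bound]) auto
  from someI[of "\<lambda>g. (\<forall>z. cmod z < 1 \<longrightarrow> ev z g = b z * ev z f) \<and> norm g \<le> norm f", OF this, folded T_def]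
  show "cmod z < 1 \<Longrightarrow> ev z (T f) = b z * ev z f" "norm (T f) \<le> norm f" by auto
qed

lemma T_clinear: "bounded_clinear T"
  by (rule mult_op_clinear[OF T])

lemma T_shift: "T (shift f) = shift (T f)"
  by (rule ev_eq_imp_eq) (simp add: T ev_shift)

abbreviation Ts :: "ell2 \<Rightarrow> ell2" where "Ts \<equiv> adj T"

lemmas Ts_clinear = bounded_clinear_adj[OF T_clinear]
lemmas cip_Ts = cip_adj[OF T_clinear]
lemmas inner_Ts = inner_adj[OF bounded_clinearD(1)[OF T_clinear]]

lemma norm_Ts_le: "norm (Ts f) \<le> norm f"
  using norm_adj_le[OF bounded_clinearD(1)[OF T_clinear], of 1 f] T(2) by simp

lemma bshift_Ts: "bshift (Ts f) = Ts (bshift f)"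
proof (rule inner_eq_imp_eq)
  show "g \<bullet> bshift (Ts f) = g \<bullet> Ts (bshift f)" for g
    by (metis T_shift inner_Ts inner_shift)
qed

text \<open>
  The Toeplitz identity \<open>S\<^sup>* T\<^sup>* S = T\<^sup>*\<close>.
\<close>

lemma bshift_Ts_shift: "bshift (Ts (shift f)) = Ts f"
  by (simp add: bshift_Ts)

definition R :: "ell2 \<Rightarrow> ell2" where "R = psqrt (\<lambda>f. f - T (Ts f))"
definition G :: "ell2 \<Rightarrow> ell2" where "G = psqrt (\<lambda>f. f - Ts (T f))"

lemma inner_Ts': "Ts f \<bullet> g = f \<bullet> T g"
  using inner_Ts[of g f] by (simp add: inner_commute)

lemma R_assms:
  shows "bounded_linear (\<lambda>f. f - T (Ts f))" "(f - T (Ts f)) \<bullet> g = f \<bullet> (g - T (Ts g))" "norm (f - (f - T (Ts f))) \<le> norm f"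
proof -
  show "bounded_linear (\<lambda>f. f - T (Ts f))"
    using bounded_clinearD(1)[OF bounded_clinear_compose[OF T_clinear Ts_clinear]] by (intro bounded_linear_intros)
  show "(f - T (Ts f)) \<bullet> g = f \<bullet> (g - T (Ts g))"
    by (simp add: inner_diff inner_Ts inner_Ts')
  show "norm (f - (f - T (Ts f))) \<le> norm f" using T(2)[of "Ts f"] norm_Ts_le[of f] by simp
qed

lemma G_assms:
  shows "bounded_linear (\<lambda>f. f - Ts (T f))" "(f - Ts (T f)) \<bullet> g = f \<bullet> (g - Ts (T g))" "norm (f - (f - Ts (T f))) \<le> norm f"
proof -
  show "bounded_linear (\<lambda>f. f - Ts (T f))"
    using bounded_clinearD(1)[OF bounded_clinear_compose[OF Ts_clinear T_clinear]] by (intro bounded_linear_intros)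
  show "(f - Ts (T f)) \<bullet> g = f \<bullet> (g - Ts (T g))"
    by (simp add: inner_diff inner_Ts inner_Ts')
  show "norm (f - (f - Ts (T f))) \<le> norm f" using T(2)[of f] norm_Ts_le[of "T f"] by simp
qed

lemmas R = psqrt[OF R_assms, folded R_def]
lemmas G = psqrt[OF G_assms, folded G_def]

lemma R_clinear: "bounded_clinear R"
proof (rule bounded_clinearI[OF R(1)])
  show "R (\<i> *\<^sub>C f) = \<i> *\<^sub>C R f" for f
    by (rule R(5)[OF bounded_linear_cmul, symmetric])
      (simp add: cmul_diff bounded_clinearD(2)[OF T_clinear] bounded_clinearD(2)[OF Ts_clinear])
qed

lemma G_clinear: "bounded_clinear G"
proof (rule bounded_clinearI[OF G(1)])
  show "G (\<i> *\<^sub>C f) = \<i> *\<^sub>C G f" for f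
    by (rule G(5)[OF bounded_linear_cmul, symmetric])
      (simp add: cmul_diff bounded_clinearD(2)[OF T_clinear] bounded_clinearD(2)[OF Ts_clinear])
qed

lemma norm_R_squared: "(norm (R f))\<^sup>2 = (norm f)\<^sup>2 - (norm (Ts f))\<^sup>2"
  unfolding power2_norm_eq_inner R(2) R(4) by (simp add: inner_diff inner_Ts' inner_commute)

lemma norm_G_squared: "(norm (G f))\<^sup>2 = (norm f)\<^sup>2 - (norm (T f))\<^sup>2"
  unfolding power2_norm_eq_inner G(2) G(4) by (simp add: inner_diff inner_Ts inner_commute)

lemma cip_G_G: "cip (G f) (G g) = cip f g - cip (T f) (T g)"
proof -
  have "cip (G f) (G g) = cip f (G (G g))"
    using G(2)[of f "G g"] G(2)[of f "G (\<i> *\<^sub>C g)"]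
    by (simp add: cip_def bounded_clinearD(2)[OF G_clinear])
  then show ?thesis by (simp add: G(4) cip_diff_right cip_Ts)
qed

lemma cip_R: "cip (R f) g = cip f (R g)"
  using R(2)[of f g] R(2)[of f "\<i> *\<^sub>C g"] by (simp add: cip_def bounded_clinearD(2)[OF R_clinear])

lemma norm_R_le: "norm (R f) \<le> norm f"
  by (rule power2_le_imp_le) (simp_all add: norm_R_squared)

text \<open>
  From \<open>T\<^sup>* f = S\<^sup>* T\<^sup>* S f\<close> one gets \<open>\<parallel>T\<^sup>* f\<parallel> \<le> \<parallel>T\<^sup>* S f\<parallel>\<close>. By duality the backward shift is a contraction
  on \<open>H(b)\<close>.
\<close>

lemma norm_R_shift_le: "norm (R (shift f)) \<le> norm (R f)"
proof (rule power2_le_imp_le)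
  have "norm (Ts f) \<le> norm (Ts (shift f))" using norm_bshift_le[of "Ts (shift f)"] by (simp add: bshift_Ts_shift)
  then show "(norm (R (shift f)))\<^sup>2 \<le> (norm (R f))\<^sup>2"
    unfolding norm_R_squared by (simp add: power_mono)
qed simp

lemma norm_G_shift: "norm (G (shift f)) = norm (G f)"
proof -
  have "(norm (G (shift f)))\<^sup>2 = (norm (G f))\<^sup>2" unfolding norm_G_squared by (simp add: T_shift)
  then show ?thesis by simp
qed

lemma cip_G_shift: "cip (G (shift f)) (G (shift g)) = cip (G f) (G g)"
  by (simp add: cip_G_G T_shift)

text \<open>
  The difference of the squares is \<open>\<parallel>f - T T\<^sup>* f\<parallel>\<^sup>2\<close>, and in the next lemma \<open>\<parallel>f - T\<^sup>* T f\<parallel>\<^sup>2\<close>.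
\<close>

lemma norm_G_Ts_le: "norm (G (Ts f)) \<le> norm (R f)"
proof (rule power2_le_imp_le)
  have "0 \<le> (norm (f - T (Ts f)))\<^sup>2" by simp
  also have "\<dots> = (norm f)\<^sup>2 - 2 * (norm (Ts f))\<^sup>2 + (norm (T (Ts f)))\<^sup>2"
    unfolding power2_norm_eq_inner by (simp add: inner_diff inner_Ts' inner_Ts inner_commute)
  finally show "(norm (G (Ts f)))\<^sup>2 \<le> (norm (R f))\<^sup>2" unfolding norm_G_squared norm_R_squared by simp
qed simp

lemma norm_R_T_le: "norm (R (T f)) \<le> norm (G f)"
proof (rule power2_le_imp_le)
  have "0 \<le> (norm (f - Ts (T f)))\<^sup>2" by simp
  also have "\<dots> = (norm f)\<^sup>2 - 2 * (norm (T f))\<^sup>2 + (norm (Ts (T f)))\<^sup>2"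
    unfolding power2_norm_eq_inner by (simp add: inner_diff inner_Ts' inner_Ts inner_commute)
  finally show "(norm (R (T f)))\<^sup>2 \<le> (norm (G f))\<^sup>2" unfolding norm_G_squared norm_R_squared by simp
qed simp

text \<open>
  Split \<open>f = T T\<^sup>* f + R\<^sup>2 f\<close> and evaluate: the first term is \<open>b(z) (T\<^sup>* f)(z)\<close>.
\<close>

lemma norm_ev_le_R:
  assumes "cmod z < 1"
  shows "cmod (ev z f) \<le> cmod (ev z (Ts f)) + norm (szego z) * norm (R f)"
proof -
  have "ev z f = b z * ev z (Ts f) + ev z (R (R f))"
    by (simp add: R(4) ev_diff T assms)
  moreover have "cmod (b z * ev z (Ts f)) \<le> cmod (ev z (Ts f))"
    using bound[OF assms] by (simp add: norm_mult mult_left_le_one_le)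
  moreover have "cmod (ev z (R (R f))) \<le> norm (szego z) * norm (R f)"
    using norm_ev_le[of z "R (R f)"] norm_R_le[of "R f"] by (meson mult_left_mono norm_ge_zero order_trans)
  ultimately show ?thesis using norm_triangle_ineq[of "b z * ev z (Ts f)" "ev z (R (R f))"] by simp
qed

end

section \<open>Bounded evaluations and mates\<close>

lemma norm_szego_squared: "cmod z < 1 \<Longrightarrow> (norm (szego z))\<^sup>2 = 1 / (1 - (cmod z)\<^sup>2)"
proof -
  assume z: "cmod z < 1"
  then have "(cmod z)\<^sup>2 < 1" by (simp add: abs_square_less_1)
  then have "(\<lambda>n. ((cmod z)\<^sup>2) ^ n) sums (1 / (1 - (cmod z)\<^sup>2))" by (intro geometric_sums) simp
  moreover have "(cmod (coef (szego z) n))\<^sup>2 = ((cmod z)\<^sup>2) ^ n" for n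
    using z by (simp add: szego.rep_eq norm_power mult.commute flip: power_mult)
  ultimately show ?thesis by (simp add: norm_ell2_squared sums_iff)
qed

context schur
begin

text \<open>
  The Wold decomposition of the shift in the seminorm \<open>\<parallel>G f\<parallel>\<close>, for which it is isometric. Let \<open>e\<close> be the part
  of \<open>G 1\<close> orthogonal to \<open>G S H\<^sup>2\<close>. Were \<open>e = 0\<close>, every \<open>G f\<close> would be a limit of vectors \<open>G S q\<close>; as evaluation
  of \<open>S q\<close> at \<open>\<alpha>\<close> carries the factor \<open>\<alpha>\<close>, a bound \<open>K\<close> for the evaluation could be improved to \<open>|\<alpha>| K\<close>, then to
  \<open>|\<alpha>|\<^sup>2 K\<close>, and so on, and the evaluation would vanish. So \<open>e\<close> is nonzero; normalised, it generates an
  orthonormal sequence under the isometry, and \<open>V\<close> is the coefficient map of that sequence. It commutes with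
  the shift and is therefore multiplication by an analytic function. The sequence \<open>X\<close> with \<open>G X\<^sub>m \<rightarrow> e\<close> is
  carried to a sequence with limit \<open>1\<close>, which says that this function is outer.
\<close>

lemma outer_factor:
  assumes \<alpha>: "cmod \<alpha> < 1" and bd: "\<And>f. cmod (ev \<alpha> f) \<le> C * norm (G f)"
  obtains V X where "bounded_clinear V" "\<And>f. V (shift f) = shift (V f)" "\<And>f. norm (V f) \<le> norm (G f)"
    "(\<lambda>m. V (X m)) \<longlonglongrightarrow> monomial 0" "(\<lambda>m. norm (G (X m))) \<longlonglongrightarrow> 1"
proof -
  note Gl = bounded_clinearD[OF G_clinear]
  note Sl = bounded_clinearD[OF bounded_clinear_shift]
  have GS: "bounded_clinear (\<lambda>f. G (shift f))" by (rule bounded_clinear_compose[OF G_clinear bounded_clinear_shift])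
  note GSl = bounded_clinearD[OF GS]
  obtain y where y: "y \<in> closure (range (\<lambda>f. G (shift f)))" "\<And>f. G (monomial 0) \<bullet> G (shift f) = y \<bullet> G (shift f)"
  proof (rule riesz_minimizer[OF bounded_linear.linear[OF GSl(1)] _ subspace_UNIV])
    show "linear (\<lambda>f. G (monomial 0) \<bullet> G (shift f))"
      using bounded_linear_inner_right_comp[OF GSl(1)] by (rule bounded_linear.linear)
    show "\<bar>G (monomial 0) \<bullet> G (shift f)\<bar> \<le> norm (G (monomial 0)) * norm (G (shift f))" for f
      by (rule Cauchy_Schwarz_ineq2)
  qed auto
  obtain p where p: "(\<lambda>m. G (shift (p m))) \<longlonglongrightarrow> y"
    using y(1) by (rule closure_range_sequence)
  define e where "e = G (monomial 0) - y"
  have e_orth_real: "e \<bullet> G (shift f) = 0" for f using y(2) by (simp add: e_def inner_diff_left)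
  have e_orth: "cip e (G (shift f)) = 0" for f
    unfolding cip_def using e_orth_real[of f] e_orth_real[of "\<i> *\<^sub>C f"] by (simp add: GSl(2) complex_eq_iff)
  \<comment> \<open>Otherwise any bound for the evaluation at \<open>\<alpha>\<close> could be improved by the factor \<open>|\<alpha>|\<close>.\<close>
  have "e \<noteq> 0"
  proof
    assume "e = 0"
    then have p1: "(\<lambda>m. G (shift (p m))) \<longlonglongrightarrow> G (monomial 0)" using p by (simp add: e_def)
    define q where "q f m = coef f 0 *\<^sub>C p m + bshift f" for f m
    have q: "(\<lambda>m. G (shift (q f m))) \<longlonglongrightarrow> G f" for f
    proof -
      have "(\<lambda>m. coef f 0 *\<^sub>C G (shift (p m)) + G (shift (bshift f))) \<longlonglongrightarrow> coef f 0 *\<^sub>C G (monomial 0) + G (shift (bshift f))"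
        by (intro tendsto_intros bounded_linear.tendsto[OF bounded_linear_cmul] p1)
      moreover have "coef f 0 *\<^sub>C G (monomial 0) + G (shift (bshift f)) = G f"
        by (metis shift_bshift[of f] Gl(2,3))
      ultimately show ?thesis by (simp add: q_def GSl)
    qed
    have step: "cmod (ev \<alpha> f) \<le> cmod \<alpha> * K * norm (G f)" if K: "\<And>f. cmod (ev \<alpha> f) \<le> K * norm (G f)" for K f
    proof (rule LIMSEQ_le_const)
      have "(\<lambda>m. K * norm (G f - G (shift (q f m))) + cmod \<alpha> * (K * norm (G (shift (q f m))))) \<longlonglongrightarrow> K * norm (G f - G f) + cmod \<alpha> * (K * norm (G f))"
        by (intro tendsto_intros q)
      then show "(\<lambda>m. K * norm (G f - G (shift (q f m))) + cmod \<alpha> * (K * norm (G (shift (q f m))))) \<longlonglongrightarrow> cmod \<alpha> * K * norm (G f)"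
        by (simp add: mult.assoc)
      have "cmod (ev \<alpha> f) \<le> K * norm (G f - G (shift (q f m))) + cmod \<alpha> * (K * norm (G (shift (q f m))))" for m
      proof -
        have "ev \<alpha> f = ev \<alpha> (f - shift (q f m)) + \<alpha> * ev \<alpha> (q f m)" by (simp add: ev_diff ev_shift)
        then have "cmod (ev \<alpha> f) \<le> cmod (ev \<alpha> (f - shift (q f m))) + cmod \<alpha> * cmod (ev \<alpha> (q f m))"
          by (metis norm_mult norm_triangle_ineq)
        also have "\<dots> \<le> K * norm (G (f - shift (q f m))) + cmod \<alpha> * (K * norm (G (q f m)))"
          by (intro add_mono mult_left_mono K) auto
        finally show ?thesis by (simp add: Gl(4) norm_G_shift)
      qed
      then show "\<exists>N. \<forall>n\<ge>N. cmod (ev \<alpha> f) \<le> K * norm (G f - G (shift (q f n))) + cmod \<alpha> * (K * norm (G (shift (q f n))))" by blast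
    qed
    have iter: "cmod (ev \<alpha> f) \<le> cmod \<alpha> ^ n * C * norm (G f)" for n f
    proof (induction n arbitrary: f)
      case (Suc n)
      show ?case using step[OF Suc] by (simp add: mult.assoc)
    qed (simp add: bd)
    have "(\<lambda>n. cmod \<alpha> ^ n * C * norm (G (monomial 0))) \<longlonglongrightarrow> 0 * C * norm (G (monomial 0))"
      using \<alpha> by (intro tendsto_intros LIMSEQ_power_zero) simp
    then have "cmod (ev \<alpha> (monomial 0)) \<le> 0 * C * norm (G (monomial 0))"
      by (rule LIMSEQ_le_const) (use iter in blast)
    then show False using ev_monomial[OF \<alpha>, of 0] by simp
  qed
  define d where "d = complex_of_real (1 / norm e)"
  define X where "X m = d *\<^sub>C (monomial 0 - shift (p m))" for m
  define e1 where "e1 = d *\<^sub>C e"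
  have GX: "(\<lambda>m. G (X m)) \<longlonglongrightarrow> e1"
    unfolding X_def e1_def e_def Gl(2) Gl(4) by (intro tendsto_intros bounded_linear.tendsto[OF bounded_linear_cmul] p)
  have norm_e1: "norm e1 = 1" using \<open>e \<noteq> 0\<close> by (simp add: e1_def d_def norm_divide)
  have e1_orth: "cip e1 (G (shift f)) = 0" for f using e_orth by (simp add: e1_def)
  have GSn_norm: "norm (G ((shift ^^ n) f)) = norm (G f)" for n f
    by (induction n) (simp_all add: norm_G_shift)
  have Sn_diff: "(shift ^^ n) (f - g) = (shift ^^ n) f - (shift ^^ n) g" for n f g
    by (induction n) (simp_all add: Sl(4))
  have "Cauchy (\<lambda>m. G ((shift ^^ n) (X m)))" for n
    using LIMSEQ_imp_Cauchy[OF GX] unfolding Cauchy_def dist_norm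
    by (simp flip: Gl(4) Sn_diff add: GSn_norm)
  then have "\<exists>E. (\<lambda>m. G ((shift ^^ n) (X m))) \<longlonglongrightarrow> E" for n by (simp add: Cauchy_convergent_iff convergent_def)
  then obtain E where E: "\<And>n. (\<lambda>m. G ((shift ^^ n) (X m))) \<longlonglongrightarrow> E n" by metis
  have E0: "E 0 = e1" using E[of 0] GX LIMSEQ_unique by auto
  have E_Suc: "cip (G (shift f)) (E (Suc n)) = cip (G f) (E n)" for f n
  proof -
    have "(\<lambda>m. cip (G (shift f)) (G ((shift ^^ Suc n) (X m)))) \<longlonglongrightarrow> cip (G (shift f)) (E (Suc n))"
      by (rule tendsto_cip_right[OF E])
    moreover have "(\<lambda>m. cip (G f) (G ((shift ^^ n) (X m)))) \<longlonglongrightarrow> cip (G f) (E n)"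
      by (rule tendsto_cip_right[OF E])
    ultimately show ?thesis by (simp add: cip_G_shift LIMSEQ_unique)
  qed
  have E_0: "cip (G (shift f)) (E 0) = 0" for f
    using e1_orth[of f] unfolding E0 by (subst cip_commute) simp
  have E_Suc_Suc: "cip (E (Suc i)) (E (Suc j)) = cip (E i) (E j)" for i j
  proof -
    have "(\<lambda>m. cip (G ((shift ^^ Suc i) (X m))) (E (Suc j))) \<longlonglongrightarrow> cip (E (Suc i)) (E (Suc j))"
      by (rule tendsto_cip_left[OF E])
    moreover have "(\<lambda>m. cip (G ((shift ^^ i) (X m))) (E j)) \<longlonglongrightarrow> cip (E i) (E j)"
      by (rule tendsto_cip_left[OF E])
    ultimately show ?thesis by (simp add: E_Suc LIMSEQ_unique)
  qed
  have E_Suc_0: "cip (E (Suc i)) (E 0) = 0" for i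
  proof -
    have "(\<lambda>m. cip (G ((shift ^^ Suc i) (X m))) (E 0)) \<longlonglongrightarrow> cip (E (Suc i)) (E 0)"
      by (rule tendsto_cip_left[OF E])
    then show ?thesis by (simp add: E_0 LIMSEQ_unique)
  qed
  have orth: "cip (E i) (E j) = (if i = j then 1 else 0)" for i j
  proof (induction i arbitrary: j)
    case 0
    show ?case
    proof (cases j)
      case 0
      then show ?thesis by (simp add: cip_self E0 norm_e1)
    next
      case (Suc k)
      then show ?thesis using E_Suc_0[of k] by (subst cip_commute) simp
    qed
  next
    case (Suc i)
    then show ?case by (cases j) (simp_all add: E_Suc_0 E_Suc_Suc)
  qed
  obtain W where W: "bounded_clinear W" "\<And>x. norm (W x) \<le> norm x" "\<And>x n. coef (W x) n = cip x (E n)"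
    by (rule orthonormal_analysis[OF orth]) blast
  show ?thesis
  proof (rule that)
    show "bounded_clinear (\<lambda>f. W (G f))" by (rule bounded_clinear_compose[OF W(1) G_clinear])
    show "W (G (shift f)) = shift (W (G f))" for f
    proof (rule ell2_eqI)
      show "coef (W (G (shift f))) n = coef (shift (W (G f))) n" for n
        by (cases n) (simp_all add: W(3) E_0 E_Suc)
    qed
    show "norm (W (G f)) \<le> norm (G f)" for f by (rule W(2))
    have "W e1 = monomial 0" by (rule ell2_eqI) (simp add: W(3) orth flip: E0)
    then show "(\<lambda>m. W (G (X m))) \<longlonglongrightarrow> monomial 0"
      using bounded_linear.tendsto[OF bounded_clinearD(1)[OF W(1)] GX] by simp
    show "(\<lambda>m. norm (G (X m))) \<longlonglongrightarrow> 1" using tendsto_norm[OF GX] by (simp add: norm_e1)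
  qed
qed

text \<open>
  Let \<open>Q(f) = \<parallel>G f\<parallel>\<^sup>2 - \<parallel>V f\<parallel>\<^sup>2 \<ge> 0\<close> and let \<open>a\<close> be the function by which \<open>V\<close> multiplies. On circles the integrand
  of \<open>Q\<close> is \<open>(1 - |b|\<^sup>2 - |a|\<^sup>2) |f|\<^sup>2\<close> with nonnegative weight, so \<open>|a| \<le> 1\<close> gives \<open>Q(V f) \<le> Q(f)\<close>. Now
  \<open>Q(X\<^sub>m) \<rightarrow> 0\<close> while \<open>V X\<^sub>m \<rightarrow> 1\<close>, hence \<open>Q(1) = 0\<close>. As \<open>Q\<close> is invariant under the shift and the null set of a
  nonnegative quadratic form is a subspace, \<open>Q = 0\<close>.
\<close>

lemma outer_factor_norm:
  assumes V: "bounded_clinear V" "\<And>f. V (shift f) = shift (V f)" "\<And>f. norm (V f) \<le> norm (G f)"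
    and X: "(\<lambda>m. V (X m)) \<longlonglongrightarrow> monomial 0" "(\<lambda>m. norm (G (X m))) \<longlonglongrightarrow> 1"
  shows "norm (V f) = norm (G f)"
proof -
  note Vl = bounded_clinearD[OF V(1)]
  define Q where "Q f = (norm (G f))\<^sup>2 - (norm (V f))\<^sup>2" for f
  define a where "a z = ev z (V (monomial 0))" for z
  have ev_V: "ev z (V f) = a z * ev z f" if "cmod z < 1" for z f
    unfolding a_def by (rule shift_commuting_imp_mult[OF V(1,2) that])
  have Q_nonneg: "Q f \<ge> 0" for f using V(3) by (simp add: Q_def power_mono)
  have sum_le: "(cmod (a z))\<^sup>2 + (cmod (b z))\<^sup>2 \<le> 1" if "cmod z < 1" for z
  proof (rule norm_mult_pair_bound[OF ev_V T(1) _ that])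
    show "(norm (V f))\<^sup>2 + (norm (T f))\<^sup>2 \<le> (norm f)\<^sup>2" for f
      using Q_nonneg[of f] by (simp add: Q_def norm_G_squared)
  qed
  have Q_V: "Q (V f) \<le> Q f" for f
  proof -
    \<comment> \<open>The form \<open>Q(f) - Q(V f)\<close>; its integrand is \<open>|f|\<^sup>2 (1 - |a|\<^sup>2 - |b|\<^sup>2) (1 - |a|\<^sup>2)\<close>.\<close>
    let ?s = "\<lambda>i::nat. [1, -1, -2, 1, 1] ! i :: real" and ?f = "\<lambda>i. [f, T f, V f, T (V f), V (V f)] ! i"
    have "0 \<le> (\<Sum>i\<in>{..<5}. ?s i * (norm (?f i))\<^sup>2)"
    proof (rule norm_form_nonneg)
      fix z :: complex assume z: "cmod z < 1"
      have "(\<Sum>i\<in>{..<5}. ?s i * (cmod (ev z (?f i)))\<^sup>2)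
        = (cmod (ev z f))\<^sup>2 * ((1 - (cmod (a z))\<^sup>2 - (cmod (b z))\<^sup>2) * (1 - (cmod (a z))\<^sup>2))"
        by (simp add: eval_nat_numeral lessThan_Suc ev_V T z norm_mult power_mult_distrib)
          (simp add: algebra_simps)
      moreover have "(cmod (a z))\<^sup>2 \<le> 1" using sum_le[OF z] zero_le_power2[of "cmod (b z)"] by linarith
      ultimately show "0 \<le> (\<Sum>i\<in>{..<5}. ?s i * (cmod (ev z (?f i)))\<^sup>2)"
        using sum_le[OF z] by (simp add: mult_nonneg_nonneg)
    qed simp
    then have "0 \<le> (norm f)\<^sup>2 - (norm (T f))\<^sup>2 - 2 * (norm (V f))\<^sup>2 + (norm (T (V f)))\<^sup>2 + (norm (V (V f)))\<^sup>2"
      by (simp add: eval_nat_numeral lessThan_Suc)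
    then show ?thesis by (simp add: Q_def norm_G_squared)
  qed
  have Q_cont: "(\<lambda>k. Q (Y k)) \<longlonglongrightarrow> Q g" if "Y \<longlonglongrightarrow> g" for Y g
    unfolding Q_def by (intro tendsto_intros bounded_linear.tendsto[OF Vl(1)] bounded_linear.tendsto[OF G(1)] that)
  have "Q (monomial 0) = 0"
  proof -
    have "(\<lambda>m. Q (X m)) \<longlonglongrightarrow> 1\<^sup>2 - (norm (monomial 0))\<^sup>2"
      unfolding Q_def by (intro tendsto_intros X)
    then have "(\<lambda>m. Q (V (X m))) \<longlonglongrightarrow> 0"
      by (intro tendsto_sandwich[of "\<lambda>_. 0" "\<lambda>m. Q (V (X m))" _ "\<lambda>m. Q (X m)"])
        (auto intro!: always_eventually Q_nonneg Q_V)
    with Q_cont[OF X(1)] show ?thesis using LIMSEQ_unique by blast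
  qed
  then have mono: "Q (monomial n) = 0" for n
  proof (induction n)
    case (Suc n)
    have "Q (monomial (Suc n)) = Q (monomial n)"
      by (simp add: Q_def norm_G_shift V(2) flip: shift_monomial)
    with Suc show ?case by simp
  qed
  have "Q f = 0"
  proof (induction f rule: ell2_dense_induct)
    case (1 n) show ?case by (rule mono)
  next
    case (2 f g)
    have "Q (f + g) + Q (f - g) = 2 * Q f + 2 * Q g"
      unfolding Q_def power2_norm_eq_inner
      by (simp add: Vl(3,4) bounded_clinearD(3,4)[OF G_clinear] inner_add inner_diff)
    with 2 Q_nonneg[of "f + g"] Q_nonneg[of "f - g"] show ?case by simp
  next
    case (3 c f)
    have "Q (c *\<^sub>C f) = (cmod c)\<^sup>2 * Q f"
      by (simp add: Q_def Vl(2) bounded_clinearD(2)[OF G_clinear] power_mult_distrib algebra_simps)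
    with 3 show ?case by simp
  next
    case (4 Y f)
    with Q_cont[OF 4(2)] show ?case by (simp add: LIMSEQ_const_iff)
  qed
  then show ?thesis unfolding Q_def by simp
qed

text \<open>
  Multiplication by the mate \<open>h\<close> satisfies \<open>\<parallel>h f\<parallel> \<le> \<parallel>G f\<parallel>\<close>. Its zeros are isolated, so some circle about \<open>\<alpha>\<close> is
  free of them; on that circle \<open>|f|\<close> is bounded by a multiple of \<open>|h f|\<close>, hence of \<open>\<parallel>G f\<parallel>\<close>, and the maximum
  principle carries the bound to \<open>\<alpha>\<close>.
\<close>

lemma ev_bound_of_mate:
  assumes h: "h holomorphic_on unit_disc" "\<And>z. cmod z < 1 \<Longrightarrow> (cmod (h z))\<^sup>2 + (cmod (b z))\<^sup>2 \<le> 1"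
    and w: "cmod w < 1" "h w \<noteq> 0" and \<alpha>: "cmod \<alpha> < 1"
  obtains C where "C \<ge> 0" "\<And>f. cmod (ev \<alpha> f) \<le> C * norm (G f)"
proof -
  have h1: "cmod (h z) \<le> 1" if "cmod z < 1" for z
  proof -
    have "(cmod (h z))\<^sup>2 \<le> 1" using h(2)[OF that] zero_le_power2[of "cmod (b z)"] by linarith
    then show ?thesis by (simp add: abs_square_le_1)
  qed
  have h_le: "norm g \<le> norm (G f)" if g: "\<And>z. cmod z < 1 \<Longrightarrow> ev z g = h z * ev z f" for f g
  proof (rule power2_le_imp_le)
    \<comment> \<open>The form \<open>\<parallel>G f\<parallel>\<^sup>2 - \<parallel>h f\<parallel>\<^sup>2\<close>, with integrand \<open>|f|\<^sup>2 (1 - |h|\<^sup>2 - |b|\<^sup>2)\<close>.\<close>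
    let ?s = "\<lambda>i::nat. [1, -1, -1] ! i :: real" and ?f = "\<lambda>i. [f, T f, g] ! i"
    have "0 \<le> (\<Sum>i\<in>{..<3}. ?s i * (norm (?f i))\<^sup>2)"
    proof (rule norm_form_nonneg)
      fix z :: complex assume z: "cmod z < 1"
      have "(\<Sum>i\<in>{..<3}. ?s i * (cmod (ev z (?f i)))\<^sup>2)
        = (cmod (ev z f))\<^sup>2 * (1 - (cmod (h z))\<^sup>2 - (cmod (b z))\<^sup>2)"
        by (simp add: eval_nat_numeral lessThan_Suc g T z norm_mult power_mult_distrib)
          (simp add: algebra_simps)
      then show "0 \<le> (\<Sum>i\<in>{..<3}. ?s i * (cmod (ev z (?f i)))\<^sup>2)"
        using h(2)[OF z] by (simp add: mult_nonneg_nonneg)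
    qed simp
    then have "0 \<le> (norm f)\<^sup>2 - (norm (T f))\<^sup>2 - (norm g)\<^sup>2" by (simp add: eval_nat_numeral lessThan_Suc)
    then show "(norm g)\<^sup>2 \<le> (norm (G f))\<^sup>2" by (simp add: norm_G_squared)
  qed simp
  obtain \<rho> where \<rho>: "\<rho> > 0" "cball \<alpha> \<rho> \<subseteq> unit_disc" and nz: "\<And>z. z \<in> sphere \<alpha> \<rho> \<Longrightarrow> h z \<noteq> 0"
  proof (cases "h \<alpha> = 0")
    case True
    obtain r where r: "0 < r" "ball \<alpha> r \<subseteq> unit_disc" "\<And>z. z \<in> ball \<alpha> r - {\<alpha>} \<Longrightarrow> h z \<noteq> 0"
      using isolated_zeros[OF h(1) open_ball connected_ball _ True, of w] \<alpha> w by auto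
    show ?thesis
    proof (rule that[of "r/2"])
      show "cball \<alpha> (r/2) \<subseteq> unit_disc" using r(1,2) by (auto simp: subset_iff)
      show "h z \<noteq> 0" if "z \<in> sphere \<alpha> (r/2)" for z using that r(1) by (intro r(3)) auto
    qed (use r in auto)
  next
    case False
    have "continuous (at \<alpha>) h"
      using holomorphic_on_imp_continuous_on[OF h(1)] \<alpha> by (simp add: continuous_on_eq_continuous_at)
    then obtain e where e: "e > 0" "\<And>z. dist \<alpha> z < e \<Longrightarrow> h z \<noteq> 0"
      using continuous_at_avoid[of \<alpha> h 0] False by auto
    obtain r where r: "r > 0" "ball \<alpha> r \<subseteq> unit_disc" using \<alpha> open_ball[of 0 1] by (metis dist_0_norm mem_ball openE)
    show ?thesis
    proof (rule that[of "min e r / 2"])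
      show "cball \<alpha> (min e r / 2) \<subseteq> unit_disc" using r e(1) by (auto simp: subset_iff)
      show "h z \<noteq> 0" if "z \<in> sphere \<alpha> (min e r / 2)" for z using that r(1) e(1) by (intro e(2)) auto
    qed (use r e in auto)
  qed
  have cont_h: "continuous_on (sphere \<alpha> \<rho>) h"
    using \<rho>(2) by (intro continuous_on_subset[OF holomorphic_on_imp_continuous_on[OF h(1)]]) (auto simp: subset_iff)
  have ne: "sphere \<alpha> \<rho> \<noteq> {}" using \<rho>(1) by simp
  obtain z0 where z0: "z0 \<in> sphere \<alpha> \<rho>" "\<And>z. z \<in> sphere \<alpha> \<rho> \<Longrightarrow> cmod (h z0) \<le> cmod (h z)"
    using continuous_attains_inf[OF compact_sphere ne continuous_on_norm[OF cont_h]] by blast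
  obtain z1 where z1: "z1 \<in> sphere \<alpha> \<rho>" "\<And>z. z \<in> sphere \<alpha> \<rho> \<Longrightarrow> cmod z \<le> cmod z1"
    using continuous_attains_sup[OF compact_sphere ne continuous_on_norm[OF continuous_on_id]] by auto
  have disc: "cmod z < 1" if "z \<in> sphere \<alpha> \<rho>" for z using that \<rho>(2) by (auto simp: subset_iff)
  define m where "m = cmod (h z0)"
  have m: "m > 0" using nz[OF z0(1)] by (simp add: m_def)
  define K where "K = norm (szego z1)"
  have K: "norm (szego z) \<le> K" if "z \<in> sphere \<alpha> \<rho>" for z
  proof (rule power2_le_imp_le)
    have "(cmod z)\<^sup>2 \<le> (cmod z1)\<^sup>2" using z1(2)[OF that] by (intro power_mono) auto
    moreover have "(cmod z1)\<^sup>2 < 1" using disc[OF z1(1)] by (simp add: abs_square_less_1)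
    ultimately have "1 / (1 - (cmod z)\<^sup>2) \<le> 1 / (1 - (cmod z1)\<^sup>2)" by (intro frac_le) auto
    then show "(norm (szego z))\<^sup>2 \<le> K\<^sup>2"
      by (simp only: K_def norm_szego_squared[OF disc[OF that]] norm_szego_squared[OF disc[OF z1(1)]])
  qed (simp add: K_def)
  show ?thesis
  proof (rule that)
    show "0 \<le> K / m" using m by (simp add: K_def)
    fix f
    obtain g where g: "\<And>z. cmod z < 1 \<Longrightarrow> ev z g = h z * ev z f"
      by (rule mult_contraction[OF h(1) h1]) auto
    show "cmod (ev \<alpha> f) \<le> K / m * norm (G f)"
    proof (rule maximum_modulus_frontier[of "\<lambda>z. ev z f" "cball \<alpha> \<rho>"])
      show "(\<lambda>z. ev z f) holomorphic_on interior (cball \<alpha> \<rho>)"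
        using \<rho>(2) interior_subset by (intro holomorphic_on_subset[OF ev_holomorphic]) blast
      show "continuous_on (closure (cball \<alpha> \<rho>)) (\<lambda>z. ev z f)"
        using \<rho>(2) by (intro holomorphic_on_imp_continuous_on holomorphic_on_subset[OF ev_holomorphic]) auto
      fix z assume "z \<in> frontier (cball \<alpha> \<rho>)"
      then have z: "z \<in> sphere \<alpha> \<rho>" using \<rho>(1) by simp
      have "m * cmod (ev z f) \<le> cmod (h z) * cmod (ev z f)"
        unfolding m_def by (intro mult_right_mono z0(2) z) simp
      also have "\<dots> = cmod (ev z g)" by (simp add: g[OF disc[OF z]] norm_mult)
      also have "\<dots> \<le> norm (szego z) * norm g" by (rule norm_ev_le)
      also have "\<dots> \<le> K * norm (G f)" by (intro mult_mono K z h_le g) (simp_all add: K_def)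
      finally show "cmod (ev z f) \<le> K / m * norm (G f)" using m by (simp add: field_simps)
    qed (use \<rho>(1) in auto)
  qed
qed

end

section \<open>Totality of the kernels and the resolvent\<close>

text \<open>
  The Hankel property says that the form depends on the product of its arguments only, as is seen on powers
  of the variable; multiplication by an analytic function can therefore be moved from one argument to
  the other.
\<close>

lemma hankel_form_commute:
  assumes \<beta>: "bounded_bilinear \<beta>" and cl: "\<And>c f g. \<beta> (c *\<^sub>C f) g = c * \<beta> f g" and cr: "\<And>c f g. \<beta> f (c *\<^sub>C g) = c * \<beta> f g"
    and hankel: "\<And>f g. \<beta> (shift f) g = \<beta> f (shift g)"
    and V: "bounded_clinear V" "\<And>f. V (shift f) = shift (V f)"
  shows "\<beta> (V f) g = (\<beta> f (V g) :: complex)"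
proof -
  note Vl = bounded_clinearD[OF V(1)]
  note lim = bounded_bilinear.tendsto[OF \<beta>] bounded_linear.tendsto[OF Vl(1)] tendsto_const
  note add = bounded_bilinear.add_left[OF \<beta>] bounded_bilinear.add_right[OF \<beta>]
  have hk: "\<beta> (monomial (Suc n)) (monomial m) = \<beta> (monomial n) (monomial (Suc m))"
    and hkV: "\<beta> (V (monomial m)) (monomial (Suc n)) = \<beta> (V (monomial (Suc m))) (monomial n)" for m n
    using hankel[of "monomial n" "monomial m"] hankel[of "V (monomial m)" "monomial n"] V(2)[of "monomial m"] by simp_all
  have sym: "\<beta> u (monomial 0) = \<beta> (monomial 0) u" for u
  proof (induction u rule: ell2_dense_induct)
    case (1 n)
    have "\<beta> (monomial n) (monomial m) = \<beta> (monomial 0) (monomial (n + m))" for m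
      by (induction n arbitrary: m) (simp_all add: hk)
    then show ?case by simp
  next
    case (4 X f)
    have "(\<lambda>k. \<beta> (X k) (monomial 0)) \<longlonglongrightarrow> \<beta> f (monomial 0)" "(\<lambda>k. \<beta> (monomial 0) (X k)) \<longlonglongrightarrow> \<beta> (monomial 0) f"
      by (intro lim 4)+
    with 4(1) show ?case using LIMSEQ_unique by simp
  qed (simp_all add: add cl cr)
  have base: "\<beta> (V (monomial 0)) u = \<beta> (monomial 0) (V u)" for u
  proof (induction u rule: ell2_dense_induct)
    case (1 n)
    have "\<beta> (V (monomial m)) (monomial n) = \<beta> (V (monomial (m + n))) (monomial 0)" for m
      by (induction n arbitrary: m) (simp_all add: hkV)
    from this[of 0] show ?case by (simp add: sym)
  next
    case (4 X f)
    have "(\<lambda>k. \<beta> (V (monomial 0)) (X k)) \<longlonglongrightarrow> \<beta> (V (monomial 0)) f" "(\<lambda>k. \<beta> (monomial 0) (V (X k))) \<longlonglongrightarrow> \<beta> (monomial 0) (V f)"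
      by (intro lim 4)+
    with 4(1) show ?case using LIMSEQ_unique by simp
  qed (simp_all add: add cl cr Vl(2,3))
  show ?thesis
  proof (induction f rule: ell2_dense_induct)
    case (1 n)
    have "\<beta> (V (monomial n)) g = \<beta> (monomial n) (V g)" for g
    proof (induction n arbitrary: g)
      case (Suc n)
      then show ?case
        using hankel[of "V (monomial n)" g] hankel[of "monomial n" "V g"] V(2)[of "monomial n"] V(2)[of g] by simp
    qed (rule base)
    then show ?case .
  next
    case (4 X f)
    have "(\<lambda>k. \<beta> (V (X k)) g) \<longlonglongrightarrow> \<beta> (V f) g" "(\<lambda>k. \<beta> (X k) (V g)) \<longlonglongrightarrow> \<beta> f (V g)"
      by (intro lim 4)+
    with 4(1) show ?case using LIMSEQ_unique by simp
  qed (simp_all add: add cl cr Vl(2,3))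
qed

text \<open>
  Conjugating the second argument turns the inner product into the bilinear pairing \<open>\<Sum>n. f\<^sub>n g\<^sub>n\<close>.
\<close>

lift_definition conj_coef :: "ell2 \<Rightarrow> ell2" is "\<lambda>a n. cnj (a n)" by simp

declare conj_coef.rep_eq [simp]

lemma norm_conj_coef [simp]: "norm (conj_coef f) = norm f"
proof -
  have "(norm (conj_coef f))\<^sup>2 = (norm f)\<^sup>2" unfolding norm_ell2_squared by simp
  then show ?thesis by simp
qed

lemma bounded_linear_conj_coef: "bounded_linear conj_coef"
  by (rule bounded_linear_intro[of _ 1]) (auto intro!: ell2_eqI)

lemma cip_bshift_bshift: "cip (bshift f) (bshift g) = cip f g - coef f 0 * cnj (coef g 0)"
proof -
  have "(\<lambda>n. coef f (Suc n) * cnj (coef g (Suc n))) sums (cip f g - coef f 0 * cnj (coef g 0))"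
    using sums_Suc_iff[of "\<lambda>n. coef f n * cnj (coef g n)"] cip_sums[of f g] by simp
  then show ?thesis using cip_sums[of "bshift f" "bshift g"] sums_unique2 by simp
qed

context schur
begin

lemma coef_Ts_0: "coef (Ts f) 0 = cip f (T (monomial 0))"
  using cip_monomial_right[of "Ts f" 0] by (metis cip_Ts cip_commute)

text \<open>
  The entries \<open>\<langle>S\<^sup>j\<^sup>+\<^sup>1 f, b\<rangle>\<close> of \<open>P f\<close> are the Fourier coefficients of \<open>f\<close> times the conjugate of \<open>b\<close> at the
  negative frequencies, those of \<open>T\<^sup>* f\<close> belong to the others, and together they have the norm of \<open>b f\<close>. Square summability follows from the
  telescoping sum \<open>\<Sum>j<N. |(P f)\<^sub>j|\<^sup>2 = \<parallel>T\<^sup>* S\<^sup>N f\<parallel>\<^sup>2 - \<parallel>T\<^sup>* f\<parallel>\<^sup>2\<close>. The norm identity is polarised; the difference \<open>D\<close> of its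
  two sides is invariant under shifting both arguments and Hermitian, so it suffices to compute
  \<open>D(z\<^sup>k, 1)\<close>.
\<close>

lemma hankel_operator:
  obtains P where "bounded_clinear P" "\<And>f. P (shift f) = bshift (P f)"
    "\<And>f. (norm (T f))\<^sup>2 = (norm (Ts f))\<^sup>2 + (norm (P f))\<^sup>2"
proof -
  let ?b = "T (monomial 0)"
  note Sl = bounded_clinearD[OF bounded_clinear_shift]
  define c where "c f j = cip ((shift ^^ Suc j) f) ?b" for f j
  have partial: "(\<Sum>j<N. (cmod (c f j))\<^sup>2) = (norm (Ts ((shift ^^ N) f)))\<^sup>2 - (norm (Ts f))\<^sup>2" for f N
  proof (induction N)
    case (Suc N)
    have "(cmod (c f N))\<^sup>2 = (norm (Ts ((shift ^^ Suc N) f)))\<^sup>2 - (norm (Ts ((shift ^^ N) f)))\<^sup>2"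
      using norm_bshift_squared[of "Ts ((shift ^^ Suc N) f)"] by (simp add: c_def bshift_Ts coef_Ts_0)
    with Suc show ?case by simp
  qed simp
  have norm_Sn: "norm ((shift ^^ n) f) = norm f" for n f by (induction n) simp_all
  have c_bd: "(\<Sum>j<N. (cmod (c f j))\<^sup>2) \<le> (norm f)\<^sup>2" for f N
  proof -
    have "(norm (Ts ((shift ^^ N) f)))\<^sup>2 \<le> (norm f)\<^sup>2"
      using norm_Ts_le[of "(shift ^^ N) f"] by (intro power_mono) (simp_all add: norm_Sn)
    then show ?thesis unfolding partial using zero_le_power2[of "norm (Ts f)"] by linarith
  qed
  define P where "P f = Abs_ell2 (c f)" for f
  have cP: "coef (P f) j = c f j" for f j unfolding P_def by (subst ell2_intro_bound(1)[OF c_bd[of f]]) simp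
  have nP: "norm (P f) \<le> norm f" for f
    using ell2_intro_bound(2)[OF c_bd[of f]] unfolding P_def by (rule power2_le_imp_le) simp
  have S_pow: "(shift ^^ n) (f + g) = (shift ^^ n) f + (shift ^^ n) g" "(shift ^^ n) (a *\<^sub>C f) = a *\<^sub>C (shift ^^ n) f" for n f g a
    by (induction n) (simp_all add: Sl)
  have P: "bounded_clinear P"
  proof (rule bounded_clinearI)
    show "bounded_linear P"
      by (rule bounded_linear_intro[of _ 1])
        (auto intro!: ell2_eqI simp: cP nP c_def S_pow Sl cip_add_left scaleR_cmul)
    show "P (\<i> *\<^sub>C f) = \<i> *\<^sub>C P f" for f by (rule ell2_eqI) (simp add: cP c_def S_pow Sl)
  qed
  note Pl = bounded_clinearD[OF P] and Tl = bounded_clinearD[OF T_clinear] and Tsl = bounded_clinearD[OF Ts_clinear]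
  have PS: "P (shift f) = bshift (P f)" for f
    by (rule ell2_eqI) (simp add: cP c_def funpow_swap1)
  \<comment> \<open>The difference of the two sides of the polarised norm identity.\<close>
  define D where "D f g = cip (T f) (T g) - cip (Ts f) (Ts g) - cip (P f) (P g)" for f g
  have D_shift: "D (shift f) (shift g) = D f g" for f g
  proof -
    have "cip (Ts (shift f)) (Ts (shift g)) = cip (Ts f) (Ts g) + c f 0 * cnj (c g 0)"
      using cip_bshift_bshift[of "Ts (shift f)" "Ts (shift g)"] by (simp add: bshift_Ts_shift coef_Ts_0 c_def)
    then show ?thesis by (simp add: D_def T_shift PS cip_bshift_bshift cP)
  qed
  have D_0: "D (monomial k) (monomial 0) = 0" for k
  proof -
    have mono: "(shift ^^ n) (monomial k) = monomial (n + k)" for n k by (induction n) simp_all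
    have Pm: "coef (P (monomial k)) j = cnj (coef ?b (Suc j + k))" for j k
      unfolding cP c_def mono by (subst cip_commute) (simp add: add.commute)
    have Ts0: "coef (Ts (monomial 0)) n = (if n = 0 then cnj (coef ?b 0) else 0)" for n
    proof -
      have "coef (Ts (monomial 0)) n = cip (monomial 0) (T (monomial n))"
        by (metis cip_Ts cip_commute cip_monomial_right)
      also have "\<dots> = cnj (coef (T (monomial n)) 0)" by (subst cip_commute) simp
      finally show ?thesis by (cases n) (simp_all add: T_shift flip: shift_monomial)
    qed
    have "cip (Ts (monomial k)) (Ts (monomial 0)) = cnj (coef ?b k) * coef ?b 0"
    proof -
      have "Ts (monomial 0) = cnj (coef ?b 0) *\<^sub>C monomial 0" by (rule ell2_eqI) (simp add: Ts0)
      moreover have "coef (Ts (monomial k)) 0 = cnj (coef ?b k)"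
        unfolding coef_Ts_0 by (subst cip_commute) simp
      ultimately show ?thesis by (simp add: mult.commute)
    qed
    moreover have "(\<lambda>j. cnj (coef ?b (Suc j + k)) * coef ?b (Suc j)) sums cip (P (monomial k)) (P (monomial 0))"
      using cip_sums[of "P (monomial k)" "P (monomial 0)"] by (simp add: Pm)
    moreover have "(\<lambda>j. cnj (coef ?b (j + k)) * coef ?b j) sums cip (T (monomial k)) ?b"
    proof -
      have Tk: "T (monomial k) = (shift ^^ k) ?b" by (induction k) (simp_all add: T_shift flip: shift_monomial)
      have "cip ((shift ^^ k) ?b) g = cip ?b ((bshift ^^ k) g)" for g
        by (induction k arbitrary: g) (simp_all add: cip_shift funpow_swap1[of bshift])
      moreover have "coef ((bshift ^^ k) g) j = coef g (j + k)" for g j by (induction k arbitrary: j) simp_all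
      ultimately show ?thesis using cip_sums[of ?b "(bshift ^^ k) ?b"] by (simp add: Tk mult.commute)
    qed
    ultimately have "cip (T (monomial k)) ?b = cip (P (monomial k)) (P (monomial 0)) + cip (Ts (monomial k)) (Ts (monomial 0))"
      using sums_Suc_iff[of "\<lambda>j. cnj (coef ?b (j + k)) * coef ?b j"] sums_unique2 by fastforce
    then show ?thesis by (simp add: D_def)
  qed
  have D_commute: "D g f = cnj (D f g)" for f g
    by (simp add: D_def cip_commute[of "T f"] cip_commute[of "Ts f"] cip_commute[of "P f"])
  have D_mono: "D (monomial k) (monomial l) = 0" for k l
  proof -
    have red: "D (monomial (k + m)) (monomial (l + m)) = D (monomial k) (monomial l)" for k l m
      by (induction m) (simp_all add: D_shift flip: shift_monomial)
    have ge: "D (monomial k) (monomial l) = 0" if "l \<le> k" for k l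
      using red[of "k - l" l 0] D_0[of "k - l"] that by simp
    show ?thesis using ge[of l k] ge[of k l] D_commute[of "monomial k" "monomial l"] by (cases "l \<le> k") auto
  qed
  have D_cont: "(\<lambda>k. D (X k) g) \<longlonglongrightarrow> D f g" if "X \<longlonglongrightarrow> f" for X f g
    unfolding D_def by (intro tendsto_intros tendsto_cip_left that bounded_linear.tendsto[OF Tl(1)]
        bounded_linear.tendsto[OF Tsl(1)] bounded_linear.tendsto[OF Pl(1)])
  have ext: "D f g = 0" if "\<And>k. D (monomial k) g = 0" for f g
  proof (induction f rule: ell2_dense_induct)
    case (1 n)
    show ?case by (rule that)
  next
    case (4 X f)
    with D_cont[OF 4(2), of g] show ?case by (simp add: LIMSEQ_const_iff)
  next
    case (2 f h)
    have "D (f + h) g = D f g + D h g" by (simp add: D_def Tl(3) Tsl(3) Pl(3) cip_add_left)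
    with 2 show ?case by simp
  next
    case (3 c f)
    have "D (c *\<^sub>C f) g = c * D f g" by (simp add: D_def Tl(2) Tsl(2) Pl(2) algebra_simps)
    with 3 show ?case by simp
  qed
  have "D f g = 0" for f g
    by (rule ext) (metis D_commute D_mono complex_cnj_zero ext)
  then have D0: "D f f = 0" for f .
  have "(norm (T f))\<^sup>2 = (norm (Ts f))\<^sup>2 + (norm (P f))\<^sup>2" for f
    using D0[of f] unfolding D_def cip_self by (simp add: complex_eq_iff)
  with P PS show ?thesis using that by blast
qed

text \<open>
  Write \<open>x\<close> as the limit of \<open>R g\<^sub>n\<close>. Since \<open>\<parallel>R f\<parallel>\<^sup>2 = \<parallel>V f\<parallel>\<^sup>2 + \<parallel>P f\<parallel>\<^sup>2\<close>, both \<open>V g\<^sub>n\<close> and \<open>P g\<^sub>n\<close> converge, to \<open>v\<close> and \<open>\<psi>\<close>.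
  Orthogonality to the kernels means \<open>g\<^sub>n \<rightarrow> 0\<close> pointwise, so \<open>v\<close> vanishes pointwise. In the bilinear
  pairing \<open>[V f, \<psi>]\<close> is the limit of \<open>[V f, P g\<^sub>n] = [f, P V g\<^sub>n]\<close>, which is \<open>0\<close>; as \<open>S\<^sup>j V X\<^sub>m \<rightarrow> z\<^sup>j\<close>, every coefficient of
  \<open>\<psi>\<close> vanishes.
\<close>

lemma kernels_total:
  assumes \<alpha>: "cmod \<alpha> < 1" and bd: "\<And>f. cmod (ev \<alpha> f) \<le> C * norm (G f)"
    and x: "x \<in> closure (range R)"
    and orth: "\<And>z. cmod z < 1 \<Longrightarrow> \<exists>y. R y = szego z \<and> cip x y = 0"
  shows "x = 0"
proof -
  obtain V X where V: "bounded_clinear V" "\<And>f. V (shift f) = shift (V f)" "\<And>f. norm (V f) \<le> norm (G f)"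
    and X: "(\<lambda>m. V (X m)) \<longlonglongrightarrow> monomial 0" "(\<lambda>m. norm (G (X m))) \<longlonglongrightarrow> 1"
    by (rule outer_factor[OF \<alpha> bd]) blast
  note VG = outer_factor_norm[OF V X]
  note Vl = bounded_clinearD[OF V(1)]
  obtain P where P: "bounded_clinear P" "\<And>f. P (shift f) = bshift (P f)"
    "\<And>f. (norm (T f))\<^sup>2 = (norm (Ts f))\<^sup>2 + (norm (P f))\<^sup>2"
    by (rule hankel_operator) blast
  note Pl = bounded_clinearD[OF P(1)]
  have split: "(norm (R f))\<^sup>2 = (norm (V f))\<^sup>2 + (norm (P f))\<^sup>2" for f
    by (simp add: VG norm_R_squared norm_G_squared P(3))
  obtain g where g: "(\<lambda>n. R (g n)) \<longlonglongrightarrow> x"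
    using x by (rule closure_range_sequence)
  have cauchy: "Cauchy (\<lambda>n. L (g n))" if L: "bounded_clinear L" "\<And>f. (norm (L f))\<^sup>2 \<le> (norm (R f))\<^sup>2" for L
  proof -
    have "norm (L f) \<le> norm (R f)" for f using L(2) by (rule power2_le_imp_le) simp
    then have "dist (L (g m)) (L (g n)) \<le> dist (R (g m)) (R (g n))" for m n
      unfolding dist_norm by (simp flip: bounded_clinearD(4)[OF L(1)] bounded_clinearD(4)[OF R_clinear])
    with LIMSEQ_imp_Cauchy[OF g] show ?thesis unfolding Cauchy_def by (meson order_le_less_trans)
  qed
  have "Cauchy (\<lambda>n. V (g n))" "Cauchy (\<lambda>n. P (g n))" by (rule cauchy; simp add: V P split)+
  then obtain v \<psi> where v: "(\<lambda>n. V (g n)) \<longlonglongrightarrow> v" and \<psi>: "(\<lambda>n. P (g n)) \<longlonglongrightarrow> \<psi>"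
    by (auto simp: Cauchy_convergent_iff convergent_def)
  have "v = 0"
  proof (rule ev_eq_imp_eq)
    fix z assume z: "cmod z < 1"
    obtain y where y: "R y = szego z" "cip x y = 0" using orth[OF z] by blast
    have "(\<lambda>n. cip (R (g n)) y) \<longlonglongrightarrow> 0" using tendsto_cip_left[OF g, of y] y(2) by simp
    then have "(\<lambda>n. ev z (g n)) \<longlonglongrightarrow> 0" by (simp add: ev_def cip_R y(1))
    from tendsto_mult[OF tendsto_const[of "ev z (V (monomial 0))"] this]
    have "(\<lambda>n. ev z (V (g n))) \<longlonglongrightarrow> 0"
      by (simp flip: shift_commuting_imp_mult[OF V(1,2) z])
    with tendsto_ev[OF v, of z] show "ev z v = ev z 0" using LIMSEQ_unique by fastforce
  qed
  define \<beta> where "\<beta> f h = cip f (conj_coef (P h))" for f h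
  have comm: "\<beta> (V f) h = \<beta> f (V h)" for f h
  proof (rule hankel_form_commute[OF _ _ _ _ V(1,2)])
    show "bounded_bilinear \<beta>"
    proof
      show "\<exists>K. \<forall>f h. norm (\<beta> f h) \<le> norm f * norm h * K"
      proof -
        obtain K where K: "\<And>h. norm (P h) \<le> norm h * K" using bounded_linear.bounded[OF Pl(1)] by blast
        have "norm (\<beta> f h) \<le> norm f * norm h * K" for f h
        proof -
          have "norm (\<beta> f h) \<le> norm f * norm (P h)" using norm_cip_le[of f "conj_coef (P h)"] by (simp add: \<beta>_def)
          also have "\<dots> \<le> norm f * (norm h * K)" by (intro mult_left_mono K) simp
          finally show ?thesis by (simp add: mult.assoc)
        qed
        then show ?thesis by blast
      qed
    qed (simp_all add: \<beta>_def cip_add_left cip_add_right scaleR_cmul Pl scaleR_conv_of_real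
        linear_add[OF bounded_linear.linear[OF bounded_linear_conj_coef]]
        linear_scale[OF bounded_linear.linear[OF bounded_linear_conj_coef], unfolded scaleR_cmul])
    show "\<beta> (c *\<^sub>C f) h = c * \<beta> f h" for c f h by (simp add: \<beta>_def)
    show "\<beta> f (c *\<^sub>C h) = c * \<beta> f h" for c f h
    proof -
      have "conj_coef (c *\<^sub>C P h) = cnj c *\<^sub>C conj_coef (P h)" by (rule ell2_eqI) simp
      then show ?thesis by (simp add: \<beta>_def Pl(2))
    qed
    show "\<beta> (shift f) h = \<beta> f (shift h)" for f h
    proof -
      have "bshift (conj_coef (P h)) = conj_coef (bshift (P h))" by (rule ell2_eqI) simp
      then show ?thesis by (simp add: \<beta>_def cip_shift P(2))
    qed
  qed
  have \<beta>_lim: "(\<lambda>n. \<beta> f (h n)) \<longlonglongrightarrow> cip f (conj_coef p)" if "(\<lambda>n. P (h n)) \<longlonglongrightarrow> p" for f h p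
    unfolding \<beta>_def by (intro tendsto_cip_right bounded_linear.tendsto[OF bounded_linear_conj_coef] that)
  have V_orth: "cip (V f) (conj_coef \<psi>) = 0" for f
  proof -
    have "(\<lambda>n. P (V (g n))) \<longlonglongrightarrow> P 0" using v \<open>v = 0\<close> by (intro bounded_linear.tendsto[OF Pl(1)]) simp
    then have "(\<lambda>n. \<beta> f (V (g n))) \<longlonglongrightarrow> cip f (conj_coef (P 0))" by (rule \<beta>_lim)
    moreover have "conj_coef (P 0) = 0" by (rule ell2_eqI) (simp add: Pl(5))
    ultimately have "(\<lambda>n. \<beta> (V f) (g n)) \<longlonglongrightarrow> 0" by (simp add: comm)
    with \<beta>_lim[OF \<psi>, of "V f"] show ?thesis using LIMSEQ_unique by blast
  qed
  have "\<psi> = 0"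
  proof (rule ell2_eqI)
    fix j
    have VS: "V ((shift ^^ j) f) = (shift ^^ j) (V f)" for f by (induction j) (simp_all add: V(2))
    have "(\<lambda>m. (shift ^^ j) (V (X m))) \<longlonglongrightarrow> (shift ^^ j) (monomial 0)"
      by (induction j) (simp_all add: X bounded_linear.tendsto[OF bounded_clinearD(1)[OF bounded_clinear_shift]])
    moreover have "(shift ^^ j) (monomial 0) = monomial j" by (induction j) simp_all
    ultimately have "(\<lambda>m. cip (V ((shift ^^ j) (X m))) (conj_coef \<psi>)) \<longlonglongrightarrow> cip (monomial j) (conj_coef \<psi>)"
      by (simp add: VS tendsto_cip_left)
    then have "cip (monomial j) (conj_coef \<psi>) = 0" by (simp add: V_orth LIMSEQ_const_iff)
    then have "cip (conj_coef \<psi>) (monomial j) = 0" by (subst cip_commute) simp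
    then show "coef \<psi> j = coef 0 j" by simp
  qed
  have "(\<lambda>n. (norm (R (g n)))\<^sup>2) \<longlonglongrightarrow> (norm v)\<^sup>2 + (norm \<psi>)\<^sup>2"
    unfolding split by (intro tendsto_intros v \<psi>)
  then have "(norm x)\<^sup>2 = (norm v)\<^sup>2 + (norm \<psi>)\<^sup>2"
    using tendsto_power[OF tendsto_norm[OF g], of 2] LIMSEQ_unique by blast
  then show ?thesis by (simp add: \<open>v = 0\<close> \<open>\<psi> = 0\<close>)
qed

text \<open>
  The backward shift increases \<open>\<parallel>R h\<parallel>\<^sup>2\<close> by at most \<open>|(T\<^sup>* h)(0)|\<^sup>2\<close>, and evaluating \<open>T\<^sup>* f = (I - \<alpha> S\<^sup>*) T\<^sup>* h\<close> at \<open>\<alpha>\<close>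
  gives \<open>(T\<^sup>* h)(0) = (T\<^sup>* f)(\<alpha>)\<close>. So the seminorm of \<open>S\<^sup>* h\<close> exceeds that of \<open>h = f + \<alpha> S\<^sup>* h\<close> by a multiple of
  \<open>\<parallel>R f\<parallel>\<close> only, and \<open>|\<alpha>| < 1\<close> lets one solve for it.
\<close>

lemma resolvent_bound:
  assumes \<alpha>: "cmod \<alpha> < 1" and C: "C \<ge> 0" "\<And>f. cmod (ev \<alpha> (Ts f)) \<le> C * norm (R f)"
    and h: "h - \<alpha> *\<^sub>C bshift h = f"
  shows "norm (R (bshift h)) \<le> (1 + C) / (1 - cmod \<alpha>) * norm (R f)"
proof -
  have Ts_f: "Ts f = Ts h - \<alpha> *\<^sub>C bshift (Ts h)"
    unfolding h[symmetric] by (simp add: bounded_clinearD[OF Ts_clinear] bshift_Ts)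
  have eval: "coef (Ts h) 0 = ev \<alpha> (Ts f)"
    using ev_bshift[OF \<alpha>, of "Ts h"] by (simp add: Ts_f ev_diff ev_cmul)
  have "(norm (R (bshift h)))\<^sup>2 \<le> (norm (R h))\<^sup>2 + (cmod (coef (Ts h) 0))\<^sup>2"
    by (simp add: norm_R_squared norm_bshift_squared flip: bshift_Ts)
  also have "\<dots> \<le> (norm (R h) + cmod (coef (Ts h) 0))\<^sup>2" by (simp add: power2_sum)
  finally have "norm (R (bshift h)) \<le> norm (R h) + cmod (coef (Ts h) 0)" by (rule power2_le_imp_le) simp
  also have "cmod (coef (Ts h) 0) \<le> C * norm (R f)" unfolding eval by (rule C)
  also have "norm (R h) \<le> norm (R f) + cmod \<alpha> * norm (R (bshift h))"
  proof -
    have "R h = R f + \<alpha> *\<^sub>C R (bshift h)" unfolding h[symmetric] by (simp add: bounded_clinearD[OF R_clinear])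
    then show ?thesis using norm_triangle_ineq[of "R f" "\<alpha> *\<^sub>C R (bshift h)"] by simp
  qed
  finally have "(1 - cmod \<alpha>) * norm (R (bshift h)) \<le> (1 + C) * norm (R f)" by (simp add: algebra_simps)
  then show ?thesis using \<alpha> by (simp add: field_simps)
qed

text \<open>
  If \<open>u - \<omega> S u = S R x\<close>, then \<open>S\<^sup>* u - \<omega> u = R x\<close>, and \<open>u\<close> is in the range of \<open>R\<close>: for \<open>f = h - \<omega>\<^sup>* S\<^sup>* h\<close> one has
  \<open>\<langle>f, u\<rangle> = \<langle>R S\<^sup>* h, x\<rangle>\<close>, which \<open>resolvent_bound\<close> estimates.
\<close>

lemma bshift_range_surj:
  assumes \<alpha>: "cmod \<omega> < 1" and C: "C \<ge> 0" "\<And>f. cmod (ev (cnj \<omega>) (Ts f)) \<le> C * norm (R f)"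
  obtains y where "bshift (R y) - \<omega> *\<^sub>C R y = R x"
proof -
  obtain u where u: "u - \<omega> *\<^sub>C shift u = shift (R x)"
    by (rule neumann[OF bounded_clinear_shift _ \<alpha>]) auto
  define K where "K = (1 + C) / (1 - cmod (cnj \<omega>)) * norm x"
  have bd: "\<bar>f \<bullet> u\<bar> \<le> K * norm (R f)" for f
  proof -
    obtain h where h: "h - cnj \<omega> *\<^sub>C bshift h = f"
      by (rule neumann[OF bounded_clinear_bshift norm_bshift_le, of "cnj \<omega>"]) (use \<alpha> in auto)
    have "R x \<bullet> bshift h = (u - \<omega> *\<^sub>C shift u) \<bullet> h" by (simp add: u inner_shift)
    also have "\<dots> = u \<bullet> h - u \<bullet> bshift (cnj \<omega> *\<^sub>C h)" by (simp add: inner_diff inner_cmul_left inner_shift)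
    also have "\<dots> = u \<bullet> f" by (simp add: bounded_clinearD[OF bounded_clinear_bshift] inner_diff flip: h)
    finally have "f \<bullet> u = x \<bullet> R (bshift h)" by (metis R(2) inner_commute)
    then have "\<bar>f \<bullet> u\<bar> \<le> norm x * norm (R (bshift h))" using Cauchy_Schwarz_ineq2 by simp
    also have "\<dots> \<le> norm x * ((1 + C) / (1 - cmod (cnj \<omega>)) * norm (R f))"
      using \<alpha> by (intro mult_left_mono resolvent_bound[OF _ C h]) auto
    finally show ?thesis by (simp add: K_def mult_ac)
  qed
  obtain y where "R y = u"
    by (rule range_symmetricI[OF R(1,2) bd]) (use C \<alpha> in \<open>auto simp: K_def\<close>)
  moreover have "bshift u - \<omega> *\<^sub>C u = R x"
    using arg_cong[OF u, of bshift] by (simp add: bounded_clinearD[OF bounded_clinear_bshift])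
  ultimately have "bshift (R y) - \<omega> *\<^sub>C R y = R x" by simp
  then show ?thesis by (rule that)
qed

end

section \<open>Extreme points of the unit ball\<close>

lemma Hinf_unit_ball_iff: "b \<in> Hinf_unit_ball \<longleftrightarrow> b \<in> disc_analytic \<and> (\<forall>z\<in>unit_disc. cmod (b z) \<le> 1)"
proof safe
  assume b: "b \<in> Hinf_unit_ball"
  then show "b \<in> disc_analytic" by (simp add: Hinf_unit_ball_def Hinf_def)
  fix z assume z: "z \<in> unit_disc"
  have "bdd_above ((\<lambda>z. cmod (b z)) ` unit_disc)"
    using b by (auto simp: Hinf_unit_ball_def Hinf_def bounded_iff bdd_above_def)
  then have "cmod (b z) \<le> Hinf_norm b" unfolding Hinf_norm_def by (intro cSUP_upper z)
  then show "cmod (b z) \<le> 1" using b by (simp add: Hinf_unit_ball_def)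
next
  assume b: "b \<in> disc_analytic" "\<forall>z\<in>unit_disc. cmod (b z) \<le> 1"
  have "Hinf_norm b \<le> 1" unfolding Hinf_norm_def using b(2) by (intro cSUP_least) auto
  moreover have "bounded (b ` unit_disc)" using b(2) by (auto simp: bounded_iff)
  ultimately show "b \<in> Hinf_unit_ball" using b(1) by (simp add: Hinf_unit_ball_def Hinf_def)
qed

text \<open>
  Inside the segment through \<open>b\<close> there is a symmetric segment from \<open>b - h\<close> to \<open>b + h\<close>, and
  \<open>2 (|h|\<^sup>2 + |b|\<^sup>2) = |b + h|\<^sup>2 + |b - h|\<^sup>2 \<le> 2\<close>.
\<close>

lemma not_extreme_imp_mate:
  assumes b: "b \<in> Hinf_unit_ball" and ne: "\<not> b extreme_point_of Hinf_unit_ball"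
  obtains h w where "h holomorphic_on unit_disc" "\<And>z. cmod z < 1 \<Longrightarrow> (cmod (h z))\<^sup>2 + (cmod (b z))\<^sup>2 \<le> 1" "cmod w < 1" "h w \<noteq> 0"
proof -
  obtain u v where u: "u \<in> Hinf_unit_ball" and v: "v \<in> Hinf_unit_ball" and seg: "b \<in> open_segment u v"
    using b ne unfolding extreme_point_of_def by blast
  from seg obtain t where t: "0 < t" "t < 1" "b = (1 - t) *\<^sub>R u + t *\<^sub>R v" and uv: "u \<noteq> v"
    unfolding in_segment by blast
  have bz: "b z = of_real (1 - t) * u z + of_real t * v z" for z
    using t(3) by (simp add: scaleR_fun_def scaleR_conv_of_real)
  define s where "s = min t (1 - t)"
  have s: "0 < s" "s \<le> t" "s \<le> 1 - t" using t by (auto simp: s_def)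
  define h where "h z = of_real s * (v z - u z)" for z
  have u': "u holomorphic_on unit_disc" "\<And>z. cmod z < 1 \<Longrightarrow> cmod (u z) \<le> 1" "\<And>z. \<not> cmod z < 1 \<Longrightarrow> u z = 0"
    and v': "v holomorphic_on unit_disc" "\<And>z. cmod z < 1 \<Longrightarrow> cmod (v z) \<le> 1" "\<And>z. \<not> cmod z < 1 \<Longrightarrow> v z = 0"
    using u v by (auto simp: Hinf_unit_ball_iff disc_analytic_def)
  obtain w where w: "u w \<noteq> v w" using uv by blast
  show ?thesis
  proof (rule that)
    show "h holomorphic_on unit_disc" unfolding h_def by (intro holomorphic_intros u' v')
    show "cmod w < 1" using w u'(3) v'(3) by metis
    show "h w \<noteq> 0" using w s by (simp add: h_def)
    fix z :: complex assume z: "cmod z < 1"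
    have conv: "cmod (of_real (1 - r) * u z + of_real r * v z) \<le> 1" if "0 \<le> r" "r \<le> 1" for r
    proof -
      have "cmod (of_real (1 - r) * u z + of_real r * v z) \<le> (1 - r) * cmod (u z) + r * cmod (v z)"
        using norm_triangle_ineq[of "of_real (1 - r) * u z" "of_real r * v z"] that
        by (simp add: norm_mult del: of_real_diff)
      also have "\<dots> \<le> (1 - r) * 1 + r * 1"
        using that u'(2)[OF z] v'(2)[OF z] by (intro add_mono mult_left_mono) auto
      finally show ?thesis by simp
    qed
    have "b z + h z = of_real (1 - (t + s)) * u z + of_real (t + s) * v z"
      "b z - h z = of_real (1 - (t - s)) * u z + of_real (t - s) * v z"
      by (simp_all add: bz h_def algebra_simps)
    then have "cmod (b z + h z) \<le> 1" "cmod (b z - h z) \<le> 1"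
      using conv[of "t + s"] conv[of "t - s"] s t by simp_all
    then have "(cmod (b z + h z))\<^sup>2 \<le> 1" "(cmod (b z - h z))\<^sup>2 \<le> 1" by (simp_all add: power_le_one)
    moreover have "(cmod (b z + h z))\<^sup>2 + (cmod (b z - h z))\<^sup>2 = 2 * ((cmod (h z))\<^sup>2 + (cmod (b z))\<^sup>2)"
      unfolding cmod_power2 by (simp add: power2_eq_square algebra_simps)
    ultimately show "(cmod (h z))\<^sup>2 + (cmod (b z))\<^sup>2 \<le> 1" by argo
  qed
qed

text \<open>
  The points \<open>b \<plusminus> a\<^sup>2/2\<close> lie in the ball, because \<open>1 - |b| - (1 - |b|\<^sup>2)/2 = (1 - |b|)\<^sup>2/2 \<ge> 0\<close>.
\<close>

lemma mate_imp_not_extreme: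
  assumes b: "b \<in> Hinf_unit_ball" and a: "a holomorphic_on unit_disc"
    and ab: "\<And>z. cmod z < 1 \<Longrightarrow> (cmod (a z))\<^sup>2 + (cmod (b z))\<^sup>2 \<le> 1" and w: "cmod w < 1" "a w \<noteq> 0"
  shows "\<not> b extreme_point_of Hinf_unit_ball"
proof
  assume ext: "b extreme_point_of Hinf_unit_ball"
  \<comment> \<open>Cut off outside the disc, where elements of the ball vanish by convention.\<close>
  define h where "h z = (if cmod z < 1 then (a z)\<^sup>2 / 2 else 0)" for z
  have "(\<lambda>z. (a z)\<^sup>2 / 2) holomorphic_on unit_disc" by (intro holomorphic_intros a) simp
  then have h: "h holomorphic_on unit_disc" by (rule holomorphic_transform) (simp add: h_def)
  have b': "b holomorphic_on unit_disc" "\<And>z. \<not> cmod z < 1 \<Longrightarrow> b z = 0"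
    using b by (auto simp: Hinf_unit_ball_iff disc_analytic_def)
  have bd: "cmod (b z) + cmod (h z) \<le> 1" if z: "cmod z < 1" for z
  proof -
    have "cmod (h z) = (cmod (a z))\<^sup>2 / 2" using z by (simp add: h_def norm_divide norm_power)
    with ab[OF z] zero_le_power2[of "1 - cmod (b z)"] show ?thesis by (simp add: power2_diff)
  qed
  have mem: "(\<lambda>z. b z + c * h z) \<in> Hinf_unit_ball" if "cmod c = 1" for c
  proof -
    have "(\<lambda>z. b z + c * h z) \<in> disc_analytic"
      using b'(2) by (auto simp: disc_analytic_def intro!: holomorphic_intros b'(1) h) (simp add: h_def)
    moreover have "cmod (b z + c * h z) \<le> 1" if "cmod z < 1" for z
      using norm_triangle_ineq[of "b z" "c * h z"] bd[OF that] \<open>cmod c = 1\<close> by (simp add: norm_mult)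
    ultimately show ?thesis by (simp add: Hinf_unit_ball_iff)
  qed
  have "b \<in> open_segment (\<lambda>z. b z + (-1) * h z) (\<lambda>z. b z + 1 * h z)"
    unfolding in_segment
  proof (intro conjI exI[of _ "1/2"])
    have "h w \<noteq> 0" using w by (simp add: h_def)
    then show "(\<lambda>z. b z + (-1) * h z) \<noteq> (\<lambda>z. b z + 1 * h z)" by (auto simp: fun_eq_iff intro!: exI[of _ w])
    show "b = (1 - 1/2) *\<^sub>R (\<lambda>z. b z + (-1) * h z) + (1/2) *\<^sub>R (\<lambda>z. b z + 1 * h z)"
      by (simp add: fun_eq_iff scaleR_fun_def scaleR_conv_of_real field_simps)
  qed auto
  with ext mem[of "-1"] mem[of 1] show False by (simp add: extreme_point_of_def)
qed

section \<open>The space \<open>H(b)\<close> and its backward shift\<close>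

lemma bshift_eigenvector:
  assumes f: "bshift f = \<omega> *\<^sub>C f" "f \<noteq> 0"
  shows "cmod \<omega> < 1" "coef f 0 \<noteq> 0" "f = coef f 0 *\<^sub>C szego (cnj \<omega>)"
proof -
  have c: "coef f n = coef f 0 * \<omega> ^ n" for n
  proof (induction n)
    case (Suc n)
    have "coef f (Suc n) = \<omega> * coef f n" by (metis bshift.rep_eq cmul.rep_eq f(1))
    with Suc show ?case by simp
  qed simp
  show f0: "coef f 0 \<noteq> 0"
  proof
    assume "coef f 0 = 0"
    then have "f = 0" by (intro ell2_eqI) (metis c mult_zero_left zero_ell2.rep_eq)
    with f show False by simp
  qed
  show "cmod \<omega> < 1"
  proof (rule ccontr)
    assume "\<not> cmod \<omega> < 1"
    then have ge: "1 \<le> (cmod \<omega> ^ n)\<^sup>2" for n by (simp add: one_le_power)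
    have "(\<lambda>n. (cmod (coef f n))\<^sup>2) \<longlonglongrightarrow> 0" by (rule summable_LIMSEQ_zero[OF summable_coef])
    moreover have "(cmod (coef f n))\<^sup>2 \<ge> (cmod (coef f 0))\<^sup>2" for n
      using mult_left_mono[OF ge[of n], of "(cmod (coef f 0))\<^sup>2"]
      by (subst c) (simp add: norm_mult norm_power power_mult_distrib)
    ultimately have "(cmod (coef f 0))\<^sup>2 \<le> 0" using LIMSEQ_le_const by blast
    with f0 show False by simp
  qed
  then show "f = coef f 0 *\<^sub>C szego (cnj \<omega>)" by (intro ell2_eqI, subst c) (simp add: szego.rep_eq)
qed

lemma H2_eq_range: "H2 = range hfun"
  by (auto elim: H2_imp_hfun)

lemma ip_norm_H2: "ip_norm H2_ip (hfun f) = norm f"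
  by (simp add: ip_norm_def norm_eq_sqrt_inner)

lemma backward_shift_hfun: "backward_shift (hfun f) = hfun (bshift f)"
proof
  fix z
  have "deriv (hfun f) 0 = coef f 1"
  proof -
    have "taylor_coeff (hfun f) 1 = deriv (hfun f) 0"
      by (simp add: taylor_coeff_def fps_expansion_def del: taylor_coeff_hfun)
    then show ?thesis by simp
  qed
  then show "backward_shift (hfun f) z = hfun (bshift f) z"
    using ev_bshift[of z f] hfun_outside[of z "bshift f"]
    by (auto simp: backward_shift_def hfun_def field_simps)
qed

context schur
begin

text \<open>
  The orthogonal complement of the kernel of \<open>R\<close>; it is mapped isometrically onto \<open>H(b)\<close>.
\<close>

abbreviation N :: "ell2 set" where "N \<equiv> closure (range R)"

lemma N_cmul: "x \<in> N \<Longrightarrow> c *\<^sub>C x \<in> N"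
proof -
  assume "x \<in> N"
  moreover have "(\<lambda>x. c *\<^sub>C x) ` N \<subseteq> closure ((\<lambda>x. c *\<^sub>C x) ` range R)"
    by (rule closure_bounded_linear_image_subset[OF bounded_linear_cmul])
  moreover have "(\<lambda>x. c *\<^sub>C x) ` range R \<subseteq> range R" by (auto simp flip: bounded_clinearD(2)[OF R_clinear])
  ultimately show ?thesis using closure_mono by blast
qed

lemma N_subspace: "subspace N"
  unfolding subspace_def
proof (intro conjI ballI allI)
  show "0 \<in> N" using closure_subset[of "range R"] bounded_clinearD(5)[OF R_clinear] by (metis rangeI subsetD)
  show "x + y \<in> N" if x: "x \<in> N" and y: "y \<in> N" for x y
  proof -
    obtain f where f: "(\<lambda>n. R (f n)) \<longlonglongrightarrow> x" using x by (rule closure_range_sequence)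
    obtain g where g: "(\<lambda>n. R (g n)) \<longlonglongrightarrow> y" using y by (rule closure_range_sequence)
    from f g have "(\<lambda>n. R (f n + g n)) \<longlonglongrightarrow> x + y" by (simp add: bounded_clinearD(3)[OF R_clinear] tendsto_add)
    then show ?thesis unfolding closure_sequential by (intro exI[of _ "\<lambda>n. R (f n + g n)"]) simp
  qed
  show "r *\<^sub>R x \<in> N" if "x \<in> N" for r x using that by (simp add: scaleR_cmul N_cmul)
qed

lemma N_orth_kernel: "x \<in> N \<Longrightarrow> R g = 0 \<Longrightarrow> cip x g = 0"
proof -
  assume g: "R g = 0"
  assume "x \<in> N"
  then obtain f where f: "(\<lambda>n. R (f n)) \<longlonglongrightarrow> x" by (rule closure_range_sequence)
  from tendsto_cip_left[OF f, of g] show ?thesis by (simp add: cip_R g LIMSEQ_const_iff)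
qed

lemma range_R_rep:
  assumes "\<And>f. \<bar>f \<bullet> u\<bar> \<le> C * norm (R f)" "C \<ge> 0"
  obtains x where "x \<in> N" "R x = u" "norm x \<le> C"
  using range_symmetricI[OF R(1,2) assms] by blast

lemma range_R_N: obtains x where "x \<in> N" "R x = R f"
proof (rule range_R_rep)
  show "\<bar>g \<bullet> R f\<bar> \<le> norm f * norm (R g)" for g
    using Cauchy_Schwarz_ineq2[of "R g" f] by (simp add: R(2) mult.commute)
qed auto

lemma bshift_R:
  assumes "x \<in> N"
  obtains y where "y \<in> N" "R y = bshift (R x)" "norm y \<le> norm x"
proof (rule range_R_rep)
  show "\<bar>f \<bullet> bshift (R x)\<bar> \<le> norm x * norm (R f)" for f
  proof -
    have "\<bar>f \<bullet> bshift (R x)\<bar> = \<bar>R (shift f) \<bullet> x\<bar>" by (simp add: R(2) flip: inner_shift)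
    also have "\<dots> \<le> norm (R (shift f)) * norm x" by (rule Cauchy_Schwarz_ineq2)
    also have "\<dots> \<le> norm x * norm (R f)" using mult_right_mono[OF norm_R_shift_le] by (simp add: mult.commute)
    finally show ?thesis .
  qed
qed auto

text \<open>
  A positive operator on a complex space is symmetric by polarisation, and a square root of \<open>I - T T\<^sup>*\<close> commutes
  with \<open>I - T T\<^sup>*\<close>, hence with \<open>R\<close>; so \<open>positive_sqrt_unique\<close> applies.
\<close>

lemma sqrt_op_unique:
  assumes bo: "bounded_operator H2 H2_ip S" and pos: "\<forall>f\<in>H2. H2_ip (S f) f \<in> \<real>\<^sub>\<ge>\<^sub>0"
    and sq: "\<And>f. S (S (hfun f)) = hfun (f - T (Ts f))"
  shows "S (hfun f) = hfun (R f)"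
proof -
  have "\<exists>g. S (hfun f) = hfun g" for f
    using bo H2_imp_hfun by (metis bounded_operator_def hfun_in_H2)
  then obtain r where r: "\<And>f. S (hfun f) = hfun (r f)" by metis
  have r_add: "r (f + g) = r f + r g" for f g
    using bo unfolding bounded_operator_def by (metis hfun_add hfun_eq_iff hfun_in_H2 r)
  have r_cmul: "r (c *\<^sub>C f) = c *\<^sub>C r f" for c f
    using bo unfolding bounded_operator_def by (metis hfun_cmul hfun_eq_iff hfun_in_H2 r)
  obtain K where K: "\<And>f. f \<in> H2 \<Longrightarrow> ip_norm H2_ip (S f) \<le> K * ip_norm H2_ip f"
    using bo unfolding bounded_operator_def by blast
  have bl: "bounded_linear r"
    by (rule bounded_linear_intro[of _ K])
      (use K[OF hfun_in_H2] in \<open>simp_all add: r_add scaleR_cmul r_cmul r ip_norm_H2 mult.commute\<close>)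
  have real: "cip (r f) f \<in> \<real>\<^sub>\<ge>\<^sub>0" for f using bspec[OF pos hfun_in_H2[of f]] by (simp add: r)
  then have Im: "Im (cip (r f) f) = 0" for f by (meson complex_is_Real_iff nonneg_Reals_subset_Reals subsetD)
  have sym: "r f \<bullet> g = f \<bullet> r g" for f g
  proof -
    \<comment> \<open>Polarisation with \<open>f + i g\<close>; complex scalars are essential here.\<close>
    have 1: "Im (cip (r f) (\<i> *\<^sub>C g)) + Im (cip (r (\<i> *\<^sub>C g)) f) = 0"
      using Im[of "f + \<i> *\<^sub>C g"] Im[of f] Im[of "\<i> *\<^sub>C g"] by (simp add: r_add cip_add_left cip_add_right)
    then have "Re (cip (r g) f) = Re (cip (r f) g)" by (simp add: r_cmul)
    then show ?thesis by (simp add: inner_commute)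
  qed
  have rr: "r (r f) = f - T (Ts f)" for f using sq[of f] by (simp add: r)
  have "R = r"
  proof (rule positive_sqrt_unique[OF bounded_linear.linear[OF R(1)] R(2,3) bounded_linear.linear[OF bl] sym])
    show "r f \<bullet> f \<ge> 0" for f using real[of f] by (simp add: complex_nonneg_Reals_iff)
    show "R (r f) = r (R f)" for f by (rule R(5)[OF bl, symmetric]) (simp flip: rr)
    show "R (R f) = r (r f)" for f by (simp add: R(4) rr)
  qed
  then show ?thesis using r by simp
qed

end

text \<open>
  The multiplier as an element of the function space, extended by zero beyond the disc.
\<close>

locale schur_disc = schur +
  assumes outside: "\<And>z. z \<notin> unit_disc \<Longrightarrow> b z = 0"
begin

lemma toeplitz_hfun: "toeplitz b (hfun f) = hfun (T f)"
proof
  show "toeplitz b (hfun f) z = hfun (T f) z" for z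
    using outside[of z] hfun_outside[of z "T f"] by (cases "cmod z < 1") (auto simp: toeplitz_def hfun_def T)
qed

lemma toeplitz_adj_hfun: "toeplitz_adj b (hfun g) = hfun (Ts g)"
  unfolding toeplitz_adj_def adjoint_op_def
proof (rule the_equality)
  show "hfun (Ts g) \<in> H2 \<and> (\<forall>f\<in>H2. H2_ip (toeplitz b f) (hfun g) = H2_ip f (hfun (Ts g)))"
    by (auto elim!: H2_imp_hfun simp: toeplitz_hfun cip_Ts)
  fix h assume h: "h \<in> H2 \<and> (\<forall>f\<in>H2. H2_ip (toeplitz b f) (hfun g) = H2_ip f h)"
  then obtain h' where h': "h = hfun h'" using H2_imp_hfun by blast
  have "cip f (Ts g) = cip f h'" for f
    using h[THEN conjunct2, rule_format, OF hfun_in_H2[of f]] by (simp add: toeplitz_hfun h' cip_Ts)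
  then have "f \<bullet> h' = f \<bullet> Ts g" for f by (metis Re_cip)
  then have "h' = Ts g" by (rule inner_eq_imp_eq)
  then show "h = hfun (Ts g)" by (simp add: h')
qed

lemma defect_op_hfun: "defect_op b (hfun f) = hfun (R f)"
proof -
  define A where "A = (\<lambda>f. f - toeplitz b (toeplitz_adj b f))"
  have A: "A (hfun f) = hfun (f - T (Ts f))" for f
    by (simp add: A_def toeplitz_adj_hfun toeplitz_hfun hfun_diff)
  let ?P = "\<lambda>S. bounded_operator H2 H2_ip S \<and> (\<forall>f\<in>H2. H2_ip (S f) f \<in> \<real>\<^sub>\<ge>\<^sub>0) \<and> (\<forall>f\<in>H2. S (S f) = A f) \<and> (\<forall>f. f \<notin> H2 \<longrightarrow> S f = 0)"
  define D where "D F = (if F \<in> H2 then hfun (R (inv hfun F)) else 0)" for F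
  have inv: "inv hfun (hfun f) = f" for f by (rule inv_f_f) (simp add: inj_def)
  have D: "D (hfun f) = hfun (R f)" for f by (simp add: D_def inv)
  have "?P D"
  proof (intro conjI ballI allI impI)
    show "bounded_operator H2 H2_ip D"
      unfolding bounded_operator_def
    proof (intro conjI ballI allI)
      show "\<exists>C. \<forall>f\<in>H2. ip_norm H2_ip (D f) \<le> C * ip_norm H2_ip f"
        by (rule exI[of _ 1]) (auto elim!: H2_imp_hfun simp: D ip_norm_H2 norm_R_le)
    qed (auto elim!: H2_imp_hfun simp: D bounded_clinearD[OF R_clinear] simp flip: hfun_add hfun_cmul)
    show "H2_ip (D F) F \<in> \<real>\<^sub>\<ge>\<^sub>0" if F: "F \<in> H2" for F
    proof -
      obtain f where f: "F = hfun f" using F H2_imp_hfun by blast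
      have "cip (R f) f = cnj (cip (R f) f)" using cip_commute[of "R f" f] by (simp add: cip_R)
      then have "Im (cip (R f) f) = 0" by (simp add: complex_eq_iff)
      then show ?thesis using R(3)[of f] by (simp add: f D complex_nonneg_Reals_iff)
    qed
    show "D (D F) = A F" if "F \<in> H2" for F
      using that by (auto elim!: H2_imp_hfun simp: D A R(4))
  qed (simp add: D_def)
  moreover have "S = D" if S: "?P S" for S
  proof
    fix F
    show "S F = D F"
    proof (cases "F \<in> H2")
      case True
      then obtain f where f: "F = hfun f" using H2_imp_hfun by blast
      have "S (hfun f) = hfun (R f)"
        by (rule sqrt_op_unique) (use S A in auto)
      then show ?thesis by (simp add: f D)
    qed (use S in \<open>simp add: D_def\<close>)
  qed
  ultimately have "sqrt_op H2 H2_ip A = D" unfolding sqrt_op_def by (rule the_equality)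
  then show ?thesis using D by (simp add: defect_op_def A_def)
qed

lemma dBR_eq: "dBR b = (\<lambda>x. hfun (R x)) ` N"
proof -
  have "dBR b = range (\<lambda>f. hfun (R f))"
    by (simp add: dBR_def H2_eq_range image_image defect_op_hfun)
  also have "\<dots> = (\<lambda>x. hfun (R x)) ` N" using range_R_N by (auto simp: image_iff) metis
  finally show ?thesis .
qed

lemma dBR_lift: "x \<in> N \<Longrightarrow> dBR_lift b (hfun (R x)) = hfun x"
  unfolding dBR_lift_def
proof (rule the_equality)
  assume x: "x \<in> N"
  show "hfun x \<in> H2 \<and> (\<forall>g\<in>H2. defect_op b g = 0 \<longrightarrow> H2_ip (hfun x) g = 0) \<and> defect_op b (hfun x) = hfun (R x)"
  proof (intro conjI ballI impI)
    fix F assume F: "F \<in> H2" "defect_op b F = 0"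
    then obtain g where g: "F = hfun g" using H2_imp_hfun by blast
    then have "R g = 0" using F(2) by (metis defect_op_hfun hfun_eq_iff hfun_zero)
    then show "H2_ip (hfun x) F = 0" by (simp add: g N_orth_kernel[OF x])
  qed (simp_all add: defect_op_hfun)
  fix F assume F: "F \<in> H2 \<and> (\<forall>g\<in>H2. defect_op b g = 0 \<longrightarrow> H2_ip F g = 0) \<and> defect_op b F = hfun (R x)"
  then obtain f where f: "F = hfun f" using H2_imp_hfun by blast
  have Rf: "R f = R x" using F by (simp add: f defect_op_hfun)
  then have ker: "R (f - x) = 0" by (simp add: bounded_clinearD[OF R_clinear])
  have "H2_ip F (hfun (f - x)) = 0" using F ker by (simp add: defect_op_hfun)
  then have "cip f (f - x) = 0" by (simp add: f)
  moreover have "cip x (f - x) = 0" by (rule N_orth_kernel[OF x ker])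
  ultimately have "cip (f - x) (f - x) = 0" by (simp add: cip_diff_left)
  then show "F = hfun x" by (simp add: cip_self f)
qed

lemma dBR_ip: "x \<in> N \<Longrightarrow> y \<in> N \<Longrightarrow> dBR_ip b (hfun (R x)) (hfun (R y)) = cip x y"
  by (simp add: dBR_ip_def dBR_lift)

lemma dBR_norm: "x \<in> N \<Longrightarrow> ip_norm (dBR_ip b) (hfun (R x)) = norm x"
  by (simp add: ip_norm_def dBR_ip norm_eq_sqrt_inner)

lemma X_op_hfun: "x \<in> N \<Longrightarrow> X_op b (hfun (R x)) = hfun (bshift (R x))"
  by (simp add: X_op_def dBR_eq backward_shift_hfun)

lemma eigenspace_eq: "eigenspace (dBR b) (X_op b) \<omega> = {hfun (R x) |x. x \<in> N \<and> bshift (R x) = \<omega> *\<^sub>C R x}"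
proof -
  have "X_op b (hfun (R x)) - cscale \<omega> (hfun (R x)) = 0 \<longleftrightarrow> bshift (R x) = \<omega> *\<^sub>C R x" if "x \<in> N" for x
    using that by (simp add: X_op_hfun flip: hfun_cmul)
  then show ?thesis unfolding eigenspace_def dBR_eq by auto
qed

lemma bounded_operator_X: "bounded_operator (dBR b) (dBR_ip b) (X_op b)"
  unfolding bounded_operator_def
proof (intro conjI ballI allI)
  note Rl = bounded_clinearD[OF R_clinear] and Bl = bounded_clinearD[OF bounded_clinear_bshift]
  show "X_op b F \<in> dBR b" if F: "F \<in> dBR b" for F
  proof -
    obtain x where x: "x \<in> N" "F = hfun (R x)" using F by (auto simp: dBR_eq)
    obtain y where "y \<in> N" "R y = bshift (R x)" by (rule bshift_R[OF x(1)])
    then show ?thesis by (metis X_op_hfun dBR_eq imageI x)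
  qed
  show "X_op b (F + H) = X_op b F + X_op b H" if FH: "F \<in> dBR b" "H \<in> dBR b" for F H
  proof -
    obtain x y where xy: "x \<in> N" "F = hfun (R x)" "y \<in> N" "H = hfun (R y)" using FH by (auto simp: dBR_eq)
    then have "x + y \<in> N" using N_subspace by (simp add: subspace_add)
    then have "X_op b (hfun (R (x + y))) = hfun (bshift (R (x + y)))" by (rule X_op_hfun)
    then show ?thesis using xy by (simp add: X_op_hfun Rl Bl hfun_add)
  qed
  show "X_op b (cscale c F) = cscale c (X_op b F)" if F: "F \<in> dBR b" for F c
  proof -
    obtain x where x: "x \<in> N" "F = hfun (R x)" using F by (auto simp: dBR_eq)
    then have "X_op b (hfun (R (c *\<^sub>C x))) = hfun (bshift (R (c *\<^sub>C x)))" by (intro X_op_hfun N_cmul)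
    then show ?thesis using x by (simp add: X_op_hfun Rl Bl hfun_cmul)
  qed
  show "\<exists>C. \<forall>F\<in>dBR b. ip_norm (dBR_ip b) (X_op b F) \<le> C * ip_norm (dBR_ip b) F"
  proof (intro exI[of _ 1] ballI)
    fix F assume "F \<in> dBR b"
    then obtain x where x: "x \<in> N" "F = hfun (R x)" by (auto simp: dBR_eq)
    obtain y where "y \<in> N" "R y = bshift (R x)" "norm y \<le> norm x" by (rule bshift_R[OF x(1)])
    then show "ip_norm (dBR_ip b) (X_op b F) \<le> 1 * ip_norm (dBR_ip b) F"
      using x by (metis X_op_hfun dBR_norm mult_1)
  qed
qed

end

context schur_disc
begin

section \<open>Membership in the Cowen-Douglas classes\<close>

text \<open>
  If \<open>k\<^sub>\<alpha> = R x\<close>, then \<open>b(\<alpha>) g(\<alpha>) = (T g)(\<alpha>) = \<langle>R T g, x\<rangle>\<close> is bounded by \<open>\<parallel>R T g\<parallel> \<le> \<parallel>G g\<parallel>\<close>, and a bounded evaluation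
  produces a mate.
\<close>

lemma szego_in_range_imp_not_extreme:
  assumes b: "b \<in> Hinf_unit_ball" and \<alpha>: "cmod \<alpha> < 1" "b \<alpha> \<noteq> 0" and x: "R x = szego \<alpha>"
  shows "\<not> b extreme_point_of Hinf_unit_ball"
proof -
  have bd: "cmod (ev \<alpha> g) \<le> norm x / cmod (b \<alpha>) * norm (G g)" for g
  proof -
    have "cmod (b \<alpha>) * cmod (ev \<alpha> g) = cmod (ev \<alpha> (T g))" by (simp add: T \<alpha> norm_mult)
    also have "\<dots> = cmod (cip (R (T g)) x)" by (simp add: ev_def cip_R x)
    also have "\<dots> \<le> norm (R (T g)) * norm x" by (rule norm_cip_le)
    also have "\<dots> \<le> norm (G g) * norm x" by (intro mult_right_mono norm_R_T_le) simp
    finally show ?thesis using \<alpha>(2) by (simp add: field_simps)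
  qed
  obtain V X where V: "bounded_clinear V" "\<And>f. V (shift f) = shift (V f)" "\<And>f. norm (V f) \<le> norm (G f)"
    and X: "(\<lambda>m. V (X m)) \<longlonglongrightarrow> monomial 0"
    by (rule outer_factor[OF \<alpha>(1) bd]) blast
  define a where "a z = ev z (V (monomial 0))" for z
  have ev_V: "ev z (V f) = a z * ev z f" if "cmod z < 1" for z f
    unfolding a_def by (rule shift_commuting_imp_mult[OF V(1,2) that])
  show ?thesis
  proof (rule mate_imp_not_extreme[OF b])
    show "a holomorphic_on unit_disc" unfolding a_def by (rule ev_holomorphic)
    show "(cmod (a z))\<^sup>2 + (cmod (b z))\<^sup>2 \<le> 1" if "cmod z < 1" for z
    proof (rule norm_mult_pair_bound[OF ev_V T(1) _ that])
      show "(norm (V f))\<^sup>2 + (norm (T f))\<^sup>2 \<le> (norm f)\<^sup>2" for f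
        using power_mono[OF V(3)[of f], of 2] by (simp add: norm_G_squared)
    qed
    show "a 0 \<noteq> 0"
    proof
      assume "a 0 = 0"
      then have "ev 0 (V (X m)) = 0" for m using ev_V[of 0 "X m"] by simp
      with tendsto_ev[OF X, of 0] show False by (simp add: LIMSEQ_const_iff)
    qed
  qed simp
qed

text \<open>
  Nontrivial eigenspaces over \<open>\<Omega>\<close> put the kernels at the conjugates of its points into \<open>H(b)\<close>. Where they do, \<open>b\<close>
  vanishes, so \<open>b = 0\<close> on the disc by the identity theorem; but \<open>0\<close> has the constant mate \<open>1\<close>.
\<close>

lemma extreme_imp_not_cowen_douglas:
  assumes b: "b \<in> Hinf_unit_ball" and ext: "b extreme_point_of Hinf_unit_ball"
    and n: "n \<ge> 1" and \<Omega>: "open \<Omega>" "\<Omega> \<noteq> {}"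
  shows "X_op b \<notin> cowen_douglas (dBR b) (dBR_ip b) n \<Omega>"
proof
  assume cd: "X_op b \<in> cowen_douglas (dBR b) (dBR_ip b) n \<Omega>"
  have eigen: "cmod \<omega> < 1 \<and> (\<exists>x. R x = szego (cnj \<omega>))" if \<omega>: "\<omega> \<in> \<Omega>" for \<omega>
  proof -
    let ?E = "eigenspace (dBR b) (X_op b) \<omega>"
    have "cfun.dim ?E = n" using cd \<omega> by (simp add: cowen_douglas_def)
    have "\<not> ?E \<subseteq> {0}"
    proof
      assume "?E \<subseteq> {0}"
      then have "cfun.dim ?E \<le> card ({} :: cvec set)" by (intro cfun.dim_le_card) auto
      with \<open>cfun.dim ?E = n\<close> n show False by simp
    qed
    then obtain x where x: "bshift (R x) = \<omega> *\<^sub>C R x" "R x \<noteq> 0"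
      unfolding eigenspace_eq by (auto simp del: hfun_zero) (metis hfun_zero)
    note ev = bshift_eigenvector[OF x]
    have "R ((1 / coef (R x) 0) *\<^sub>C x) = (1 / coef (R x) 0) *\<^sub>C (coef (R x) 0 *\<^sub>C szego (cnj \<omega>))"
      using ev(3) by (metis bounded_clinearD(2)[OF R_clinear])
    then have "R ((1 / coef (R x) 0) *\<^sub>C x) = szego (cnj \<omega>)" using ev(2) by simp
    with ev(1) show ?thesis by blast
  qed
  define U where "U = cnj -` \<Omega>"
  have "open U" unfolding U_def by (intro open_vimage \<Omega> continuous_intros)
  have "U \<noteq> {}"
  proof -
    obtain \<omega> where "\<omega> \<in> \<Omega>" using \<Omega>(2) by blast
    then have "cnj \<omega> \<in> U" by (simp add: U_def)
    then show ?thesis by blast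
  qed
  have U_disc: "U \<subseteq> unit_disc" using eigen by (auto simp: U_def) (metis complex_mod_cnj)
  have "\<exists>\<alpha>\<in>U. b \<alpha> \<noteq> 0"
  proof (rule ccontr)
    assume zero: "\<not> (\<exists>\<alpha>\<in>U. b \<alpha> \<noteq> 0)"
    have "b z = 0" if "z \<in> unit_disc" for z
      by (rule analytic_continuation_open[OF \<open>open U\<close> open_ball \<open>U \<noteq> {}\<close> connected_ball U_disc hol])
        (use zero that in auto)
    then have "\<not> b extreme_point_of Hinf_unit_ball"
      by (intro mate_imp_not_extreme[OF b, of "\<lambda>_. 1" 0]) auto
    with ext show False by simp
  qed
  then obtain \<alpha> where \<alpha>: "cnj \<alpha> \<in> \<Omega>" "b \<alpha> \<noteq> 0" by (auto simp: U_def)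
  with eigen[OF \<alpha>(1)] obtain x where "cmod \<alpha> < 1" "R x = szego \<alpha>" by auto
  with szego_in_range_imp_not_extreme[OF b _ \<alpha>(2)] ext show False by blast
qed

text \<open>
  A mate of \<open>b\<close> bounds all evaluations by \<open>\<parallel>G f\<parallel>\<close>, hence those of \<open>T\<^sup>* f\<close> and of \<open>f\<close> by \<open>\<parallel>R f\<parallel>\<close>. This places the
  kernels in \<open>H(b)\<close>, makes them total, and makes \<open>X\<^sub>b - \<omega>\<close> surjective.
\<close>

lemma not_extreme_imp_cowen_douglas:
  assumes b: "b \<in> Hinf_unit_ball" and ne: "\<not> b extreme_point_of Hinf_unit_ball"
  shows "X_op b \<in> cowen_douglas (dBR b) (dBR_ip b) 1 unit_disc"
proof -
  obtain h w where h: "h holomorphic_on unit_disc" "\<And>z. cmod z < 1 \<Longrightarrow> (cmod (h z))\<^sup>2 + (cmod (b z))\<^sup>2 \<le> 1"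
    and w: "cmod w < 1" "h w \<noteq> 0"
    by (rule not_extreme_imp_mate[OF b ne]) blast
  have G_bd: "\<exists>C\<ge>0. \<forall>f. cmod (ev z f) \<le> C * norm (G f)" if "cmod z < 1" for z
    using ev_bound_of_mate[OF h w that] by metis
  have Ts_bd: "\<exists>C\<ge>0. \<forall>f. cmod (ev z (Ts f)) \<le> C * norm (R f)" if z: "cmod z < 1" for z
  proof -
    obtain C where C: "C \<ge> 0" "\<forall>f. cmod (ev z f) \<le> C * norm (G f)" using G_bd[OF z] by blast
    have "cmod (ev z (Ts f)) \<le> C * norm (R f)" for f
      using C(2)[rule_format, of "Ts f"] mult_left_mono[OF norm_G_Ts_le[of f] C(1)] by linarith
    with C(1) show ?thesis by blast
  qed
  have kernel: "\<exists>x\<in>N. R x = szego z" if z: "cmod z < 1" for z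
  proof -
    obtain C where C: "C \<ge> 0" "\<forall>f. cmod (ev z (Ts f)) \<le> C * norm (R f)" using Ts_bd[OF z] by blast
    obtain x where "x \<in> N" "R x = szego z"
    proof (rule range_R_rep)
      fix f
      have "\<bar>f \<bullet> szego z\<bar> \<le> cmod (ev z f)" using abs_Re_le_cmod[of "ev z f"] by (simp add: ev_def)
      also have "\<dots> \<le> (C + norm (szego z)) * norm (R f)"
        using norm_ev_le_R[OF z, of f] C(2)[rule_format, of f] by (simp add: algebra_simps)
      finally show "\<bar>f \<bullet> szego z\<bar> \<le> (C + norm (szego z)) * norm (R f)" .
    qed (use C(1) in auto)
    then show ?thesis by blast
  qed
  note Rl = bounded_clinearD[OF R_clinear]
  have eigen: "hfun (szego (cnj \<omega>)) \<in> eigenspace (dBR b) (X_op b) \<omega>" if \<omega>: "cmod \<omega> < 1" for \<omega>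
  proof -
    obtain x where x: "x \<in> N" "R x = szego (cnj \<omega>)" using kernel[of "cnj \<omega>"] \<omega> by auto
    then have "bshift (R x) = \<omega> *\<^sub>C R x" by (simp add: bshift_szego)
    with x(1) show ?thesis unfolding eigenspace_eq x(2)[symmetric] by blast
  qed
  have dim: "cfun.dim (eigenspace (dBR b) (X_op b) \<omega>) = 1" if \<omega>: "cmod \<omega> < 1" for \<omega>
  proof (rule cfun.dim_unique[of "{hfun (szego (cnj \<omega>))}"])
    show "{hfun (szego (cnj \<omega>))} \<subseteq> eigenspace (dBR b) (X_op b) \<omega>" using eigen[OF \<omega>] by simp
    show "eigenspace (dBR b) (X_op b) \<omega> \<subseteq> cfun.span {hfun (szego (cnj \<omega>))}"
    proof
      fix F assume "F \<in> eigenspace (dBR b) (X_op b) \<omega>"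
      then obtain x where x: "F = hfun (R x)" "bshift (R x) = \<omega> *\<^sub>C R x" unfolding eigenspace_eq by blast
      obtain c where "R x = c *\<^sub>C szego (cnj \<omega>)"
      proof (cases "R x = 0")
        case True
        then show ?thesis by (intro that[of 0]) simp
      next
        case False
        from that[OF bshift_eigenvector(3)[OF x(2) this]] show ?thesis .
      qed
      then have "F = cscale c (hfun (szego (cnj \<omega>)))" by (simp add: x(1) hfun_cmul)
      then show "F \<in> cfun.span {hfun (szego (cnj \<omega>))}" by (simp add: cfun.span_base cfun.span_scale)
    qed
    have "szego (cnj \<omega>) \<noteq> 0"
    proof
      assume "szego (cnj \<omega>) = 0"
      then have "coef (szego (cnj \<omega>)) 0 = 0" by simp
      then show False using \<omega> by (simp add: szego.rep_eq)
    qed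
    then have "hfun (szego (cnj \<omega>)) \<noteq> 0" by (metis hfun_eq_iff hfun_zero)
    then show "cfun.independent {hfun (szego (cnj \<omega>))}" by simp
  qed simp
  have total: "closed_span (dBR b) (dBR_ip b) (\<Union>\<omega>\<in>unit_disc. eigenspace (dBR b) (X_op b) \<omega>) = dBR b"
  proof
    let ?S = "\<Union>\<omega>\<in>unit_disc. eigenspace (dBR b) (X_op b) \<omega>"
    show "closed_span (dBR b) (dBR_ip b) ?S \<subseteq> dBR b" by (auto simp: closed_span_def)
    show "dBR b \<subseteq> closed_span (dBR b) (dBR_ip b) ?S"
    proof
      fix F assume F: "F \<in> dBR b"
      then obtain x where x: "x \<in> N" "F = hfun (R x)" by (auto simp: dBR_eq)
      \<comment> \<open>The span of the kernels, pulled back to \<open>N\<close>; the component of \<open>x\<close> orthogonal to it is zero.\<close>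
      define M where "M = {y \<in> N. hfun (R y) \<in> cfun.span ?S}"
      have M_cmul: "c *\<^sub>C y \<in> M" if "y \<in> M" for c y
        using that by (auto simp: M_def N_cmul Rl hfun_cmul cfun.span_scale)
      have M_sub: "subspace M"
        unfolding subspace_def
      proof (intro conjI ballI allI)
        show "0 \<in> M" using subspace_0[OF N_subspace] by (simp add: M_def Rl cfun.span_zero)
        show "y + z \<in> M" if "y \<in> M" "z \<in> M" for y z
          using that N_subspace by (auto simp: M_def Rl hfun_add subspace_add cfun.span_add)
        show "r *\<^sub>R y \<in> M" if "y \<in> M" for r y using M_cmul[OF that] by (simp add: scaleR_cmul)
      qed
      obtain y where y: "y \<in> closure ((\<lambda>y. y) ` M)" "\<And>m. m \<in> M \<Longrightarrow> x \<bullet> m = y \<bullet> m"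
      proof (rule riesz_minimizer[of "\<lambda>y. y" "\<lambda>m. x \<bullet> m" M "norm x"])
        show "subspace M" by (rule M_sub)
        show "linear (\<lambda>m. x \<bullet> m)" by (rule bounded_linear.linear[OF bounded_linear_inner_right])
        show "\<bar>x \<bullet> m\<bar> \<le> norm x * norm m" for m by (rule Cauchy_Schwarz_ineq2)
      qed (auto intro: linearI)
      have yN: "y \<in> N" using y(1) closure_mono[of M N] by (auto simp: M_def)
      have "x - y = 0"
      proof -
        obtain C where C: "\<And>f. cmod (ev 0 f) \<le> C * norm (G f)" using G_bd[of 0] by auto
        show ?thesis
        proof (rule kernels_total[OF _ C])
          show "x - y \<in> N" using N_subspace x(1) yN by (rule subspace_diff)
          fix z :: complex assume z: "cmod z < 1"
          obtain k where k: "k \<in> N" "R k = szego z" using kernel[OF z] by blast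
          have "hfun (R k) \<in> ?S" using eigen[of "cnj z"] z by (auto simp: k(2))
          then have kM: "k \<in> M" using k(1) by (simp add: M_def cfun.span_base)
          have "cip (x - y) k = 0"
            unfolding cip_def using y(2)[OF kM] y(2)[OF M_cmul[OF kM, of \<i>]]
            by (simp add: inner_diff_left complex_eq_iff)
          with k(2) show "\<exists>k. R k = szego z \<and> cip (x - y) k = 0" by blast
        qed simp
      qed
      then have xM: "x \<in> closure M" using y(1) by simp
      show "F \<in> closed_span (dBR b) (dBR_ip b) ?S"
        unfolding closed_span_def
      proof (intro CollectI conjI F allI impI)
        fix e :: real assume "e > 0"
        then obtain m where m: "m \<in> M" "dist m x < e" using xM closure_approachable by blast
        have "x - m \<in> N" using N_subspace x(1) m(1) by (intro subspace_diff) (auto simp: M_def)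
        then have "ip_norm (dBR_ip b) (hfun (R (x - m))) = norm (x - m)" by (rule dBR_norm)
        then have "ip_norm (dBR_ip b) (F - hfun (R m)) < e"
          using m(2) by (simp add: x(2) Rl hfun_diff dist_norm norm_minus_commute)
        moreover have "hfun (R m) \<in> cfun.span ?S" using m(1) by (simp add: M_def)
        ultimately show "\<exists>H\<in>cfun.span ?S. ip_norm (dBR_ip b) (F - H) < e" by blast
      qed
    qed
  qed
  have surj: "(\<lambda>F. X_op b F - cscale \<omega> F) ` dBR b = dBR b" if \<omega>: "cmod \<omega> < 1" for \<omega>
  proof -
    have X: "X_op b (hfun (R x)) - cscale \<omega> (hfun (R x)) = hfun (bshift (R x) - \<omega> *\<^sub>C R x)" if "x \<in> N" for x
      using that by (simp add: X_op_hfun hfun_diff hfun_cmul)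
    have "hfun (bshift (R x) - \<omega> *\<^sub>C R x) \<in> dBR b" if x: "x \<in> N" for x
    proof -
      obtain y where y: "y \<in> N" "R y = bshift (R x)" by (rule bshift_R[OF x])
      then have "bshift (R x) - \<omega> *\<^sub>C R x = R (y - \<omega> *\<^sub>C x)" by (simp add: Rl)
      moreover have "y - \<omega> *\<^sub>C x \<in> N" using N_subspace y(1) N_cmul[OF x] by (rule subspace_diff)
      ultimately show ?thesis by (simp add: dBR_eq)
    qed
    moreover have "\<exists>y\<in>N. hfun (R x) = hfun (bshift (R y) - \<omega> *\<^sub>C R y)" for x
    proof -
      obtain C where C: "C \<ge> 0" "\<forall>f. cmod (ev (cnj \<omega>) (Ts f)) \<le> C * norm (R f)" using Ts_bd[of "cnj \<omega>"] \<omega> by auto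
      obtain f where f: "bshift (R f) - \<omega> *\<^sub>C R f = R x"
        by (rule bshift_range_surj[OF \<omega> C(1) C(2)[rule_format]])
      obtain y where "y \<in> N" "R y = R f" by (rule range_R_N)
      with f show ?thesis by (intro bexI[of _ y]) simp_all
    qed
    ultimately show ?thesis by (auto simp: dBR_eq X image_iff)
  qed
  show ?thesis
    unfolding cowen_douglas_def using bounded_operator_X dim total surj by simp
qed

end

theorem theorem1p1:
  fixes b :: "complex \<Rightarrow> complex"
  assumes "b \<in> Hinf" and "Hinf_norm b \<le> 1"
  shows "(b extreme_point_of Hinf_unit_ball \<longrightarrow>
            (\<forall>n::nat. \<forall>\<Omega>::complex set. n \<ge> 1 \<and> open \<Omega> \<and> \<Omega> \<noteq> {} \<longrightarrow>
               X_op b \<notin> cowen_douglas (dBR b) (dBR_ip b) n \<Omega>)) \<and>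
         (\<not> b extreme_point_of Hinf_unit_ball \<longrightarrow>
            X_op b \<in> cowen_douglas (dBR b) (dBR_ip b) 1 unit_disc)"
proof -
  have b: "b \<in> Hinf_unit_ball" using assms by (simp add: Hinf_unit_ball_def)
  then interpret schur_disc b
    by unfold_locales (auto simp: Hinf_unit_ball_iff disc_analytic_def)
  show ?thesis using extreme_imp_not_cowen_douglas[OF b] not_extreme_imp_cowen_douglas[OF b] by blast
qed

end
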